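(* Let $A$ be a finite dimensional Hopf algebra over a field $k$, let $D(A)$ be its Drinfel'd double, and let $M,N$ be left-right Yetter-Drinfel'd modules over $A$, regarded also as left $D(A)$-modules. Let $H^*(M,N)$ be the cohomology of the total complex of the double complex $(Y^{n,p}(M,N),d_m^{n,p},d_c^{n,p})_{n,p\ge 0}$ defined in the context. Then there is a group isomorphism $H^1(M,N)\simeq \mathrm{Ext}^1_{D(A)}(M,N)$.
   Context: $k$ is a field, all linear spaces, tensor products and Homs are over $k$; $A^n$ denotes $A^{\otimes n}$ with $A^0=k$. Sweedler notation: $\Delta(a)=\sum a_1\otimes a_2$, iterated $\sum a_1\otimes\cdots\otimes a_{r}$. A left-right Yetter-Drinfel'd module over a bialgebra $A$ is a $k$-space $M$ that is a left $A$-module ($a\otimes m\mapsto a\cdot m$) and a right $A$-comodule ($\rho_M(m)=\sum m_0\otimes m_1\in M\otimes A$) with $$\sum (a_2\cdot m)_0\otimes (a_2\cdot m)_1a_1=\sum a_1\cdot m_0\otimes a_2m_1\quad\text{for all } a\in A,\ m\in M.$$ Drinfel'd double: for $A$ a finite dimensional Hopf algebra with antipode $S$ (automatically bijective), $D(A)$ as an algebra is $A^*\otimes A$, containing $A^*$ (with convolution product) and $A$ as subalgebras via $q\mapsto q\otimes 1$, $a\mapsto \varepsilon\otimes a$, with $q\otimes a=qa$ and $a\,q=\sum q\bigl(S^{-1}(a_3)\,?\,a_1\bigr)\,a_2$ for $a\in A$, $q\in A^*$. It is well known that left-right Yetter-Drinfel'd modules over $A$ are the same as left $D(A)$-modules (isomorphism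 of categories), where $A\subset D(A)$ acts on $M$ by the given action and $q\in A^*$ acts by $q\cdot m=\sum q(m_1)m_0$. $Y^{n,p}(M,N)=\mathrm{Hom}(A^n\otimes M,N\otimes A^p)$ for $n,p\ge0$. For $f\in Y^{n,p}(M,N)$ write $f(x)=\sum f(x)^0\otimes f(x)^1\otimes\cdots\otimes f(x)^p$ with $f(x)^0\in N$ and $f(x)^j\in A$ for $j\ge1$. Superscripts on $a^1,\dots,a^n\in A$ are indices. Maps $b_i^{n,p}:Y^{n,p}\to Y^{n+1,p}$, $0\le i\le n+1$: - $b_0^{n,p}(f)(a^1\otimes\cdots\otimes a^{n+1}\otimes m)=\sum (a^1)_1\cdot f(x)^0\otimes (a^1)_2f(x)^1\otimes\cdots\otimes(a^1)_{p+1}f(x)^p$, with $x=a^2\otimes\cdots\otimes a^{n+1}\otimes m$; - $b_i^{n,p}(f)(a^1\otimes\cdots\otimes a^{n+1}\otimes m)=f(a^1\otimes\cdots\otimes a^ia^{i+1}\otimes\cdots\otimes a^{n+1}\otimes m)$ for $1\le i\le n$; - $b_{n+1}^{n,p}(f)(a^1\otimes\cdots\otimes a^{n+1}\otimes m)=\sum f(y)^0\otimes f(y)^1(a^{n+1})_1\otimes\cdots\otimes f(y)^p(a^{n+1})_p$, with $y=a^1\otimes\cdots\otimes a^n\otimes (a^{n+1})_{p+1}\cdot m$. Maps $c_i^{n,p}:Y^{n,p}\to Y^{n,p+1}$, $0\le i\le p+1$: - $c_0^{n,p}(f)(a^1\otimes\cdots\otimes a^n\otimes m)=\sum (f(z)^0)_0\otimes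 (f(z)^0)_1(a^1)_1\cdots(a^n)_1\otimes f(z)^1\otimes\cdots\otimes f(z)^p$, with $z=(a^1)_2\otimes\cdots\otimes(a^n)_2\otimes m$; - for $1\le i\le p$, $c_i^{n,p}(f)(x)=\sum f(x)^0\otimes\cdots\otimes (f(x)^i)_1\otimes(f(x)^i)_2\otimes\cdots\otimes f(x)^p$ ($\Delta$ applied to the $i$-th $A$-factor); - $c_{p+1}^{n,p}(f)(a^1\otimes\cdots\otimes a^n\otimes m)=\sum f((a^1)_1\otimes\cdots\otimes(a^n)_1\otimes m_0)\otimes (a^1)_2\cdots(a^n)_2m_1$. (Empty products, when $n=0$, equal $1$.) $d_m^{n,p}=\sum_{i=0}^{n+1}(-1)^ib_i^{n,p}$ and $d_c^{n,p}=\sum_{i=0}^{p+1}(-1)^ic_i^{n,p}$. These satisfy $d_md_m=0$, $d_cd_c=0$, $d_cd_m=d_md_c$. The total complex has degree-$r$ term $\bigoplus_{n+p=r}Y^{n,p}(M,N)$ and differential $d_m^{n,p}+(-1)^nd_c^{n,p}$ on $Y^{n,p}(M,N)$. *)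

theory Defs
  imports Complex_Main "HOL-Library.Function_Algebras" "HOL-Algebra.Module" "HOL-Algebra.Coset"
begin

section \<open>Tensor products over a field\<close>

text \<open>
  A vector space is a subset \<open>vec\<close> of an abelian group type with a scalar multiplication.
  The carrier is needed because the dual of \<open>A\<close> is a proper subset of a function type.
\<close>

record ('k, 'v) kspace =
  vec :: "'v set"
  scl :: "'k \<Rightarrow> 'v \<Rightarrow> 'v"

definition whole :: "('k \<Rightarrow> 'v \<Rightarrow> 'v) \<Rightarrow> ('k, 'v) kspace" where
  "whole s = \<lparr>vec = UNIV, scl = s\<rparr>"

definition klin_on ::
    "('k, 'v::ab_group_add) kspace \<Rightarrow> ('k \<Rightarrow> 'u::ab_group_add \<Rightarrow> 'u) \<Rightarrow> ('v \<Rightarrow> 'u) \<Rightarrow> bool" where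
  "klin_on V s f \<longleftrightarrow>
     (\<forall>x\<in>vec V. \<forall>y\<in>vec V. f (x + y) = f x + f y) \<and>
     (\<forall>c. \<forall>x\<in>vec V. f (scl V c x) = s c (f x))"

definition tuples :: "('k, 'v) kspace \<Rightarrow> ('k, 'w) kspace \<Rightarrow> nat \<Rightarrow> ('v \<times> 'w list) set" where
  "tuples V W p = {(v, ws). v \<in> vec V \<and> length ws = p \<and> set ws \<subseteq> vec W}"

definition multilinear ::
    "('k, 'v::ab_group_add) kspace \<Rightarrow> ('k, 'w::ab_group_add) kspace \<Rightarrow> nat \<Rightarrow>
     ('k \<Rightarrow> 'u::ab_group_add \<Rightarrow> 'u) \<Rightarrow> ('v \<times> 'w list \<Rightarrow> 'u) \<Rightarrow> bool" where
  "multilinear V W p s \<phi> \<longleftrightarrow>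
     (\<forall>(v, ws)\<in>tuples V W p.
        klin_on V s (\<lambda>x. \<phi> (x, ws)) \<and>
        (\<forall>i<p. klin_on W s (\<lambda>x. \<phi> (v, ws[i := x]))))"

text \<open>
  The tensor product of \<open>V\<close> with \<open>p\<close> copies of \<open>W\<close> is realised inside the dual of the space
  of multilinear forms: the pure tensor of a tuple is evaluation at that tuple, and the tensor
  product is the span of the pure tensors.  Over a field this has the universal property
  of the tensor product, see \<open>multilinear_tpure\<close>, \<open>tlift_linear\<close>, \<open>tlift_tpure\<close> and
  \<open>tlift_unique\<close> below.  Addition on this function type is pointwise.
\<close>

type_synonym ('k, 'v, 'w) tensor = "('v \<times> 'w list \<Rightarrow> 'k) \<Rightarrow> 'k"

definition tscale :: "'k::field \<Rightarrow> ('x \<Rightarrow> 'k) \<Rightarrow> 'x \<Rightarrow> 'k" where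
  "tscale c t = (\<lambda>\<beta>. c * t \<beta>)"

definition tpure ::
    "('k::field, 'v::ab_group_add) kspace \<Rightarrow> ('k, 'w::ab_group_add) kspace \<Rightarrow> nat \<Rightarrow>
     'v \<times> 'w list \<Rightarrow> ('k, 'v, 'w) tensor" where
  "tpure V W p x = (\<lambda>\<beta>. if multilinear V W p (*) \<beta> then \<beta> x else 0)"

definition tens ::
    "('k::field, 'v::ab_group_add) kspace \<Rightarrow> ('k, 'w::ab_group_add) kspace \<Rightarrow> nat \<Rightarrow>
     ('k, 'v, 'w) tensor set" where
  "tens V W p = Modules.module.span tscale (tpure V W p ` tuples V W p)"

text \<open>
  For multilinear \<open>\<phi>\<close>, \<open>tlift V W p s \<phi>\<close> is on \<open>tens V W p\<close> the linear map determined by \<open>\<phi>\<close>.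
  All Sweedler sums are written with it.
\<close>

definition tlift ::
    "('k::field, 'v::ab_group_add) kspace \<Rightarrow> ('k, 'w::ab_group_add) kspace \<Rightarrow> nat \<Rightarrow>
     ('k \<Rightarrow> 'u::ab_group_add \<Rightarrow> 'u) \<Rightarrow> ('v \<times> 'w list \<Rightarrow> 'u) \<Rightarrow> ('k, 'v, 'w) tensor \<Rightarrow> 'u" where
  "tlift V W p s \<phi> =
     (SOME g. Vector_Spaces.linear tscale s g \<and> (\<forall>x\<in>tuples V W p. g (tpure V W p x) = \<phi> x))"

lemma vector_space_tscale: "vector_space (tscale :: 'k::field \<Rightarrow> ('x \<Rightarrow> 'k) \<Rightarrow> 'x \<Rightarrow> 'k)"
  by unfold_locales (auto simp: tscale_def algebra_simps fun_eq_iff)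

lemma vector_space_times: "vector_space ((*) :: 'k::field \<Rightarrow> 'k \<Rightarrow> 'k)"
  by unfold_locales (auto simp: algebra_simps)

lemma multilinear_tpure: "multilinear V W p tscale (tpure V W p)"
  unfolding multilinear_def
proof (clarify, intro conjI allI impI)
  fix v ws i assume t: "(v, ws) \<in> tuples V W p"
  have lin: "klin_on V (*) (\<lambda>x. \<beta> (x, ws))"
    and lin': "i < p \<Longrightarrow> klin_on W (*) (\<lambda>x. \<beta> (v, ws[i := x]))"
    if "multilinear V W p (*) \<beta>" for \<beta> :: "'b \<times> 'c list \<Rightarrow> 'a"
    using that t unfolding multilinear_def by blast+
  show "klin_on V tscale (\<lambda>x. tpure V W p (x, ws))"
    using lin by (simp add: klin_on_def tpure_def tscale_def fun_eq_iff)
  assume "i < p"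
  with lin' show "klin_on W tscale (\<lambda>x. tpure V W p (v, ws[i := x]))"
    by (simp add: klin_on_def tpure_def tscale_def fun_eq_iff)
qed

lemma separating_functional:
  fixes s :: "'k::field \<Rightarrow> 'u::ab_group_add \<Rightarrow> 'u"
  assumes "vector_space s" and "u \<noteq> 0"
  shows "\<exists>l. Vector_Spaces.linear s (*) l \<and> l u = 1"
proof -
  interpret U: vector_space s by fact
  interpret K: vector_space "(*) :: 'k \<Rightarrow> 'k \<Rightarrow> 'k" by (rule vector_space_times)
  interpret P: vector_space_pair s "(*) :: 'k \<Rightarrow> 'k \<Rightarrow> 'k" by unfold_locales
  have "U.independent {u}" using assms(2) by simp
  from P.linear_independent_extend[OF this, of "\<lambda>_. 1"] show ?thesis by auto
qed

lemma tlift_exists: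
  fixes s :: "'k::field \<Rightarrow> 'u::ab_group_add \<Rightarrow> 'u"
  assumes s: "vector_space s" and ml: "multilinear V W p s \<phi>"
  shows "\<exists>g. Vector_Spaces.linear tscale s g \<and> (\<forall>x\<in>tuples V W p. g (tpure V W p x) = \<phi> x)"
proof -
  interpret U: vector_space s by fact
  interpret T: vector_space "tscale :: 'k \<Rightarrow> (('a \<times> 'b list \<Rightarrow> 'k) \<Rightarrow> 'k) \<Rightarrow> _"
    by (rule vector_space_tscale)
  interpret P: vector_space_pair "tscale :: 'k \<Rightarrow> (('a \<times> 'b list \<Rightarrow> 'k) \<Rightarrow> 'k) \<Rightarrow> _" s
    by unfold_locales
  let ?X = "tpure V W p ` tuples V W p"
  obtain B where B: "B \<subseteq> ?X" "T.independent B" "?X \<subseteq> T.span B"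
    by (metis T.maximal_independent_subset)
  define pre where "pre b = (SOME x. x \<in> tuples V W p \<and> tpure V W p x = b)" for b
  have pre: "pre b \<in> tuples V W p \<and> tpure V W p (pre b) = b" if "b \<in> B" for b
    unfolding pre_def by (rule someI_ex) (use that B(1) in blast)
  obtain g where g: "Vector_Spaces.linear tscale s g" "\<And>b. b \<in> B \<Longrightarrow> g b = \<phi> (pre b)"
    using P.linear_independent_extend[OF B(2), of "\<lambda>b. \<phi> (pre b)"] by auto
  interpret g: Vector_Spaces.linear tscale s g by fact
  have "g (tpure V W p x) = \<phi> x" if x: "x \<in> tuples V W p" for x
  proof (rule ccontr)
    assume "g (tpure V W p x) \<noteq> \<phi> x"
    then have "g (tpure V W p x) - \<phi> x \<noteq> 0" by simp
    from separating_functional[OF s this] obtain l where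
      l: "Vector_Spaces.linear s (*) l" "l (g (tpure V W p x) - \<phi> x) = 1" by blast
    interpret l: Vector_Spaces.linear s "(*) :: 'k \<Rightarrow> 'k \<Rightarrow> 'k" l by fact
    have mll: "multilinear V W p (*) (\<lambda>y. l (\<phi> y))"
      using ml unfolding multilinear_def klin_on_def by (auto simp: l.add l.scale)
    have "l (g t) = t (\<lambda>y. l (\<phi> y))" if "t \<in> T.span B" for t
      using that
    proof (induction rule: T.span_induct_alt)
      case base
      show ?case by (metis g.zero l.zero zero_fun_apply)
    next
      case (step c b t)
      have "b (\<lambda>y. l (\<phi> y)) = tpure V W p (pre b) (\<lambda>y. l (\<phi> y))" using pre[OF step(1)] by simp
      also have "\<dots> = l (\<phi> (pre b))" using mll by (simp add: tpure_def)
      finally have "b (\<lambda>y. l (\<phi> y)) = l (g b)" using g(2)[OF step(1)] by simp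
      moreover have "l (g (tscale c b + t)) = c * l (g b) + l (g t)"
        by (simp only: g.add g.scale l.add l.scale)
      moreover have "(tscale c b + t) (\<lambda>y. l (\<phi> y)) = c * b (\<lambda>y. l (\<phi> y)) + t (\<lambda>y. l (\<phi> y))"
        by (simp add: tscale_def)
      ultimately show ?case using step(2) by metis
    qed
    from this[of "tpure V W p x"] have "l (g (tpure V W p x)) = l (\<phi> x)"
      using B(3) x mll by (auto simp: tpure_def)
    then show False using l(2) by (simp add: l.diff)
  qed
  with g(1) show ?thesis by blast
qed

lemma
  assumes "vector_space s" and "multilinear V W p s \<phi>"
  shows tlift_linear: "Vector_Spaces.linear tscale s (tlift V W p s \<phi>)"
    and tlift_tpure: "x \<in> tuples V W p \<Longrightarrow> tlift V W p s \<phi> (tpure V W p x) = \<phi> x"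
  using someI_ex[OF tlift_exists[OF assms]] unfolding tlift_def by auto

lemma tlift_unique:
  assumes s: "vector_space s" and ml: "multilinear V W p s \<phi>"
    and g: "klin_on \<lparr>vec = tens V W p, scl = tscale\<rparr> s g"
    and gp: "\<And>x. x \<in> tuples V W p \<Longrightarrow> g (tpure V W p x) = \<phi> x"
    and t: "t \<in> tens V W p"
  shows "g t = tlift V W p s \<phi> t"
proof -
  interpret U: vector_space s by fact
  interpret T: vector_space "tscale :: 'a \<Rightarrow> (('c \<times> 'd list \<Rightarrow> 'a) \<Rightarrow> 'a) \<Rightarrow> _"
    by (rule vector_space_tscale)
  interpret h: Vector_Spaces.linear tscale s "tlift V W p s \<phi>" by (rule tlift_linear[OF s ml])
  have sub: "T.subspace (tens V W p)" unfolding tens_def by (rule T.subspace_span)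
  have g_add: "g (x + y) = g x + g y" if "x \<in> tens V W p" "y \<in> tens V W p" for x y
    using g that by (simp add: klin_on_def)
  have g_sc: "g (tscale c x) = s c (g x)" if "x \<in> tens V W p" for c x
    using g that by (simp add: klin_on_def)
  have "t \<in> tens V W p \<and> g t = tlift V W p s \<phi> t"
    using t[unfolded tens_def]
  proof (induction rule: T.span_induct_alt)
    case base
    have z: "0 \<in> tens V W p" using sub by (rule T.subspace_0)
    have "g 0 = 0" using g_add[OF z z] by (simp only: add_0 add_cancel_right_right)
    with z h.zero show ?case by metis
  next
    case (step c b t)
    then obtain x where x: "x \<in> tuples V W p" "b = tpure V W p x" by auto
    then have b: "b \<in> tens V W p" unfolding tens_def by (auto intro: T.span_base)
    have "tscale c b \<in> tens V W p" using sub b by (rule T.subspace_scale)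
    moreover have "g b = tlift V W p s \<phi> b" using x gp tlift_tpure[OF s ml] by metis
    ultimately show ?case
      using step b g_add g_sc h.add h.scale T.subspace_add[OF sub] by metis
  qed
  then show ?thesis ..
qed

definition tens2 ::
    "('k::field, 'v::ab_group_add) kspace \<Rightarrow> ('k, 'w::ab_group_add) kspace \<Rightarrow>
     'v \<Rightarrow> 'w \<Rightarrow> ('k, 'v, 'w) tensor" where
  "tens2 V W v w = tpure V W 1 (v, [w])"

definition tlift2 ::
    "('k::field, 'v::ab_group_add) kspace \<Rightarrow> ('k, 'w::ab_group_add) kspace \<Rightarrow>
     ('k \<Rightarrow> 'u::ab_group_add \<Rightarrow> 'u) \<Rightarrow> ('v \<Rightarrow> 'w \<Rightarrow> 'u) \<Rightarrow> ('k, 'v, 'w) tensor \<Rightarrow> 'u" where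
  "tlift2 V W s \<phi> = tlift V W 1 s (\<lambda>(v, ws). \<phi> v (hd ws))"


section \<open>Bialgebras, Hopf algebras and Yetter-Drinfel'd modules\<close>

text \<open>The ring structure of \<open>A\<close> is that of its type.\<close>

record ('k, 'a) bialg =
  sc :: "'k \<Rightarrow> 'a \<Rightarrow> 'a"
  cop :: "'a \<Rightarrow> ('k, 'a, 'a) tensor"
  cou :: "'a \<Rightarrow> 'k"

record ('k, 'a) hopf = "('k, 'a) bialg" +
  anti :: "'a \<Rightarrow> 'a"

definition spA :: "('k, 'a, 'z) bialg_scheme \<Rightarrow> ('k, 'a) kspace" where
  "spA A = whole (sc A)"

text \<open>\<open>sw A s \<phi> a\<close> is the sum of \<open>\<phi> a\<^sub>1 a\<^sub>2\<close>, with values in a space with scalar multiplication \<open>s\<close>.\<close>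

definition sw ::
    "('k::field, 'a::ring_1, 'z) bialg_scheme \<Rightarrow> ('k \<Rightarrow> 'u::ab_group_add \<Rightarrow> 'u) \<Rightarrow>
     ('a \<Rightarrow> 'a \<Rightarrow> 'u) \<Rightarrow> 'a \<Rightarrow> 'u" where
  "sw A s \<phi> a = tlift2 (spA A) (spA A) s \<phi> (cop A a)"

text \<open>\<open>cop_iter A r\<close> maps \<open>A\<close> to the tensor product of \<open>r + 1\<close> copies of \<open>A\<close>.\<close>

fun cop_iter ::
    "('k::field, 'a::ring_1, 'z) bialg_scheme \<Rightarrow> nat \<Rightarrow> 'a \<Rightarrow> ('k, 'a, 'a) tensor" where
  "cop_iter A 0 a = tpure (spA A) (spA A) 0 (a, [])"
| "cop_iter A (Suc r) a =
     tlift (spA A) (spA A) r tscale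
       (\<lambda>(x, xs). sw A tscale (\<lambda>y z. tpure (spA A) (spA A) (Suc r) (y, z # xs)) x)
       (cop_iter A r a)"

text \<open>\<open>sw_iter A r s \<phi> a\<close> is the sum of \<open>\<phi> [a\<^sub>1, \<dots>, a\<^sub>r]\<close> for \<open>r \<ge> 1\<close>.\<close>

definition sw_iter ::
    "('k::field, 'a::ring_1, 'z) bialg_scheme \<Rightarrow> nat \<Rightarrow> ('k \<Rightarrow> 'u::ab_group_add \<Rightarrow> 'u) \<Rightarrow>
     ('a list \<Rightarrow> 'u) \<Rightarrow> 'a \<Rightarrow> 'u" where
  "sw_iter A r s \<phi> a =
     tlift (spA A) (spA A) (r - 1) s (\<lambda>(x, xs). \<phi> (x # xs)) (cop_iter A (r - 1) a)"

text \<open>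
  \<open>sw_list A s \<phi> [a\<^sup>1, \<dots>, a\<^sup>n]\<close> is the sum of
  \<open>\<phi> [(a\<^sup>1)\<^sub>1, \<dots>, (a\<^sup>n)\<^sub>1] [(a\<^sup>1)\<^sub>2, \<dots>, (a\<^sup>n)\<^sub>2]\<close>.
\<close>

fun sw_list ::
    "('k::field, 'a::ring_1, 'z) bialg_scheme \<Rightarrow> ('k \<Rightarrow> 'u::ab_group_add \<Rightarrow> 'u) \<Rightarrow>
     ('a list \<Rightarrow> 'a list \<Rightarrow> 'u) \<Rightarrow> 'a list \<Rightarrow> 'u" where
  "sw_list A s \<phi> [] = \<phi> [] []"
| "sw_list A s \<phi> (a # as) =
     sw A s (\<lambda>x y. sw_list A s (\<lambda>xs ys. \<phi> (x # xs) (y # ys)) as) a"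

locale bialgebra =
  fixes A :: "('k::field, 'a::ring_1, 'z) bialg_scheme"
  assumes vector_space_A: "vector_space (sc A)"
    and scale_mult_left: "sc A c (a * b) = sc A c a * b"
    and scale_mult_right: "sc A c (a * b) = a * sc A c b"
    and cop_linear: "Vector_Spaces.linear (sc A) tscale (cop A)"
    and cop_closed: "cop A a \<in> tens (spA A) (spA A) 1"
    and cou_linear: "Vector_Spaces.linear (sc A) (*) (cou A)"
    and coassoc:
      "sw A tscale (\<lambda>x y. sw A tscale (\<lambda>x1 x2. tpure (spA A) (spA A) 2 (x1, [x2, y])) x) a =
       sw A tscale (\<lambda>x y. sw A tscale (\<lambda>y1 y2. tpure (spA A) (spA A) 2 (x, [y1, y2])) y) a"
    and counit_left: "sw A (sc A) (\<lambda>x y. sc A (cou A x) y) a = a"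
    and counit_right: "sw A (sc A) (\<lambda>x y. sc A (cou A y) x) a = a"
    and cop_mult:
      "cop A (a * b) =
       sw A tscale (\<lambda>a1 a2. sw A tscale (\<lambda>b1 b2. tens2 (spA A) (spA A) (a1 * b1) (a2 * b2)) b) a"
    and cop_one: "cop A 1 = tens2 (spA A) (spA A) 1 1"
    and cou_mult: "cou A (a * b) = cou A a * cou A b"
    and cou_one: "cou A 1 = 1"

locale hopf_algebra = bialgebra A
  for A :: "('k::field, 'a::ring_1) hopf" +
  assumes anti_linear: "Vector_Spaces.linear (sc A) (sc A) (anti A)"
    and antipode_left: "sw A (sc A) (\<lambda>x y. anti A x * y) a = sc A (cou A a) 1"
    and antipode_right: "sw A (sc A) (\<lambda>x y. x * anti A y) a = sc A (cou A a) 1"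

definition finite_dim :: "('k::field \<Rightarrow> 'v::ab_group_add \<Rightarrow> 'v) \<Rightarrow> bool" where
  "finite_dim s \<longleftrightarrow> (\<exists>B. finite B \<and> Modules.module.span s B = UNIV)"

record ('k, 'a, 'm) yd =
  msc :: "'k \<Rightarrow> 'm \<Rightarrow> 'm"
  act :: "'a \<Rightarrow> 'm \<Rightarrow> 'm"
  coact :: "'m \<Rightarrow> ('k, 'm, 'a) tensor"

definition spM :: "('k, 'a, 'm) yd \<Rightarrow> ('k, 'm) kspace" where
  "spM M = whole (msc M)"

text \<open>\<open>swm A M s \<phi> m\<close> is the sum of \<open>\<phi> m\<^sub>0 m\<^sub>1\<close>.\<close>

definition swm ::
    "('k::field, 'a::ring_1, 'z) bialg_scheme \<Rightarrow> ('k, 'a, 'm::ab_group_add) yd \<Rightarrow>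
     ('k \<Rightarrow> 'u::ab_group_add \<Rightarrow> 'u) \<Rightarrow> ('m \<Rightarrow> 'a \<Rightarrow> 'u) \<Rightarrow> 'm \<Rightarrow> 'u" where
  "swm A M s \<phi> m = tlift2 (spM M) (spA A) s \<phi> (coact M m)"

locale yetter_drinfeld = bialgebra A
  for A :: "('k::field, 'a::ring_1, 'z) bialg_scheme" +
  fixes M :: "('k, 'a, 'm::ab_group_add) yd"
  assumes vector_space_M: "vector_space (msc M)"
    and act_linear_left: "Vector_Spaces.linear (sc A) (msc M) (\<lambda>a. act M a m)"
    and act_linear_right: "Vector_Spaces.linear (msc M) (msc M) (act M a)"
    and act_one: "act M 1 m = m"
    and act_mult: "act M (a * b) m = act M a (act M b m)"
    and coact_linear: "Vector_Spaces.linear (msc M) tscale (coact M)"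
    and coact_closed: "coact M m \<in> tens (spM M) (spA A) 1"
    and coact_coassoc:
      "swm A M tscale (\<lambda>x a. swm A M tscale (\<lambda>y b. tpure (spM M) (spA A) 2 (y, [b, a])) x) m =
       swm A M tscale (\<lambda>x a. sw A tscale (\<lambda>a1 a2. tpure (spM M) (spA A) 2 (x, [a1, a2])) a) m"
    and coact_counit: "swm A M (msc M) (\<lambda>x a. msc M (cou A a) x) m = m"
    and yd_compat:
      "sw A tscale (\<lambda>a1 a2.
         swm A M tscale (\<lambda>x b. tens2 (spM M) (spA A) x (b * a1)) (act M a2 m)) a =
       sw A tscale (\<lambda>a1 a2.
         swm A M tscale (\<lambda>x b. tens2 (spM M) (spA A) (act M a1 x) (a2 * b)) m) a"


section \<open>The double complex\<close>

text \<open>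
  The vector factor is always stored first, so the pure tensor of
  \<open>a\<^sup>1, \<dots>, a\<^sup>n, m\<close> in the source of a cochain is represented by \<open>(m, [a\<^sup>1, \<dots>, a\<^sup>n])\<close>.
  Cochains are set to zero outside the tensor product on which they live, so that
  equality of functions is equality of cochains.
\<close>

type_synonym ('k, 'a, 'm, 'n) cochain = "('k, 'm, 'a) tensor \<Rightarrow> ('k, 'n, 'a) tensor"

definition Y ::
    "('k::field, 'a::ring_1, 'z) bialg_scheme \<Rightarrow> ('k, 'a, 'm::ab_group_add) yd \<Rightarrow>
     ('k, 'a, 'n::ab_group_add) yd \<Rightarrow> nat \<Rightarrow> nat \<Rightarrow> ('k, 'a, 'm, 'n) cochain set" where
  "Y A M N n p =
     {f. klin_on \<lparr>vec = tens (spM M) (spA A) n, scl = tscale\<rparr> tscale f \<and>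
         (\<forall>t\<in>tens (spM M) (spA A) n. f t \<in> tens (spM N) (spA A) p) \<and>
         (\<forall>t. t \<notin> tens (spM M) (spA A) n \<longrightarrow> f t = 0)}"

text \<open>\<open>ext_mult A M n \<phi>\<close> is the map on \<open>tens (spM M) (spA A) n\<close> given by \<open>\<phi>\<close> on pure tensors.\<close>

definition ext_mult ::
    "('k::field, 'a::ring_1, 'z) bialg_scheme \<Rightarrow> ('k, 'a, 'm::ab_group_add) yd \<Rightarrow> nat \<Rightarrow>
     ('m \<times> 'a list \<Rightarrow> ('k, 'n, 'a) tensor) \<Rightarrow> ('k, 'a, 'm, 'n) cochain" where
  "ext_mult A M n \<phi> =
     (\<lambda>t. if t \<in> tens (spM M) (spA A) n then tlift (spM M) (spA A) n tscale \<phi> t else 0)"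

definition b_map ::
    "('k::field, 'a::ring_1, 'z) bialg_scheme \<Rightarrow> ('k, 'a, 'm::ab_group_add) yd \<Rightarrow>
     ('k, 'a, 'n::ab_group_add) yd \<Rightarrow> nat \<Rightarrow> nat \<Rightarrow> nat \<Rightarrow>
     ('k, 'a, 'm, 'n) cochain \<Rightarrow> ('k, 'a, 'm, 'n) cochain" where
  "b_map A M N n p i f =
     (if i = 0 then
        ext_mult A M (n + 1) (\<lambda>(m, as).
          sw_iter A (p + 1) tscale
            (\<lambda>hs. tlift (spM N) (spA A) p tscale
               (\<lambda>(v, vs). tpure (spM N) (spA A) p (act N (hd hs) v, map2 (*) (tl hs) vs))
               (f (tpure (spM M) (spA A) n (m, tl as))))
            (hd as))
      else if i \<le> n then
        ext_mult A M (n + 1) (\<lambda>(m, as).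
          f (tpure (spM M) (spA A) n
               (m, take (i - 1) as @ [as ! (i - 1) * as ! i] @ drop (i + 1) as)))
      else
        ext_mult A M (n + 1) (\<lambda>(m, as).
          sw_iter A (p + 1) tscale
            (\<lambda>hs. tlift (spM N) (spA A) p tscale
               (\<lambda>(v, vs). tpure (spM N) (spA A) p (v, map2 (*) vs (butlast hs)))
               (f (tpure (spM M) (spA A) n (act M (last hs) m, butlast as))))
            (last as)))"

definition c_map ::
    "('k::field, 'a::ring_1, 'z) bialg_scheme \<Rightarrow> ('k, 'a, 'm::ab_group_add) yd \<Rightarrow>
     ('k, 'a, 'n::ab_group_add) yd \<Rightarrow> nat \<Rightarrow> nat \<Rightarrow> nat \<Rightarrow>
     ('k, 'a, 'm, 'n) cochain \<Rightarrow> ('k, 'a, 'm, 'n) cochain" where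
  "c_map A M N n p i f =
     (if i = 0 then
        ext_mult A M n (\<lambda>(m, as).
          sw_list A tscale
            (\<lambda>xs ys. tlift (spM N) (spA A) p tscale
               (\<lambda>(v, vs). swm A N tscale
                  (\<lambda>v0 v1. tpure (spM N) (spA A) (p + 1) (v0, (v1 * prod_list xs) # vs)) v)
               (f (tpure (spM M) (spA A) n (m, ys))))
            as)
      else if i \<le> p then
        (\<lambda>t. tlift (spM N) (spA A) p tscale
           (\<lambda>(v, vs). sw A tscale
              (\<lambda>x y. tpure (spM N) (spA A) (p + 1) (v, take (i - 1) vs @ [x, y] @ drop i vs))
              (vs ! (i - 1)))
           (f t))
      else
        ext_mult A M n (\<lambda>(m, as).
          sw_list A tscale
            (\<lambda>xs ys. swm A M tscale
               (\<lambda>m0 m1. tlift (spM N) (spA A) p tscale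
                  (\<lambda>(v, vs). tpure (spM N) (spA A) (p + 1) (v, vs @ [prod_list ys * m1]))
                  (f (tpure (spM M) (spA A) n (m0, xs))))
               m)
            as))"

definition d_m ::
    "('k::field, 'a::ring_1, 'z) bialg_scheme \<Rightarrow> ('k, 'a, 'm::ab_group_add) yd \<Rightarrow>
     ('k, 'a, 'n::ab_group_add) yd \<Rightarrow> nat \<Rightarrow> nat \<Rightarrow>
     ('k, 'a, 'm, 'n) cochain \<Rightarrow> ('k, 'a, 'm, 'n) cochain" where
  "d_m A M N n p f = (\<lambda>t. \<Sum>i\<le>n + 1. tscale ((-1) ^ i) (b_map A M N n p i f t))"

definition d_c ::
    "('k::field, 'a::ring_1, 'z) bialg_scheme \<Rightarrow> ('k, 'a, 'm::ab_group_add) yd \<Rightarrow>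
     ('k, 'a, 'n::ab_group_add) yd \<Rightarrow> nat \<Rightarrow> nat \<Rightarrow>
     ('k, 'a, 'm, 'n) cochain \<Rightarrow> ('k, 'a, 'm, 'n) cochain" where
  "d_c A M N n p f = (\<lambda>t. \<Sum>i\<le>p + 1. tscale ((-1) ^ i) (c_map A M N n p i f t))"

text \<open>A total cochain of degree \<open>r\<close> is a family indexed by \<open>n\<close> with \<open>n\<close>-th entry in \<open>Y\<^sup>n\<^sup>,\<^sup>r\<^sup>-\<^sup>n\<close>.\<close>

definition tot ::
    "('k::field, 'a::ring_1, 'z) bialg_scheme \<Rightarrow> ('k, 'a, 'm::ab_group_add) yd \<Rightarrow>
     ('k, 'a, 'n::ab_group_add) yd \<Rightarrow> nat \<Rightarrow> (nat \<Rightarrow> ('k, 'a, 'm, 'n) cochain) set" where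
  "tot A M N r = {F. (\<forall>n\<le>r. F n \<in> Y A M N n (r - n)) \<and> (\<forall>n>r. F n = 0)}"

definition d_tot ::
    "('k::field, 'a::ring_1, 'z) bialg_scheme \<Rightarrow> ('k, 'a, 'm::ab_group_add) yd \<Rightarrow>
     ('k, 'a, 'n::ab_group_add) yd \<Rightarrow> nat \<Rightarrow>
     (nat \<Rightarrow> ('k, 'a, 'm, 'n) cochain) \<Rightarrow> nat \<Rightarrow> ('k, 'a, 'm, 'n) cochain" where
  "d_tot A M N r F = (\<lambda>n.
     (if 1 \<le> n \<and> n \<le> r + 1 then d_m A M N (n - 1) (r - (n - 1)) (F (n - 1)) else 0) +
     (if n \<le> r then (\<lambda>t. tscale ((-1) ^ n) (d_c A M N n (r - n) (F n) t)) else 0))"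

definition tot_cocycles ::
    "('k::field, 'a::ring_1, 'z) bialg_scheme \<Rightarrow> ('k, 'a, 'm::ab_group_add) yd \<Rightarrow>
     ('k, 'a, 'n::ab_group_add) yd \<Rightarrow> nat \<Rightarrow> (nat \<Rightarrow> ('k, 'a, 'm, 'n) cochain) set" where
  "tot_cocycles A M N r = {F \<in> tot A M N r. d_tot A M N r F = 0}"

definition tot_coboundaries ::
    "('k::field, 'a::ring_1, 'z) bialg_scheme \<Rightarrow> ('k, 'a, 'm::ab_group_add) yd \<Rightarrow>
     ('k, 'a, 'n::ab_group_add) yd \<Rightarrow> nat \<Rightarrow> (nat \<Rightarrow> ('k, 'a, 'm, 'n) cochain) set" where
  "tot_coboundaries A M N r =
     (if r = 0 then {0} else d_tot A M N (r - 1) ` tot A M N (r - 1))"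

definition yd_cohomology ::
    "('k::field, 'a::ring_1, 'z) bialg_scheme \<Rightarrow> ('k, 'a, 'm::ab_group_add) yd \<Rightarrow>
     ('k, 'a, 'n::ab_group_add) yd \<Rightarrow> nat \<Rightarrow> (nat \<Rightarrow> ('k, 'a, 'm, 'n) cochain) set monoid" where
  "yd_cohomology A M N r =
     \<lparr>carrier = tot_cocycles A M N r, mult = (+), one = 0\<rparr> Mod tot_coboundaries A M N r"


section \<open>The Drinfel'd double\<close>

definition dual :: "('k::field \<Rightarrow> 'v::ab_group_add \<Rightarrow> 'v) \<Rightarrow> ('k, 'v \<Rightarrow> 'k) kspace" where
  "dual s = \<lparr>vec = {q. Vector_Spaces.linear s (*) q}, scl = tscale\<rparr>"

definition convolution ::
    "('k::field, 'a::ring_1, 'z) bialg_scheme \<Rightarrow> ('a \<Rightarrow> 'k) \<Rightarrow> ('a \<Rightarrow> 'k) \<Rightarrow> 'a \<Rightarrow> 'k" where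
  "convolution A q q' = sw A (*) (\<lambda>x y. q x * q' y)"

text \<open>
  The product of \<open>q \<otimes> a\<close> and \<open>q' \<otimes> a'\<close> is \<open>q (a q') a'\<close>, with
  \<open>a q'\<close> the sum of \<open>q'(S\<^sup>-\<^sup>1(a\<^sub>3) ? a\<^sub>1) a\<^sub>2\<close>.
\<close>

definition double_mult ::
    "('k::field, 'a::ring_1) hopf \<Rightarrow>
     ('k, 'a \<Rightarrow> 'k, 'a) tensor \<Rightarrow> ('k, 'a \<Rightarrow> 'k, 'a) tensor \<Rightarrow> ('k, 'a \<Rightarrow> 'k, 'a) tensor" where
  "double_mult A s t =
     tlift2 (dual (sc A)) (spA A) tscale
       (\<lambda>q a. tlift2 (dual (sc A)) (spA A) tscale
          (\<lambda>q' a'. sw_iter A 3 tscale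
             (\<lambda>hs. tens2 (dual (sc A)) (spA A)
                (convolution A q (\<lambda>x. q' (inv_into UNIV (anti A) (hs ! 2) * x * hs ! 0)))
                (hs ! 1 * a'))
             a)
          t)
       s"

definition double ::
    "('k::field, 'a::ring_1) hopf \<Rightarrow> ('k, 'a \<Rightarrow> 'k, 'a) tensor ring" where
  "double A =
     \<lparr>carrier = tens (dual (sc A)) (spA A) 1, mult = double_mult A,
      one = tens2 (dual (sc A)) (spA A) (cou A) 1, zero = 0, add = (+)\<rparr>"

text \<open>
  Left modules use the library record for modules; its multiplicative fields are irrelevant.
\<close>

definition double_module ::
    "('k::field, 'a::ring_1) hopf \<Rightarrow> ('k, 'a, 'm::ab_group_add) yd \<Rightarrow>
     (('k, 'a \<Rightarrow> 'k, 'a) tensor, 'm) module" where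
  "double_module A M =
     \<lparr>carrier = UNIV, mult = undefined, one = undefined, zero = 0, add = (+),
      smult = (\<lambda>d m. tlift2 (dual (sc A)) (spA A) (msc M)
        (\<lambda>q a. swm A M (msc M) (\<lambda>m0 m1. msc M (q m1) m0) (act M a m)) d)\<rparr>"


section \<open>The first Ext group of left modules over a ring\<close>

definition left_hom ::
    "('r, 'z) ring_scheme \<Rightarrow> ('r, 'p) module \<Rightarrow> ('r, 'q) module \<Rightarrow> ('p \<Rightarrow> 'q) set" where
  "left_hom R P Q =
     {h \<in> carrier P \<rightarrow>\<^sub>E carrier Q.
        (\<forall>x\<in>carrier P. \<forall>y\<in>carrier P. h (x \<oplus>\<^bsub>P\<^esub> y) = h x \<oplus>\<^bsub>Q\<^esub> h y) \<and>
        (\<forall>r\<in>carrier R. \<forall>x\<in>carrier P. h (r \<odot>\<^bsub>P\<^esub> x) = r \<odot>\<^bsub>Q\<^esub> h x)}"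

definition free_left_module ::
    "('r, 'z) ring_scheme \<Rightarrow> 'x set \<Rightarrow> ('r, 'x \<Rightarrow> 'r) module" where
  "free_left_module R X =
     \<lparr>carrier = {f. (\<forall>x\<in>X. f x \<in> carrier R) \<and> (\<forall>x. x \<notin> X \<longrightarrow> f x = \<zero>\<^bsub>R\<^esub>) \<and>
                    finite {x. f x \<noteq> \<zero>\<^bsub>R\<^esub>}},
      mult = undefined, one = undefined, zero = (\<lambda>_. \<zero>\<^bsub>R\<^esub>),
      add = (\<lambda>f g x. f x \<oplus>\<^bsub>R\<^esub> g x), smult = (\<lambda>r f x. r \<otimes>\<^bsub>R\<^esub> f x)\<rparr>"

text \<open>The linear map from the free module on a subset of \<open>M\<close> that extends the inclusion.\<close>

definition free_eval ::
    "('r, 'z) ring_scheme \<Rightarrow> ('r, 'm) module \<Rightarrow> ('m \<Rightarrow> 'r) \<Rightarrow> 'm" where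
  "free_eval R M f = (\<Oplus>\<^bsub>M\<^esub>x\<in>{x. f x \<noteq> \<zero>\<^bsub>R\<^esub>}. f x \<odot>\<^bsub>M\<^esub> x)"

text \<open>
  The start \<open>F\<^sub>2 \<rightarrow> F\<^sub>1 \<rightarrow> F\<^sub>0 \<rightarrow> M \<rightarrow> 0\<close> of the standard free resolution: \<open>F\<^sub>0\<close> is free on the
  set \<open>M\<close>, and each further \<open>F\<^sub>i\<close> is free on the kernel of the preceding map.
\<close>

definition res0 ::
    "('r, 'z) ring_scheme \<Rightarrow> ('r, 'm) module \<Rightarrow> ('r, 'm \<Rightarrow> 'r) module" where
  "res0 R M = free_left_module R (carrier M)"

definition res1 ::
    "('r, 'z) ring_scheme \<Rightarrow> ('r, 'm) module \<Rightarrow> ('r, ('m \<Rightarrow> 'r) \<Rightarrow> 'r) module" where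
  "res1 R M = free_left_module R {f \<in> carrier (res0 R M). free_eval R M f = \<zero>\<^bsub>M\<^esub>}"

definition res2 ::
    "('r, 'z) ring_scheme \<Rightarrow> ('r, 'm) module \<Rightarrow> ('r, (('m \<Rightarrow> 'r) \<Rightarrow> 'r) \<Rightarrow> 'r) module" where
  "res2 R M =
     free_left_module R {f \<in> carrier (res1 R M). free_eval R (res0 R M) f = \<zero>\<^bsub>res0 R M\<^esub>}"

text \<open>The first cohomology of \<open>Hom\<^sub>R(F\<^sub>0, N) \<rightarrow> Hom\<^sub>R(F\<^sub>1, N) \<rightarrow> Hom\<^sub>R(F\<^sub>2, N)\<close>.\<close>

definition Ext1 ::
    "('r, 'z) ring_scheme \<Rightarrow> ('r, 'm) module \<Rightarrow> ('r, 'n) module \<Rightarrow>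
     ((('m \<Rightarrow> 'r) \<Rightarrow> 'r) \<Rightarrow> 'n) set monoid" where
  "Ext1 R M N =
     \<lparr>carrier = {h \<in> left_hom R (res1 R M) N.
                  \<forall>f\<in>carrier (res2 R M). h (free_eval R (res1 R M) f) = \<zero>\<^bsub>N\<^esub>},
      mult = (\<lambda>g h. \<lambda>x\<in>carrier (res1 R M). g x \<oplus>\<^bsub>N\<^esub> h x),
      one = (\<lambda>x\<in>carrier (res1 R M). \<zero>\<^bsub>N\<^esub>)\<rparr>
     Mod ((\<lambda>h. \<lambda>x\<in>carrier (res1 R M). h (free_eval R (res0 R M) x)) ` left_hom R (res0 R M) N)"

end

theory Submission
  imports Defs "HOL-Library.Product_Plus"
begin

text \<open>
  A cocycle of total degree one is a pair of maps \<open>\<omega>\<close> from the tensor product of \<open>A\<close> and \<open>M\<close> to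
  \<open>N\<close> and \<open>\<lambda>\<close> from \<open>M\<close> to the tensor product of \<open>N\<close> and \<open>A\<close>.  The three components of the
  cocycle condition say that \<open>\<omega>\<close> and \<open>\<lambda>\<close>, used as off-diagonal entries of an action and a
  coaction, make the sum of \<open>N\<close> and \<open>M\<close> a Yetter-Drinfel'd module, that is, a module over the
  double.  Hence they correspond to bilinear maps \<open>\<phi>\<close> on \<open>D(A)\<close> and \<open>M\<close> with
  \<open>\<phi>(d d', m) = d \<phi>(d', m) + \<phi>(d, d' m)\<close>, where \<open>\<phi>(q a, m) = q \<omega>(a, m) + \<lambda>\<^sub>q(a m)\<close> and \<open>\<lambda>\<^sub>q\<close> is
  \<open>\<lambda>\<close> contracted with \<open>q\<close>.  If \<open>K\<close> is the kernel of \<open>F\<^sub>0 \<rightarrow> M\<close>, such a \<open>\<phi>\<close> gives the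
  \<open>D(A)\<close>-linear map \<open>K \<rightarrow> N\<close> that sends the formal sum of the \<open>x\<^sub>m [m]\<close> to the sum of the
  \<open>\<phi>(x\<^sub>m, m)\<close>.  Because \<open>F\<^sub>0 \<rightarrow> M\<close> has a \<open>k\<close>-linear section, every linear map \<open>K \<rightarrow> N\<close> arises in
  this way up to maps that extend to \<open>F\<^sub>0\<close>, and the maps that extend come from coboundaries.

  The product of the double involves \<open>S\<^sup>-\<^sup>1\<close>; that \<open>S\<close> is bijective is not assumed but follows from finite
  dimension.
\<close>

text \<open>The maps behind Sweedler sums are chosen by \<open>SOME\<close> and are under control
  only for multilinear arguments, so nested sums would carry side conditions everywhere. Finite
  dimension removes this: \<open>SW\<close> evaluates sums in a basis, and a coaction becomes an
  action of the dual, so that identities between tensors over \<open>A\<close> are tested one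
  functional at a time. In this form the Yetter-Drinfel'd condition and the exchange rule of the
  double differ only by cancelling \<open>S\<^sup>-\<^sup>1\<close>. Bijectivity of \<open>S\<close>
  must therefore come first. Kernels of powers of \<open>S\<close> stabilise, and uniqueness of
  convolution inverses lets the exponent of a stable kernel descend to zero. Associativity of the
  double, the module axioms for \<open>M\<close> and \<open>N\<close> and the cocycle identity for
  \<open>\<phi>\<close> are three instances of one statement on compatible actions,
  \<open>dual_action.dm_mult\<close>. On the Ext side the obstacle is that \<open>F\<^sub>0\<close>
  is free on the underlying set of \<open>M\<close>: the section \<open>m \<mapsto> [m]\<close> is
  not additive, whereas cochains of the double complex are linear in \<open>m\<close>.\<close>

declare One_nat_def [simp del]

section \<open>Linear maps between carriers\<close>

abbreviation lin :: "('k::field \<Rightarrow> 'v::ab_group_add \<Rightarrow> 'v) \<Rightarrow> ('k \<Rightarrow> 'u::ab_group_add \<Rightarrow> 'u) \<Rightarrow> ('v \<Rightarrow> 'u) \<Rightarrow> bool"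
  where "lin \<equiv> Vector_Spaces.linear"

lemmas lin_iff = Vector_Spaces.linear_iff

lemma vec_whole [simp]: "vec (whole s) = UNIV" and scl_whole [simp]: "scl (whole s) = s"
  by (simp_all add: whole_def)

lemma vec_spA [simp]: "vec (spA A) = UNIV" and scl_spA [simp]: "scl (spA A) = sc A"
  by (simp_all add: spA_def)

lemma vec_spM [simp]: "vec (spM M) = UNIV" and scl_spM [simp]: "scl (spM M) = msc M"
  by (simp_all add: spM_def)

lemma scl_dual [simp]: "scl (dual s) = tscale"
  by (simp add: dual_def)

lemma klin_onI:
  assumes "\<And>x y. x \<in> vec V \<Longrightarrow> y \<in> vec V \<Longrightarrow> f (x + y) = f x + f y"
    and "\<And>c x. x \<in> vec V \<Longrightarrow> f (scl V c x) = s c (f x)"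
  shows "klin_on V s f"
  using assms by (simp add: klin_on_def)

lemma klin_add: "klin_on V s f \<Longrightarrow> x \<in> vec V \<Longrightarrow> y \<in> vec V \<Longrightarrow> f (x + y) = f x + f y"
  and klin_scale: "klin_on V s f \<Longrightarrow> x \<in> vec V \<Longrightarrow> f (scl V c x) = s c (f x)"
  by (simp_all add: klin_on_def)

lemma klin_cong: "klin_on V s f \<Longrightarrow> (\<And>x. x \<in> vec V \<Longrightarrow> f x = g x) \<Longrightarrow>
    (\<And>x y. x \<in> vec V \<Longrightarrow> y \<in> vec V \<Longrightarrow> x + y \<in> vec V) \<Longrightarrow>
    (\<And>c x. x \<in> vec V \<Longrightarrow> scl V c x \<in> vec V) \<Longrightarrow> klin_on V s g"
  by (simp add: klin_on_def)

lemma lin_klin: "lin s t f \<Longrightarrow> klin_on (whole s) t f"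
  by (simp add: lin_iff klin_on_def)

lemma klin_lin: "vector_space s \<Longrightarrow> vector_space t \<Longrightarrow> klin_on (whole s) t f \<Longrightarrow> lin s t f"
  by (simp add: lin_iff klin_on_def)

text \<open>\<open>klin_on\<close> only speaks about arguments in the carrier, and a carrier such as
  that of the dual is a proper subset of its type, so sums and multiples must be known to stay
  inside.\<close>

definition kclosed :: "('k::field, 'v::ab_group_add) kspace \<Rightarrow> bool" where
  "kclosed V \<longleftrightarrow> 0 \<in> vec V \<and> (\<forall>x\<in>vec V. \<forall>y\<in>vec V. x + y \<in> vec V) \<and> (\<forall>c. \<forall>x\<in>vec V. scl V c x \<in> vec V)"

lemma kclosed_whole [simp]: "kclosed (whole s)" and kclosed_spA [simp]: "kclosed (spA A)"
  and kclosed_spM [simp]: "kclosed (spM M)"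
  by (simp_all add: kclosed_def)

lemma kclosed_dual: assumes "vector_space s" shows "kclosed (dual s)"
proof -
  have "lin s (*) (\<lambda>x. 0)" using assms by (simp add: lin_iff vector_space_times)
  then have "0 \<in> vec (dual s)" by (simp add: dual_def zero_fun_def)
  then show ?thesis unfolding kclosed_def by (simp add: dual_def lin_iff tscale_def algebra_simps)
qed

lemma klin_zero: "kclosed V \<Longrightarrow> klin_on V s f \<Longrightarrow> f 0 = 0"
  unfolding kclosed_def using klin_add[of V s f 0 0] by simp

lemma kclosed_sum: "kclosed V \<Longrightarrow> (\<And>i. i \<in> I \<Longrightarrow> x i \<in> vec V) \<Longrightarrow> (\<Sum>i\<in>I. x i) \<in> vec V"
  by (induction I rule: infinite_finite_induct) (auto simp: kclosed_def)

lemma klin_sum: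
  assumes "kclosed V" "klin_on V s f" "\<And>i. i \<in> I \<Longrightarrow> x i \<in> vec V"
  shows "f (\<Sum>i\<in>I. x i) = (\<Sum>i\<in>I. f (x i))"
  using assms(3)
proof (induction I rule: infinite_finite_induct)
  case (insert i I)
  then show ?case using klin_add[OF assms(2)] kclosed_sum[OF assms(1), of I x] by simp
qed (simp_all add: klin_zero[OF assms(1,2)])

lemma lin_sum: "lin s t f \<Longrightarrow> f (\<Sum>i\<in>I. x i) = (\<Sum>i\<in>I. f (x i))"
  using klin_sum[OF kclosed_whole lin_klin, of s t f I x] by simp

lemma kclosed_scale: "kclosed V \<Longrightarrow> x \<in> vec V \<Longrightarrow> scl V c x \<in> vec V"
  by (simp add: kclosed_def)

lemma klin_comp:
  assumes "klin_on V t g" "klin_on U (scl V) f" "\<And>x. x \<in> vec U \<Longrightarrow> f x \<in> vec V"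
  shows "klin_on U t (\<lambda>x. g (f x))"
  using assms by (simp add: klin_on_def)

lemma klin_comp_lin: "lin s t g \<Longrightarrow> klin_on U s f \<Longrightarrow> klin_on U t (\<lambda>x. g (f x))"
  by (simp add: klin_on_def lin_iff)

lemma klin_plus: "vector_space t \<Longrightarrow> klin_on U t f \<Longrightarrow> klin_on U t g \<Longrightarrow> klin_on U t (\<lambda>x. f x + g x)"
  by (simp add: klin_on_def vector_space.vector_space_assms algebra_simps)

lemma vector_space_module: "vector_space t \<Longrightarrow> Modules.module t"
  by (simp add: module_iff_vector_space)

lemma klin_diff: "vector_space t \<Longrightarrow> klin_on U t f \<Longrightarrow> klin_on U t g \<Longrightarrow> klin_on U t (\<lambda>x. f x - g x)"
  by (simp add: klin_on_def vector_space.vector_space_assms Modules.module.scale_right_diff_distrib[OF vector_space_module])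

lemma klin_zero_fun: "vector_space t \<Longrightarrow> klin_on U t (\<lambda>x. 0)"
  by (simp add: klin_on_def Modules.module.scale_zero_right[OF vector_space_module])

lemma klin_sum_fun: "vector_space t \<Longrightarrow> (\<And>i. i \<in> I \<Longrightarrow> klin_on U t (f i)) \<Longrightarrow> klin_on U t (\<lambda>x. \<Sum>i\<in>I. f i x)"
  by (induction I rule: infinite_finite_induct) (auto intro: klin_zero_fun klin_plus)

lemma klin_scl: "vector_space t \<Longrightarrow> klin_on U t f \<Longrightarrow> klin_on U t (\<lambda>x. t c (f x))"
  by (simp add: klin_on_def vector_space.vector_space_assms mult.commute)

lemma klin_scl_left: "vector_space t \<Longrightarrow> klin_on U (*) f \<Longrightarrow> klin_on U t (\<lambda>x. t (f x) v)"
  by (simp add: klin_on_def vector_space.vector_space_assms)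

lemma klin_mult_field: "klin_on U (*) f \<Longrightarrow> klin_on U (*) (\<lambda>x. f x * (c::'k::field))"
   "klin_on U (*) f \<Longrightarrow> klin_on U (*) (\<lambda>x. (c::'k::field) * f x)"
  by (simp_all add: klin_on_def algebra_simps)

lemma klin_fun: "(\<And>z. klin_on U (*) (\<lambda>x. f x z)) \<Longrightarrow> klin_on U tscale (\<lambda>x. f x)"
  by (simp add: klin_on_def fun_eq_iff tscale_def)

lemma klin_eval: "klin_on (dual s) (*) (\<lambda>q. q a)"
  by (simp add: klin_on_def tscale_def)

lemma klin_id: "klin_on V (scl V) (\<lambda>x. x)"
  by (simp add: klin_on_def)

section \<open>Low tensor powers\<close>

lemma tuples0: "tuples V W 0 = {(v, []) |v. v \<in> vec V}"
  by (auto simp: tuples_def)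

lemma length_one: "length ws = 1 \<longleftrightarrow> (\<exists>w. ws = [w])"
  by (cases ws) (auto simp: One_nat_def)

lemma length_two: "length ws = 2 \<longleftrightarrow> (\<exists>w u. ws = [w, u])"
  by (cases ws; cases "tl ws") auto

lemma tuples1: "tuples V W 1 = {(v, [w]) |v w. v \<in> vec V \<and> w \<in> vec W}"
  by (auto simp: tuples_def length_one)

lemma tuples2: "tuples V W 2 = {(v, [w, u]) |v w u. v \<in> vec V \<and> w \<in> vec W \<and> u \<in> vec W}"
  by (auto simp: tuples_def length_two)

lemma multilinear0: "multilinear V W 0 s \<phi> \<longleftrightarrow> (vec V \<noteq> {} \<longrightarrow> klin_on V s (\<lambda>v. \<phi> (v, [])))"
  by (auto simp: multilinear_def tuples0)

lemma multilinear1: "multilinear V W 1 s \<phi> \<longleftrightarrow>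
   (\<forall>v\<in>vec V. \<forall>w\<in>vec W. klin_on V s (\<lambda>v. \<phi> (v, [w])) \<and> klin_on W s (\<lambda>w. \<phi> (v, [w])))"
proof -
  have all: "(\<forall>x\<in>tuples V W 1. P x) \<longleftrightarrow> (\<forall>v\<in>vec V. \<forall>w\<in>vec W. P (v, [w]))" for P
    by (auto simp: tuples1)
  show ?thesis unfolding multilinear_def all by simp
qed

lemma multilinear2: "multilinear V W 2 s \<phi> \<longleftrightarrow>
   (\<forall>v\<in>vec V. \<forall>w\<in>vec W. \<forall>u\<in>vec W. klin_on V s (\<lambda>v. \<phi> (v, [w, u])) \<and>
      klin_on W s (\<lambda>w. \<phi> (v, [w, u])) \<and> klin_on W s (\<lambda>u. \<phi> (v, [w, u])))"
proof -
  have all: "(\<forall>x\<in>tuples V W 2. P x) \<longleftrightarrow> (\<forall>v\<in>vec V. \<forall>w\<in>vec W. \<forall>u\<in>vec W. P (v, [w, u]))" for P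
    by (auto simp: tuples2)
  have all2: "(\<forall>i<2. P i) \<longleftrightarrow> P 0 \<and> P (Suc 0)" for P :: "nat \<Rightarrow> bool"
    using less_2_cases_iff by auto
  show ?thesis unfolding multilinear_def all by (simp add: all2)
qed

text \<open>Agreement is known only on tuples from the carriers. Closure of \<open>V\<close> and
  \<open>W\<close> keeps the sums and multiples in the linearity equations where the two functions
  agree.\<close>

lemma multilinear_cong:
  assumes "multilinear V W p s \<psi>" "\<And>x. x \<in> tuples V W p \<Longrightarrow> \<phi> x = \<psi> x"
    "kclosed V" "kclosed W"
  shows "multilinear V W p s \<phi>"
  unfolding multilinear_def
proof (clarify, intro conjI allI impI)
  fix v ws assume t: "(v, ws) \<in> tuples V W p"
  have "klin_on V s (\<lambda>x. \<psi> (x, ws))" using assms(1) t by (auto simp: multilinear_def)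
  then show "klin_on V s (\<lambda>x. \<phi> (x, ws))"
    by (rule klin_cong) (use t assms in \<open>auto simp: tuples_def kclosed_def\<close>)
  fix i assume i: "i < p"
  have "klin_on W s (\<lambda>x. \<psi> (v, ws[i := x]))" using assms(1) t i by (auto simp: multilinear_def)
  moreover have "(v, ws[i := x]) \<in> tuples V W p" if "x \<in> vec W" for x
    using t that set_update_subset_insert[of ws i x] by (auto simp: tuples_def)
  ultimately show "klin_on W s (\<lambda>x. \<phi> (v, ws[i := x]))"
    using assms by (simp add: klin_on_def kclosed_def)
qed

lemma tscale_module: "Modules.module tscale"
  by (rule vector_space_module[OF vector_space_tscale])

lemma subspace_tens: "Modules.module.subspace tscale (tens V W p)"
  unfolding tens_def by (rule Modules.module.subspace_span[OF tscale_module])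

lemma tens_add: "x \<in> tens V W p \<Longrightarrow> y \<in> tens V W p \<Longrightarrow> x + y \<in> tens V W p"
  and tens_scale: "x \<in> tens V W p \<Longrightarrow> tscale c x \<in> tens V W p"
  and tens_zero: "0 \<in> tens V W p"
  using Modules.module.subspace_add[OF tscale_module subspace_tens] Modules.module.subspace_scale[OF tscale_module subspace_tens]
      Modules.module.subspace_0[OF tscale_module subspace_tens] by blast+

definition tspace :: "('k::field, 'v::ab_group_add) kspace \<Rightarrow> ('k, 'w::ab_group_add) kspace \<Rightarrow> nat \<Rightarrow> ('k, ('k, 'v, 'w) tensor) kspace"
  where "tspace V W p = \<lparr>vec = tens V W p, scl = tscale\<rparr>"

lemma tspace_simps [simp]: "vec (tspace V W p) = tens V W p" "scl (tspace V W p) = tscale"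
  by (simp_all add: tspace_def)

lemma kclosed_tspace [simp]: "kclosed (tspace V W p)"
  by (simp add: kclosed_def tens_add tens_scale tens_zero)

lemma tens_diff: "x \<in> tens V W p \<Longrightarrow> y \<in> tens V W p \<Longrightarrow> x - y \<in> tens V W p"
  using Modules.module.subspace_diff[OF tscale_module subspace_tens] by blast

lemma tpure_tens: "x \<in> tuples V W p \<Longrightarrow> tpure V W p x \<in> tens V W p"
  unfolding tens_def by (intro Modules.module.span_base[OF tscale_module]) simp

text \<open>The standard way to compare maps below: linearity on the span leaves only pure tensors
  to check. Nothing is claimed outside \<open>tens V W p\<close>, where a \<open>tlift\<close> is an
  arbitrary linear extension.\<close>

lemma tens_eqI:
  assumes g: "klin_on (tspace V W p) s g" and h: "klin_on (tspace V W p) s h"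
    and eq: "\<And>x. x \<in> tuples V W p \<Longrightarrow> g (tpure V W p x) = h (tpure V W p x)"
    and t: "t \<in> tens V W p"
  shows "g t = h t"
proof -
  have "t \<in> tens V W p \<and> g t = h t"
    using t[unfolded tens_def]
  proof (induction rule: Modules.module.span_induct_alt[OF tscale_module, consumes 1, case_names base step])
    case base
    show ?case using tens_zero klin_zero[OF kclosed_tspace g] klin_zero[OF kclosed_tspace h] by metis
  next
    case (step c b t)
    then obtain x where x: "x \<in> tuples V W p" "b = tpure V W p x" by auto
    then have b: "b \<in> tens V W p" by (simp add: tpure_tens)
    note cb = tens_scale[OF b, of c]
    have e: "f (tscale c b + t) = s c (f b) + f t" if "klin_on (tspace V W p) s f" for f
      using klin_add[OF that, of "tscale c b" t] klin_scale[OF that, of b c] b cb step by simp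
    show ?case using step x eq e[OF g] e[OF h] tens_add[OF cb] by metis
  qed
  then show ?thesis ..
qed

lemma lin_klin_on: "lin tscale s g \<Longrightarrow> klin_on (tspace V W p) s g"
  by (simp add: klin_on_def lin_iff)

lemma tlift_klin: "vector_space s \<Longrightarrow> multilinear V W p s \<phi> \<Longrightarrow> klin_on (tspace V W p) s (tlift V W p s \<phi>)"
  by (rule lin_klin_on[OF tlift_linear])

section \<open>Bilinear maps and tensor products of two factors\<close>

definition bil :: "('k::field, 'v::ab_group_add) kspace \<Rightarrow> ('k, 'w::ab_group_add) kspace \<Rightarrow>
     ('k \<Rightarrow> 'u::ab_group_add \<Rightarrow> 'u) \<Rightarrow> ('v \<Rightarrow> 'w \<Rightarrow> 'u) \<Rightarrow> bool" where
  "bil V W s \<phi> \<longleftrightarrow> (\<forall>v\<in>vec V. klin_on W s (\<phi> v)) \<and> (\<forall>w\<in>vec W. klin_on V s (\<lambda>v. \<phi> v w))"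

lemma bilI: "(\<And>v. v \<in> vec V \<Longrightarrow> klin_on W s (\<phi> v)) \<Longrightarrow> (\<And>w. w \<in> vec W \<Longrightarrow> klin_on V s (\<lambda>v. \<phi> v w)) \<Longrightarrow> bil V W s \<phi>"
  by (simp add: bil_def)

lemma bil_left: "bil V W s \<phi> \<Longrightarrow> w \<in> vec W \<Longrightarrow> klin_on V s (\<lambda>v. \<phi> v w)"
  and bil_right: "bil V W s \<phi> \<Longrightarrow> v \<in> vec V \<Longrightarrow> klin_on W s (\<phi> v)"
  by (simp_all add: bil_def)

lemma bil_multilinear: "bil V W s \<phi> \<Longrightarrow> multilinear V W 1 s (\<lambda>(v, ws). \<phi> v (hd ws))"
  unfolding multilinear1 by (simp add: bil_def)

lemma tlift2_linear: "vector_space s \<Longrightarrow> bil V W s \<phi> \<Longrightarrow> lin tscale s (tlift2 V W s \<phi>)"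
  unfolding tlift2_def by (intro tlift_linear bil_multilinear)

lemma tlift2_tens2:
  assumes "vector_space s" "bil V W s \<phi>" "v \<in> vec V" "w \<in> vec W"
  shows "tlift2 V W s \<phi> (tens2 V W v w) = \<phi> v w"
proof -
  have "(v, [w]) \<in> tuples V W 1" using assms by (auto simp: tuples1)
  then show ?thesis
    unfolding tlift2_def tens2_def using tlift_tpure[OF assms(1) bil_multilinear[OF assms(2)]] by auto
qed

lemma tens2_tens: "v \<in> vec V \<Longrightarrow> w \<in> vec W \<Longrightarrow> tens2 V W v w \<in> tens V W 1"
  unfolding tens2_def by (rule tpure_tens) (auto simp: tuples1)

lemma bil_tens2: "bil V W tscale (tens2 V W)"
proof -
  have "multilinear V W 1 tscale (tpure V W 1)" by (rule multilinear_tpure)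
  then show ?thesis unfolding multilinear1 tens2_def bil_def klin_on_def by blast
qed

lemma tens2_eqI:
  assumes "klin_on (tspace V W 1) s g" "klin_on (tspace V W 1) s h"
    and "\<And>v w. v \<in> vec V \<Longrightarrow> w \<in> vec W \<Longrightarrow> g (tens2 V W v w) = h (tens2 V W v w)"
    and "t \<in> tens V W 1"
  shows "g t = h t"
  by (rule tens_eqI[OF assms(1,2) _ assms(4)]) (use assms(3) in \<open>auto simp: tuples1 tens2_def\<close>)

section \<open>Sweedler sums in coordinates\<close>

locale fd_hopf = hopf_algebra A for A :: "('k::field, 'a::ring_1) hopf" +
  assumes finite_dim_A: "finite_dim (sc A)"
begin

sublocale VA: vector_space "sc A" by (rule vector_space_A)

definition basis :: "'a set" where
  "basis = (SOME B. finite B \<and> VA.independent B \<and> VA.span B = UNIV)"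

lemma basis: "finite basis" "VA.independent basis" "VA.span basis = UNIV"
proof -
  obtain F where F: "finite F" "VA.span F = UNIV" using finite_dim_A by (auto simp: finite_dim_def)
  obtain B where B: "B \<subseteq> F" "VA.independent B" "F \<subseteq> VA.span B"
    using VA.maximal_independent_subset by blast
  have "finite B" using B(1) F(1) by (rule finite_subset)
  moreover have "VA.span B = UNIV" using VA.span_mono[OF B(3)] F(2) by (simp add: VA.span_span top.extremum_unique)
  ultimately have "\<exists>B. finite B \<and> VA.independent B \<and> VA.span B = UNIV" using B(2) by blast
  from someI_ex[OF this] show "finite basis" "VA.independent basis" "VA.span basis = UNIV"
    unfolding basis_def by auto
qed

text \<open>For \<open>b\<close> in \<open>basis\<close> these are the coordinate functionals, the
  dual basis.\<close>

definition co :: "'a \<Rightarrow> 'a \<Rightarrow> 'k" where "co b a = VA.representation basis a b"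

lemma spA_whole: "spA A = whole (sc A)" by (simp add: spA_def)

lemma lin_spA: "vector_space t \<Longrightarrow> klin_on (spA A) t f \<Longrightarrow> lin (sc A) t f"
  unfolding spA_whole by (rule klin_lin[OF vector_space_A])

lemma spA_lin: "lin (sc A) t f \<Longrightarrow> klin_on (spA A) t f"
  unfolding spA_whole by (rule lin_klin)

lemma co_lin: "lin (sc A) (*) (co b)"
  unfolding co_def using VA.linear_representation[OF basis(2,3)] by simp

lemma co_dual: "co b \<in> vec (dual (sc A))"
  using co_lin by (simp add: dual_def)

lemma dual_klin: "q \<in> vec (dual (sc A)) \<longleftrightarrow> klin_on (spA A) (*) q"
  using lin_spA[OF vector_space_times] spA_lin by (auto simp: dual_def)

lemma expand: "a = (\<Sum>b\<in>basis. sc A (co b a) b)"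
proof -
  have "(\<Sum>b\<in>basis. sc A (co b a) b) = a"
    unfolding co_def using VA.sum_representation_eq[OF basis(2) _ basis(1)] basis(3) by simp
  then show ?thesis by simp
qed

lemma co_basis: "b \<in> basis \<Longrightarrow> c \<in> basis \<Longrightarrow> co b c = (if b = c then 1 else 0)"
  unfolding co_def using VA.representation_basis[OF basis(2), of c] by auto

lemma klin_expand: assumes "klin_on (spA A) s f" shows "f a = (\<Sum>b\<in>basis. s (co b a) (f b))"
proof -
  have "f a = f (\<Sum>b\<in>basis. sc A (co b a) b)" using expand[of a] by simp
  also have "\<dots> = (\<Sum>b\<in>basis. f (sc A (co b a) b))" by (rule klin_sum[OF _ assms]) auto
  also have "\<dots> = (\<Sum>b\<in>basis. s (co b a) (f b))"
    using klin_scale[OF assms] by simp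
  finally show ?thesis .
qed

text \<open>The map \<open>id \<otimes> q\<close>, which evaluates the factor in \<open>A\<close>.
  Contracting a coaction with \<open>q\<close> gives the action of \<open>q\<close> as an element of
  the double.\<close>

definition contr :: "('k \<Rightarrow> 'v::ab_group_add \<Rightarrow> 'v) \<Rightarrow> ('a \<Rightarrow> 'k) \<Rightarrow> ('k, 'v, 'a) tensor \<Rightarrow> 'v" where
  "contr s q = tlift2 (whole s) (spA A) s (\<lambda>v a. s (q a) v)"

lemma bil_contr: assumes "vector_space s" "q \<in> vec (dual (sc A))" shows "bil (whole s) (spA A) s (\<lambda>v a. s (q a) v)"
proof -
  have "klin_on (spA A) (*) q" using assms by (simp add: dual_klin)
  then show ?thesis
    using assms(1) by (intro bilI klin_scl_left klin_scl) (auto intro: klin_id[of "whole s", simplified])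
qed

lemma contr_lin: "vector_space s \<Longrightarrow> q \<in> vec (dual (sc A)) \<Longrightarrow> lin tscale s (contr s q)"
  unfolding contr_def by (intro tlift2_linear bil_contr)

lemma contr_tens2: "vector_space s \<Longrightarrow> q \<in> vec (dual (sc A)) \<Longrightarrow> contr s q (tens2 (whole s) (spA A) v a) = s (q a) v"
  unfolding contr_def by (intro tlift2_tens2 bil_contr) auto

text \<open>The identity of \<open>A\<close> is the sum of the maps
  \<open>a \<mapsto> co b a\<close> times \<open>b\<close>. Applied to the second factor it writes a
  tensor through its contractions, so that finitely many functionals determine it.\<close>

lemma tens2_expand:
  assumes s: "vector_space s" and t: "t \<in> tens (whole s) (spA A) 1"
  shows "t = (\<Sum>b\<in>basis. tens2 (whole s) (spA A) (contr s (co b) t) b)"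
proof -
  let ?T = "tens2 (whole s) (spA A)"
  have bl: "klin_on (whole s) tscale (\<lambda>v. ?T v b)" for b
    by (rule bil_left[OF bil_tens2]) simp
  have br: "klin_on (spA A) tscale (?T v)" for v
    by (rule bil_right[OF bil_tens2]) simp
  show ?thesis
  proof (rule tens2_eqI[OF _ _ _ t])
    show "klin_on (tspace (whole s) (spA A) 1) tscale (\<lambda>t. t)"
      using klin_id[of "tspace (whole s) (spA A) 1"] by simp
    show "klin_on (tspace (whole s) (spA A) 1) tscale (\<lambda>t. \<Sum>b\<in>basis. ?T (contr s (co b) t) b)"
      by (intro klin_sum_fun vector_space_tscale klin_comp[OF bl])
        (auto intro!: lin_klin_on contr_lin s co_dual)
    show "?T v w = (\<Sum>b\<in>basis. ?T (contr s (co b) (?T v w)) b)" for v w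
    proof -
      have "?T v w = (\<Sum>b\<in>basis. tscale (co b w) (?T v b))" by (rule klin_expand[OF br])
      also have "\<dots> = (\<Sum>b\<in>basis. ?T (contr s (co b) (?T v w)) b)"
        using klin_scale[OF bl] by (simp add: contr_tens2 s co_dual)
      finally show ?thesis .
    qed
  qed
qed

lemma tlift2_expand:
  assumes s: "vector_space s" and t: "t \<in> tens (whole s) (spA A) 1"
    and u: "vector_space u" and phi: "bil (whole s) (spA A) u \<phi>"
  shows "tlift2 (whole s) (spA A) u \<phi> t = (\<Sum>b\<in>basis. \<phi> (contr s (co b) t) b)"
proof -
  note l = lin_klin[OF tlift2_linear[OF u phi]]
  have "tlift2 (whole s) (spA A) u \<phi> t =
     tlift2 (whole s) (spA A) u \<phi> (\<Sum>b\<in>basis. tens2 (whole s) (spA A) (contr s (co b) t) b)"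
    using tens2_expand[OF s t] by simp
  also have "\<dots> = (\<Sum>b\<in>basis. \<phi> (contr s (co b) t) b)"
    by (subst klin_sum[OF _ l]) (simp_all add: tlift2_tens2[OF u phi])
  finally show ?thesis .
qed

text \<open>Structure constants of the comultiplication: \<open>cf (b, c) a\<close> is the
  coefficient of \<open>b\<close> tensor \<open>c\<close> in the coproduct of
  \<open>a\<close>.\<close>

definition cf :: "'a \<times> 'a \<Rightarrow> 'a \<Rightarrow> 'k" where
  "cf p a = co (fst p) (contr (sc A) (co (snd p)) (cop A a))"

text \<open>
  The sum of \<open>\<phi> a\<^sub>1 a\<^sub>2\<close> computed from the values of \<open>\<phi>\<close> on basis elements.  In contrast to
  \<open>sw\<close> it is linear in \<open>a\<close> and coassociative even if \<open>\<phi>\<close> is not bilinear.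
\<close>

definition SW :: "('k \<Rightarrow> 'u::ab_group_add \<Rightarrow> 'u) \<Rightarrow> ('a \<Rightarrow> 'a \<Rightarrow> 'u) \<Rightarrow> 'a \<Rightarrow> 'u" where
  "SW s \<phi> a = (\<Sum>p\<in>basis \<times> basis. s (cf p a) (\<phi> (fst p) (snd p)))"

lemma SW_double: "SW s \<phi> a = (\<Sum>b\<in>basis. \<Sum>c\<in>basis. s (cf (b, c) a) (\<phi> b c))"
  unfolding SW_def by (simp add: sum.cartesian_product case_prod_unfold)

lemma cf_lin: "lin (sc A) (*) (cf p)"
proof -
  have "klin_on (spA A) (*) (\<lambda>a. co (fst p) (contr (sc A) (co (snd p)) (cop A a)))"
    by (rule klin_comp_lin[OF co_lin klin_comp_lin[OF contr_lin[OF vector_space_A co_dual] spA_lin[OF cop_linear]]])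
  then show ?thesis unfolding cf_def[abs_def] by (rule lin_spA[OF vector_space_times])
qed

lemma sw_SW: assumes u: "vector_space u" and phi: "bil (spA A) (spA A) u \<phi>"
  shows "sw A u \<phi> a = SW u \<phi> a"
proof -
  have "sw A u \<phi> a = (\<Sum>c\<in>basis. \<phi> (contr (sc A) (co c) (cop A a)) c)"
    unfolding sw_def using tlift2_expand[OF vector_space_A _ u, folded spA_whole, OF cop_closed phi] .
  also have "\<dots> = (\<Sum>c\<in>basis. \<Sum>b\<in>basis. u (cf (b, c) a) (\<phi> b c))"
  proof (rule sum.cong[OF refl])
    fix c
    have "klin_on (spA A) u (\<lambda>x. \<phi> x c)" using bil_left[OF phi] by simp
    from klin_expand[OF this, of "contr (sc A) (co c) (cop A a)"] show "\<phi> (contr (sc A) (co c) (cop A a)) c = (\<Sum>b\<in>basis. u (cf (b, c) a) (\<phi> b c))"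
      by (simp add: cf_def)
  qed
  also have "\<dots> = SW u \<phi> a"
    unfolding SW_double by (rule sum.swap)
  finally show ?thesis .
qed

section \<open>Calculus with Sweedler sums in coordinates\<close>

lemma klin_SW_arg: "vector_space t \<Longrightarrow> klin_on U (sc A) f \<Longrightarrow> klin_on U t (\<lambda>x. SW t \<phi> (f x))"
  unfolding SW_def by (intro klin_sum_fun klin_scl_left klin_comp_lin[OF cf_lin])

lemma klin_SW_body: "vector_space t \<Longrightarrow> (\<And>u v. klin_on U t (\<lambda>x. \<phi> x u v)) \<Longrightarrow> klin_on U t (\<lambda>x. SW t (\<phi> x) a)"
  unfolding SW_def by (intro klin_sum_fun klin_scl)

lemma SW_out:
  assumes "kclosed V" "klin_on V t f" "\<And>x y. \<phi> x y \<in> vec V"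
  shows "f (SW (scl V) \<phi> a) = SW t (\<lambda>x y. f (\<phi> x y)) a"
  unfolding SW_def
  by (subst klin_sum[OF assms(1,2)]) (auto simp: klin_scale[OF assms(2)] assms kclosed_scale)

lemma SW_closed: "kclosed V \<Longrightarrow> (\<And>x y. \<phi> x y \<in> vec V) \<Longrightarrow> SW (scl V) \<phi> a \<in> vec V"
  unfolding SW_def by (intro kclosed_sum) (auto intro: kclosed_scale)

lemma SW_lin: "lin s t f \<Longrightarrow> f (SW s \<phi> a) = SW t (\<lambda>x y. f (\<phi> x y)) a"
  using SW_out[OF kclosed_whole lin_klin, of s t f \<phi> a] by simp

lemma SW_apply: "SW tscale \<phi> a z = SW (*) (\<lambda>x y. \<phi> x y z) a"
proof -
  have "(\<Sum>p\<in>I. tscale (g p) (h p)) z = (\<Sum>p\<in>I. g p * h p z)" for I and g :: "_ \<Rightarrow> 'k" and h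
    by (induction I rule: infinite_finite_induct) (simp_all add: tscale_def)
  then show ?thesis unfolding SW_def .
qed

lemma SW_swap: assumes "vector_space s"
  shows "SW s (\<lambda>x y. SW s (\<lambda>u v. \<phi> x y u v) b) a = SW s (\<lambda>u v. SW s (\<lambda>x y. \<phi> x y u v) a) b"
proof -
  interpret vector_space s by fact
  show ?thesis unfolding SW_def
    by (simp add: scale_sum_right) (subst sum.swap, simp add: mult.commute)
qed

lemma SW_scale: "vector_space s \<Longrightarrow> s c (SW s \<phi> a) = SW s (\<lambda>x y. s c (\<phi> x y)) a"
  by (rule SW_lin) (simp add: lin_iff vector_space.vector_space_assms mult.commute)

lemma SW_add: "vector_space s \<Longrightarrow> SW s (\<lambda>x y. \<phi> x y + \<psi> x y) a = SW s \<phi> a + SW s \<psi> a"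
  unfolding SW_def by (simp add: vector_space.vector_space_assms sum.distrib)

lemmas vsp = vector_space_A vector_space_times vector_space_tscale

lemma klin_idA: "klin_on (spA A) (sc A) (\<lambda>x. x)"
  using klin_id[of "spA A"] by simp

lemma klin_mult_left: "klin_on U (sc A) f \<Longrightarrow> klin_on U (sc A) (\<lambda>x. f x * c)"
  and klin_mult_right: "klin_on U (sc A) f \<Longrightarrow> klin_on U (sc A) (\<lambda>x. c * f x)"
  by (simp_all add: klin_on_def distrib_left distrib_right scale_mult_left[symmetric] scale_mult_right[symmetric])

lemma klin_anti: "klin_on U (sc A) f \<Longrightarrow> klin_on U (sc A) (\<lambda>x. anti A (f x))"
  by (rule klin_comp_lin[OF anti_linear])

lemma klin_cou: "klin_on U (sc A) f \<Longrightarrow> klin_on U (*) (\<lambda>x. cou A (f x))"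
  by (rule klin_comp_lin[OF cou_linear])

lemma klin_co: "klin_on U (sc A) f \<Longrightarrow> klin_on U (*) (\<lambda>x. co b (f x))"
  by (rule klin_comp_lin[OF co_lin])

lemma klin_dual: "q \<in> vec (dual (sc A)) \<Longrightarrow> klin_on U (sc A) f \<Longrightarrow> klin_on U (*) (\<lambda>x. q (f x))"
  by (rule klin_comp_lin) (simp add: dual_def)

lemma klin_tpure:
  shows "v \<in> vec V \<Longrightarrow> klin_on (spA A) tscale (\<lambda>x. tpure V (spA A) 2 (v, [x, w]))"
    and "v \<in> vec V \<Longrightarrow> klin_on (spA A) tscale (\<lambda>x. tpure V (spA A) 2 (v, [w, x]))"
    and "klin_on V tscale (\<lambda>x. tpure V (spA A) 2 (x, [y, w]))"
  using multilinear_tpure[of V "spA A" 2] unfolding multilinear2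
  by (auto simp: klin_on_def)

lemma klin_tens2:
  shows "v \<in> vec V \<Longrightarrow> klin_on (spA A) tscale (\<lambda>x. tens2 V (spA A) v x)"
    and "klin_on V tscale (\<lambda>x. tens2 V (spA A) x w)"
  using bil_left[OF bil_tens2, of w "spA A" V] bil_right[OF bil_tens2, of v V "spA A"] by auto

lemmas klins = klin_idA klin_mult_left klin_mult_right klin_anti klin_cou klin_co klin_mult_field
  klin_scl klin_scl_left klin_SW_arg klin_SW_body klin_sum_fun klin_plus klin_diff vsp

text \<open>Applying \<open>co k\<close>, \<open>co l\<close> and \<open>co j\<close> to the three
  factors of the coassociativity axiom selects one coefficient on each side.\<close>

lemma cf_coassoc:
  assumes "k \<in> basis" "l \<in> basis" "j \<in> basis"
  shows "(\<Sum>i\<in>basis. cf (i, j) a * cf (k, l) i) = (\<Sum>i\<in>basis. cf (k, i) a * cf (l, j) i)"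
proof -
  let ?A = "spA A"
  let ?b = "\<lambda>(x, ws). co k x * (co l (ws ! 0) * co j (ws ! 1))"
  have ml: "multilinear ?A ?A 2 (*) ?b"
    unfolding multilinear2 by (auto intro!: klins simp: One_nat_def)
  let ?L = "tlift ?A ?A 2 (*) ?b"
  have L: "lin tscale (*) ?L" by (rule tlift_linear[OF vector_space_times ml])
  have Lp: "?L (tpure ?A ?A 2 (x, [y, z])) = co k x * (co l y * co j z)" for x y z
    by (subst tlift_tpure[OF vector_space_times ml]) (auto simp: tuples2 One_nat_def)
  have b1: "bil ?A ?A tscale (\<lambda>x1 x2. tpure ?A ?A 2 (x1, [x2, y]))"
       "bil ?A ?A tscale (\<lambda>x1 x2. tpure ?A ?A 2 (y, [x1, x2]))" for y
    by (auto intro!: bilI klin_tpure)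
  have e1: "sw A tscale (\<lambda>x y. sw A tscale (\<lambda>x1 x2. tpure ?A ?A 2 (x1, [x2, y])) x) a =
    SW tscale (\<lambda>x y. SW tscale (\<lambda>x1 x2. tpure ?A ?A 2 (x1, [x2, y])) x) a"
    unfolding sw_SW[OF vector_space_tscale b1(1)]
    by (rule sw_SW[OF vector_space_tscale]) (auto intro!: bilI klins klin_tpure)
  have e2: "sw A tscale (\<lambda>x y. sw A tscale (\<lambda>y1 y2. tpure ?A ?A 2 (x, [y1, y2])) y) a =
    SW tscale (\<lambda>x y. SW tscale (\<lambda>x1 x2. tpure ?A ?A 2 (x, [x1, x2])) y) a"
    unfolding sw_SW[OF vector_space_tscale b1(2)]
    by (rule sw_SW[OF vector_space_tscale]) (auto intro!: bilI klins klin_tpure)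
  have "SW (*) (\<lambda>x y. SW (*) (\<lambda>x1 x2. co k x1 * (co l x2 * co j y)) x) a =
        SW (*) (\<lambda>x y. SW (*) (\<lambda>x1 x2. co k x * (co l x1 * co j x2)) y) a"
    using arg_cong[OF coassoc[of a, unfolded e1 e2], of ?L] by (simp add: SW_lin[OF L] Lp)
  then have "(\<Sum>i\<in>basis. \<Sum>j'\<in>basis. cf (i, j') a * (\<Sum>k'\<in>basis. \<Sum>l'\<in>basis. cf (k', l') i * (co k k' * (co l l' * co j j')))) =
     (\<Sum>k'\<in>basis. \<Sum>i\<in>basis. cf (k', i) a * (\<Sum>l'\<in>basis. \<Sum>j'\<in>basis. cf (l', j') i * (co k k' * (co l l' * co j j'))))"
    by (simp only: SW_double)
  \<comment> \<open>On basis elements the functionals \<open>co\<close> are Kronecker deltas, so all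
    sums except the one over the intermediate index collapse.\<close>
  moreover have "(\<Sum>i\<in>basis. \<Sum>j'\<in>basis. cf (i, j') a * (\<Sum>k'\<in>basis. \<Sum>l'\<in>basis. cf (k', l') i * (co k k' * (co l l' * co j j'))))
     = (\<Sum>i\<in>basis. \<Sum>j'\<in>basis. if j = j' then cf (i, j) a * (\<Sum>k'\<in>basis. if k = k' then (\<Sum>l'\<in>basis. if l = l' then cf (k, l) i else 0) else 0) else 0)"
    by (intro sum.cong refl) (auto simp: co_basis assms intro!: sum.cong sum.neutral)
  moreover have "(\<Sum>k'\<in>basis. \<Sum>i\<in>basis. cf (k', i) a * (\<Sum>l'\<in>basis. \<Sum>j'\<in>basis. cf (l', j') i * (co k k' * (co l l' * co j j'))))
     = (\<Sum>k'\<in>basis. if k = k' then (\<Sum>i\<in>basis. cf (k, i) a * (\<Sum>l'\<in>basis. if l = l' then (\<Sum>j'\<in>basis. if j = j' then cf (l, j) i else 0) else 0)) else 0)"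
    by (intro sum.cong refl) (auto simp: co_basis assms intro!: sum.cong sum.neutral)
  ultimately show ?thesis using assms basis(1) by simp
qed

text \<open>Only the values of \<open>\<phi>\<close> on triples of basis elements enter, and their
  coefficients agree by \<open>cf_coassoc\<close>.\<close>

lemma SW_coassoc:
  assumes "vector_space s"
  shows "SW s (\<lambda>x y. SW s (\<lambda>x1 x2. \<phi> x1 x2 y) x) a = SW s (\<lambda>x y. SW s (\<lambda>y1 y2. \<phi> x y1 y2) y) a"
proof -
  interpret vector_space s by fact
  let ?B = basis
  have "SW s (\<lambda>x y. SW s (\<lambda>x1 x2. \<phi> x1 x2 y) x) a =
     (\<Sum>i\<in>?B. \<Sum>j\<in>?B. \<Sum>k\<in>?B. \<Sum>l\<in>?B. s (cf (i, j) a * cf (k, l) i) (\<phi> k l j))"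
    by (simp only: SW_double scale_sum_right scale_scale)
  \<comment> \<open>The swaps bring the index \<open>i\<close>, which is split a second time, to the
    innermost place, where \<open>cf_coassoc\<close> applies.\<close>
  also have "\<dots> = (\<Sum>k\<in>?B. \<Sum>l\<in>?B. \<Sum>j\<in>?B. \<Sum>i\<in>?B. s (cf (i, j) a * cf (k, l) i) (\<phi> k l j))"
    by (subst sum.swap, subst (2) sum.swap, subst (3) sum.swap, subst sum.swap, subst (2) sum.swap, rule refl)
  also have "\<dots> = (\<Sum>k\<in>?B. \<Sum>l\<in>?B. \<Sum>j\<in>?B. \<Sum>i\<in>?B. s (cf (k, i) a * cf (l, j) i) (\<phi> k l j))"
    by (rule sum.cong[OF refl], rule sum.cong[OF refl], rule sum.cong[OF refl]) (simp only: scale_sum_left[symmetric] cf_coassoc)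
  also have "\<dots> = (\<Sum>k\<in>?B. \<Sum>i\<in>?B. \<Sum>l\<in>?B. \<Sum>j\<in>?B. s (cf (k, i) a * cf (l, j) i) (\<phi> k l j))"
    by (subst (3) sum.swap, subst (2) sum.swap, rule refl)
  also have "\<dots> = SW s (\<lambda>x y. SW s (\<lambda>y1 y2. \<phi> x y1 y2) y) a"
    by (simp only: SW_double scale_sum_right scale_scale)
  finally show ?thesis .
qed

lemma SW_counit_left: assumes s: "vector_space s" and f: "klin_on (spA A) s f"
  shows "SW s (\<lambda>x y. s (cou A x) (f y)) a = f a"
proof -
  have "f a = f (sw A (sc A) (\<lambda>x y. sc A (cou A x) y) a)" by (simp add: counit_left)
  also have "\<dots> = f (SW (sc A) (\<lambda>x y. sc A (cou A x) y) a)"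
    by (subst sw_SW) (auto intro!: bilI klins)
  also have "\<dots> = SW s (\<lambda>x y. s (cou A x) (f y)) a"
    using SW_out[OF kclosed_spA f, of "\<lambda>x y. sc A (cou A x) y" a] klin_scale[OF f] by simp
  finally show ?thesis by simp
qed

lemma SW_counit_right: assumes s: "vector_space s" and f: "klin_on (spA A) s f"
  shows "SW s (\<lambda>x y. s (cou A y) (f x)) a = f a"
proof -
  have "f a = f (sw A (sc A) (\<lambda>x y. sc A (cou A y) x) a)" by (simp add: counit_right)
  also have "\<dots> = f (SW (sc A) (\<lambda>x y. sc A (cou A y) x) a)"
    by (subst sw_SW) (auto intro!: bilI klins)
  also have "\<dots> = SW s (\<lambda>x y. s (cou A y) (f x)) a"
    using SW_out[OF kclosed_spA f, of "\<lambda>x y. sc A (cou A y) x" a] klin_scale[OF f] by simp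
  finally show ?thesis by simp
qed

lemma SW_antipode_left: assumes f: "klin_on (spA A) s f"
  shows "SW s (\<lambda>x y. f (anti A x * y)) a = s (cou A a) (f 1)"
proof -
  have "s (cou A a) (f 1) = f (sw A (sc A) (\<lambda>x y. anti A x * y) a)"
    using klin_scale[OF f] by (simp add: antipode_left)
  also have "\<dots> = f (SW (sc A) (\<lambda>x y. anti A x * y) a)"
    by (subst sw_SW) (auto intro!: bilI klins)
  also have "\<dots> = SW s (\<lambda>x y. f (anti A x * y)) a"
    using SW_out[OF kclosed_spA f, of "\<lambda>x y. anti A x * y" a] by simp
  finally show ?thesis by simp
qed

lemma SW_antipode_right: assumes f: "klin_on (spA A) s f"
  shows "SW s (\<lambda>x y. f (x * anti A y)) a = s (cou A a) (f 1)"
proof -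
  have "s (cou A a) (f 1) = f (sw A (sc A) (\<lambda>x y. x * anti A y) a)"
    using klin_scale[OF f] by (simp add: antipode_right)
  also have "\<dots> = f (SW (sc A) (\<lambda>x y. x * anti A y) a)"
    by (subst sw_SW) (auto intro!: bilI klins)
  also have "\<dots> = SW s (\<lambda>x y. f (x * anti A y)) a"
    using SW_out[OF kclosed_spA f, of "\<lambda>x y. x * anti A y" a] by simp
  finally show ?thesis by simp
qed

text \<open>In contrast to \<open>SW_coassoc\<close>, \<open>\<phi>\<close> has to be bilinear:
  products of basis elements are no longer basis elements, so the left side must be read as a map on
  the tensor product, where \<open>cop_mult\<close> applies.\<close>

lemma SW_mult:
  assumes s: "vector_space s" and phi: "bil (spA A) (spA A) s \<phi>"
  shows "SW s \<phi> (a * b) = SW s (\<lambda>a1 a2. SW s (\<lambda>b1 b2. \<phi> (a1 * b1) (a2 * b2)) b) a"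
proof -
  let ?T = "tens2 (spA A) (spA A)"
  have b: "bil (spA A) (spA A) tscale (\<lambda>b1 b2. ?T (a1 * b1) (a2 * b2))" for a1 a2
    by (auto intro!: bilI klins klin_comp[OF klin_tens2(1)] klin_comp[OF klin_tens2(2)])
  have "bil (spA A) (spA A) tscale (\<lambda>a1 a2. SW tscale (\<lambda>b1 b2. ?T (a1 * b1) (a2 * b2)) b)"
    by (auto intro!: bilI klins klin_comp[OF klin_tens2(1)] klin_comp[OF klin_tens2(2)])
  then have c: "cop A (a * b) = SW tscale (\<lambda>a1 a2. SW tscale (\<lambda>b1 b2. ?T (a1 * b1) (a2 * b2)) b) a"
    unfolding cop_mult sw_SW[OF vector_space_tscale b] by (rule sw_SW[OF vector_space_tscale])
  have L: "lin tscale s (tlift2 (spA A) (spA A) s \<phi>)" by (rule tlift2_linear[OF s phi])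
  have "SW s \<phi> (a * b) = sw A s \<phi> (a * b)" using sw_SW[OF s phi] by simp
  also have "\<dots> = SW s (\<lambda>a1 a2. SW s (\<lambda>b1 b2. \<phi> (a1 * b1) (a2 * b2)) b) a"
    unfolding sw_def c SW_lin[OF L] by (simp add: tlift2_tens2[OF s phi])
  finally show ?thesis .
qed

lemma SW_one: assumes s: "vector_space s" and phi: "bil (spA A) (spA A) s \<phi>"
  shows "SW s \<phi> 1 = \<phi> 1 1"
  using sw_SW[OF s phi, of 1] tlift2_tens2[OF s phi, of 1 1] by (simp add: sw_def cop_one)

end

context fd_hopf
begin

section \<open>Iterated Sweedler sums\<close>

lemma sw_iter1: assumes s: "vector_space s" and phi: "klin_on (spA A) s (\<lambda>x. \<phi> [x])"
  shows "sw_iter A 1 s \<phi> a = \<phi> [a]"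
proof -
  have "multilinear (spA A) (spA A) 0 s (\<lambda>(x, xs). \<phi> (x # xs))"
    using phi by (simp add: multilinear0)
  from tlift_tpure[OF s this, of "(a, [])"] show ?thesis
    by (simp add: sw_iter_def tuples0)
qed

lemma cop_iter1: "cop_iter A 1 a = SW tscale (tens2 (spA A) (spA A)) a"
proof -
  have e: "sw A tscale (\<lambda>y z. tpure (spA A) (spA A) 1 (y, z # [])) x = SW tscale (tens2 (spA A) (spA A)) x" for x
    using sw_SW[OF vector_space_tscale bil_tens2] by (simp add: tens2_def[abs_def])
  have ml: "multilinear (spA A) (spA A) 0 tscale
       (\<lambda>(x, xs). sw A tscale (\<lambda>y z. tpure (spA A) (spA A) 1 (y, z # xs)) x)"
    by (auto simp: multilinear0 e intro!: klins)
  show ?thesis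
    using tlift_tpure[OF vector_space_tscale ml, of "(a, [])"]
    unfolding One_nat_def cop_iter.simps by (simp add: tuples0 e[unfolded One_nat_def])
qed

lemma sw_iter2: assumes s: "vector_space s" and phi: "bil (spA A) (spA A) s (\<lambda>x y. \<phi> [x, y])"
  shows "sw_iter A 2 s \<phi> a = SW s (\<lambda>x y. \<phi> [x, y]) a"
proof -
  have ml: "multilinear (spA A) (spA A) 1 s (\<lambda>(x, xs). \<phi> (x # xs))"
    using phi by (simp add: multilinear1 bil_def)
  have *: "tlift (spA A) (spA A) 1 s (\<lambda>(x, xs). \<phi> (x # xs)) (tens2 (spA A) (spA A) x y) = \<phi> [x, y]" for x y
    unfolding tens2_def using tlift_tpure[OF s ml, of "(x, [y])"] by (simp add: tuples1)
  have "sw_iter A 2 s \<phi> a = tlift (spA A) (spA A) 1 s (\<lambda>(x, xs). \<phi> (x # xs)) (cop_iter A 1 a)"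
    by (simp add: sw_iter_def One_nat_def)
  then show ?thesis
    unfolding cop_iter1 SW_lin[OF tlift_linear[OF s ml]] by (simp add: *)
qed

lemma cop_iter2: "cop_iter A 2 a =
   SW tscale (\<lambda>x w. SW tscale (\<lambda>y z. tpure (spA A) (spA A) 2 (y, [z, w])) x) a"
proof -
  have b: "bil (spA A) (spA A) tscale (\<lambda>x1 x2. tpure (spA A) (spA A) 2 (x1, [x2, y]))" for y
    by (auto intro!: bilI klin_tpure)
  note e = sw_SW[OF vector_space_tscale b]
  have ml: "multilinear (spA A) (spA A) 1 tscale
       (\<lambda>(x, xs). sw A tscale (\<lambda>y z. tpure (spA A) (spA A) 2 (y, z # xs)) x)"
    by (auto simp: multilinear1 e intro!: klins klin_tpure)
  have *: "tlift (spA A) (spA A) 1 tscale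
       (\<lambda>(x, xs). sw A tscale (\<lambda>y z. tpure (spA A) (spA A) 2 (y, z # xs)) x) (tens2 (spA A) (spA A) x w) =
     SW tscale (\<lambda>y z. tpure (spA A) (spA A) 2 (y, [z, w])) x" for x w
    unfolding tens2_def using tlift_tpure[OF vector_space_tscale ml, of "(x, [w])"] by (simp add: tuples1 e)
  have "cop_iter A 2 a = tlift (spA A) (spA A) 1 tscale
       (\<lambda>(x, xs). sw A tscale (\<lambda>y z. tpure (spA A) (spA A) 2 (y, z # xs)) x) (cop_iter A 1 a)"
    by (simp add: numeral_2_eq_2 One_nat_def)
  then show ?thesis
    unfolding cop_iter1 SW_lin[OF tlift_linear[OF vector_space_tscale ml]] by (simp add: *)
qed

text \<open>\<open>cop_iter\<close> splits the first factor again and so yields sums nested to the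
  left. Coassociativity turns them to the right, the form in which the double is handled.\<close>

lemma sw_iter3:
  assumes s: "vector_space s"
    and 1: "\<And>y z. klin_on (spA A) s (\<lambda>x. \<phi> [x, y, z])"
    and 2: "\<And>x z. klin_on (spA A) s (\<lambda>y. \<phi> [x, y, z])"
    and 3: "\<And>x y. klin_on (spA A) s (\<lambda>z. \<phi> [x, y, z])"
  shows "sw_iter A 3 s \<phi> a = SW s (\<lambda>x r. SW s (\<lambda>y z. \<phi> [x, y, z]) r) a"
proof -
  have ml: "multilinear (spA A) (spA A) 2 s (\<lambda>(x, xs). \<phi> (x # xs))"
    using 1 2 3 by (simp add: multilinear2)
  have *: "tlift (spA A) (spA A) 2 s (\<lambda>(x, xs). \<phi> (x # xs)) (tpure (spA A) (spA A) 2 (x, [y, z])) = \<phi> [x, y, z]" for x y z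
    using tlift_tpure[OF s ml, of "(x, [y, z])"] by (simp add: tuples2)
  have "sw_iter A 3 s \<phi> a = tlift (spA A) (spA A) 2 s (\<lambda>(x, xs). \<phi> (x # xs)) (cop_iter A 2 a)"
    by (simp add: sw_iter_def)
  also have "\<dots> = SW s (\<lambda>x w. SW s (\<lambda>y z. \<phi> [y, z, w]) x) a"
    unfolding cop_iter2 SW_lin[OF tlift_linear[OF s ml]] by (simp add: *)
  also have "\<dots> = SW s (\<lambda>x r. SW s (\<lambda>y z. \<phi> [x, y, z]) r) a"
    by (rule SW_coassoc[OF s])
  finally show ?thesis .
qed

section \<open>The antipode\<close>

abbreviation \<epsilon> where "\<epsilon> \<equiv> cou A"
abbreviation S where "S \<equiv> anti A"

lemma anti_one: "S 1 = 1"
proof -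
  have "SW (sc A) (\<lambda>x y. S x * y) 1 = S 1 * 1"
    by (rule SW_one) (auto intro!: bilI klins)
  moreover have "SW (sc A) (\<lambda>x y. S x * y) 1 = 1"
    using SW_antipode_left[OF klin_idA, of 1] by (simp add: cou_one)
  ultimately show ?thesis by simp
qed

lemma cou_anti: "\<epsilon> (S a) = \<epsilon> a"
proof -
  have "\<epsilon> a = SW (*) (\<lambda>x y. \<epsilon> (S x * y)) a"
    by (subst SW_antipode_left) (auto intro!: klins simp: cou_one)
  also have "\<dots> = SW (*) (\<lambda>x y. \<epsilon> y * \<epsilon> (S x)) a"
    by (simp add: cou_mult mult.commute)
  also have "\<dots> = \<epsilon> (S a)"
    by (rule SW_counit_right) (auto intro!: klins)
  finally show ?thesis by simp
qed

text \<open>Both sides are inverse to the multiplication for the convolution of maps from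
  \<open>A \<otimes> A\<close> to \<open>A\<close>, hence equal.\<close>

lemma anti_mult: "S (a * b) = S b * S a"
proof -
  \<comment> \<open>The threefold convolution product of a left inverse, the multiplication and a
    right inverse. Contracting the first pair gives \<open>S b * S a\<close>, contracting the last
    pair gives \<open>S (a * b)\<close>.\<close>
  define Z where "Z = SW (sc A) (\<lambda>x a3. SW (sc A) (\<lambda>y b3. SW (sc A) (\<lambda>a1 a2. SW (sc A)
      (\<lambda>b1 b2. S (a1 * b1) * (a2 * b2) * (S b3 * S a3)) y) x) b) a"
  have in1: "SW (sc A) (\<lambda>a1 a2. SW (sc A) (\<lambda>b1 b2. S (a1 * b1) * (a2 * b2) * c) y) x = sc A (\<epsilon> x) (sc A (\<epsilon> y) c)" for c x y
  proof -
    have "SW (sc A) (\<lambda>a1 a2. SW (sc A) (\<lambda>b1 b2. S (a1 * b1) * (a2 * b2) * c) y) x =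
       SW (sc A) (\<lambda>u v. S u * v * c) (x * y)"
      by (rule SW_mult[symmetric]) (auto intro!: bilI klins)
    also have "\<dots> = sc A (\<epsilon> (x * y)) (1 * c)"
      by (rule SW_antipode_left) (auto intro!: klins)
    finally show ?thesis by (simp add: cou_mult)
  qed
  have "Z = SW (sc A) (\<lambda>x a3. SW (sc A) (\<lambda>y b3. sc A (\<epsilon> x) (sc A (\<epsilon> y) (S b3 * S a3))) b) a"
    unfolding Z_def in1 ..
  also have "\<dots> = SW (sc A) (\<lambda>x a3. sc A (\<epsilon> x) (SW (sc A) (\<lambda>y b3. sc A (\<epsilon> y) (S b3 * S a3)) b)) a"
    by (simp only: SW_scale[OF vector_space_A])
  also have "\<dots> = SW (sc A) (\<lambda>x a3. sc A (\<epsilon> x) (S b * S a3)) a"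
    by (subst SW_counit_left[of "sc A" "\<lambda>b. S b * _"]) (auto intro!: klins)
  also have "\<dots> = S b * S a"
    by (rule SW_counit_left) (auto intro!: klins)
  finally have Z1: "Z = S b * S a" .
  have "Z = SW (sc A) (\<lambda>x a3. SW (sc A) (\<lambda>a1 a2. SW (sc A) (\<lambda>y b3. SW (sc A)
      (\<lambda>b1 b2. S (a1 * b1) * (a2 * b2) * (S b3 * S a3)) y) b) x) a"
    unfolding Z_def by (subst (2) SW_swap[OF vector_space_A]) (rule refl)
  also have "\<dots> = SW (sc A) (\<lambda>a1 r. SW (sc A) (\<lambda>a2 a3. SW (sc A) (\<lambda>b1 q. SW (sc A)
      (\<lambda>b2 b3. S (a1 * b1) * (a2 * b2) * (S b3 * S a3)) q) b) r) a"
    by (simp only: SW_coassoc[OF vector_space_A])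
  also have "\<dots> = SW (sc A) (\<lambda>a1 r. SW (sc A) (\<lambda>a2 a3. SW (sc A) (\<lambda>b1 q. sc A (\<epsilon> q)
      (S (a1 * b1) * a2 * S a3)) b) r) a"
  proof -
    have "SW (sc A) (\<lambda>b2 b3. S (a1 * b1) * (a2 * b2) * (S b3 * S a3)) q = sc A (\<epsilon> q) (S (a1 * b1) * a2 * S a3)" for a1 a2 a3 b1 q
    proof -
      have "klin_on (spA A) (sc A) (\<lambda>z. S (a1 * b1) * a2 * z * S a3)" by (auto intro!: klins)
      from SW_antipode_right[OF this, of q] show ?thesis by (simp add: mult.assoc)
    qed
    then show ?thesis by simp
  qed
  also have "\<dots> = SW (sc A) (\<lambda>a1 r. SW (sc A) (\<lambda>a2 a3. S (a1 * b) * a2 * S a3) r) a"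
    by (subst SW_counit_right[of "sc A" "\<lambda>b. S (_ * b) * _ * _"]) (auto intro!: klins)
  also have "\<dots> = SW (sc A) (\<lambda>a1 r. sc A (\<epsilon> r) (S (a1 * b))) a"
  proof -
    have "SW (sc A) (\<lambda>a2 a3. S (a1 * b) * a2 * S a3) r = sc A (\<epsilon> r) (S (a1 * b))" for a1 r
    proof -
      have "klin_on (spA A) (sc A) (\<lambda>z. S (a1 * b) * z)" by (auto intro!: klins)
      from SW_antipode_right[OF this, of r] show ?thesis by (simp add: mult.assoc)
    qed
    then show ?thesis by simp
  qed
  also have "\<dots> = S (a * b)"
    by (rule SW_counit_right) (auto intro!: klins)
  finally show ?thesis using Z1 by simp
qed

lemma klin_comp_bil:
  assumes "bil (spA A) (spA A) s \<phi>" "klin_on U (sc A) f"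
  shows "klin_on U s (\<lambda>x. \<phi> (f x) c)" "klin_on U s (\<lambda>x. \<phi> c (f x))"
  using klin_comp[OF bil_left[OF assms(1)], of c U f] klin_comp[OF bil_right[OF assms(1)], of c U f] assms(2)
  by simp_all

text \<open>Uniqueness of convolution inverses again, now for maps from \<open>A\<close> to
  \<open>A \<otimes> A\<close>: both sides invert the comultiplication. Everything is evaluated
  through \<open>\<phi>\<close>, so that no product on \<open>A \<otimes> A\<close> has to be
  introduced.\<close>

lemma anti_comult:
  assumes s: "vector_space s" and phi: "bil (spA A) (spA A) s \<phi>"
  shows "SW s \<phi> (S a) = SW s (\<lambda>x y. \<phi> (S y) (S x)) a"
proof -
  note k = klins klin_comp_bil[OF phi] s
  \<comment> \<open>Inserts the factor \<open>a3 * S a4\<close>, whose Sweedler sum is a counit, in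
    the second argument.\<close>
  have e1: "\<phi> (u * (a2 * S a5)) v = SW s (\<lambda>w a4. SW s (\<lambda>a2 a3. \<phi> (u * a2 * S a5) (v * a3 * S a4)) w) a2" for u v a2 a5
  proof -
    have 1: "SW s (\<lambda>a3 a4. \<phi> (u * a2 * S a5) (v * a3 * S a4)) q = s (\<epsilon> q) (\<phi> (u * a2 * S a5) v)" for a2 q
    proof -
      have "klin_on (spA A) s (\<lambda>z. \<phi> (u * a2 * S a5) (v * z))" by (auto intro!: k)
      from SW_antipode_right[OF this, of q] show ?thesis by (simp add: mult.assoc)
    qed
    have "\<phi> (u * a2 * S a5) v = SW s (\<lambda>a2 q. s (\<epsilon> q) (\<phi> (u * a2 * S a5) v)) a2"
      by (rule SW_counit_right[OF s, symmetric]) (auto intro!: k)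
    also have "\<dots> = SW s (\<lambda>a2 q. SW s (\<lambda>a3 a4. \<phi> (u * a2 * S a5) (v * a3 * S a4)) q) a2"
      by (simp only: 1)
    also have "\<dots> = SW s (\<lambda>w a4. SW s (\<lambda>a2 a3. \<phi> (u * a2 * S a5) (v * a3 * S a4)) w) a2"
      by (rule SW_coassoc[OF s, symmetric])
    finally show ?thesis by (simp only: mult.assoc)
  qed
  have "SW s \<phi> (S a) = SW s (\<lambda>a1 r. s (\<epsilon> r) (SW s \<phi> (S a1))) a"
    by (rule SW_counit_right[OF s, symmetric]) (auto intro!: k)
  \<comment> \<open>The factor \<open>p * S a5\<close> is inserted in the first argument; together
    with \<open>e1\<close> this spreads \<open>a\<close> over five legs.\<close>
  also have "\<dots> = SW s (\<lambda>a1 r. SW s (\<lambda>u v. SW s (\<lambda>p a5. \<phi> (u * (p * S a5)) v) r) (S a1)) a"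
  proof -
    have "SW s (\<lambda>p a5. \<phi> (u * (p * S a5)) v) r = s (\<epsilon> r) (\<phi> u v)" for u v r
    proof -
      have "klin_on (spA A) s (\<lambda>z. \<phi> (u * z) v)" by (auto intro!: k)
      from SW_antipode_right[OF this, of r] show ?thesis by simp
    qed
    then show ?thesis by (simp add: SW_scale[OF s])
  qed
  also have "\<dots> = SW s (\<lambda>a1 r. SW s (\<lambda>p a5. SW s (\<lambda>u v. \<phi> (u * (p * S a5)) v) (S a1)) r) a"
    by (subst (2) SW_swap[OF s]) (rule refl)
  also have "\<dots> = SW s (\<lambda>a1 r. SW s (\<lambda>p a5. SW s (\<lambda>u v. SW s (\<lambda>w a4. SW s (\<lambda>a2 a3. \<phi> (u * a2 * S a5) (v * a3 * S a4)) w) p) (S a1)) r) a"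
    by (simp only: e1)
  also have "\<dots> = SW s (\<lambda>a1 r. SW s (\<lambda>p a5. SW s (\<lambda>w a4. SW s (\<lambda>u v. SW s (\<lambda>a2 a3. \<phi> (u * a2 * S a5) (v * a3 * S a4)) w) (S a1)) p) r) a"
    by (subst (3) SW_swap[OF s]) (rule refl)
  also have "\<dots> = SW s (\<lambda>a1 r. SW s (\<lambda>p a5. SW s (\<lambda>w a4. SW s (\<lambda>u v. \<phi> (u * S a5) (v * S a4)) (S a1 * w)) p) r) a"
  proof -
    have "SW s (\<lambda>u v. SW s (\<lambda>a2 a3. \<phi> (u * a2 * S a5) (v * a3 * S a4)) w) (S a1) =
       SW s (\<lambda>u v. \<phi> (u * S a5) (v * S a4)) (S a1 * w)" for a1 w a4 a5
      by (rule SW_mult[OF s, symmetric]) (auto intro!: bilI k)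
    then show ?thesis by simp
  qed
  also have "\<dots> = SW s (\<lambda>a1 r. SW s (\<lambda>w t. SW s (\<lambda>a4 a5. SW s (\<lambda>u v. \<phi> (u * S a5) (v * S a4)) (S a1 * w)) t) r) a"
    by (simp only: SW_coassoc[OF s])
  \<comment> \<open>Regrouped so that \<open>S a1\<close> meets its neighbour \<open>w\<close>. The
    antipode law then leaves only the last two legs, in reversed order.\<close>
  also have "\<dots> = SW s (\<lambda>y t. SW s (\<lambda>a1 w. SW s (\<lambda>a4 a5. SW s (\<lambda>u v. \<phi> (u * S a5) (v * S a4)) (S a1 * w)) t) y) a"
    by (rule SW_coassoc[OF s, symmetric])
  also have "\<dots> = SW s (\<lambda>y t. s (\<epsilon> y) (SW s (\<lambda>a4 a5. \<phi> (S a5) (S a4)) t)) a"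
  proof -
    have "SW s (\<lambda>a1 w. SW s (\<lambda>a4 a5. SW s (\<lambda>u v. \<phi> (u * S a5) (v * S a4)) (S a1 * w)) t) y =
       s (\<epsilon> y) (SW s (\<lambda>a4 a5. SW s (\<lambda>u v. \<phi> (u * S a5) (v * S a4)) 1) t)" for t y
      by (rule SW_antipode_left) (auto intro!: k)
    moreover have "SW s (\<lambda>u v. \<phi> (u * S a5) (v * S a4)) 1 = \<phi> (S a5) (S a4)" for a4 a5
      by (subst SW_one[OF s]) (auto intro!: bilI k)
    ultimately show ?thesis by simp
  qed
  also have "\<dots> = SW s (\<lambda>a4 a5. \<phi> (S a5) (S a4)) a"
    by (rule SW_counit_left[OF s]) (auto intro!: k)
  finally show ?thesis .
qed

section \<open>Bijectivity of the antipode\<close>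

text \<open>Each application of \<open>S\<close> reverses the comultiplication, so an odd power
  exchanges the two factors. The parity lets both cases share one statement.\<close>

definition twist :: "nat \<Rightarrow> ('a \<Rightarrow> 'a \<Rightarrow> 'u) \<Rightarrow> 'a \<Rightarrow> 'a \<Rightarrow> 'u" where
  "twist j \<phi> x y = (if even j then \<phi> x y else \<phi> y x)"

lemma pow_lin: "lin (sc A) (sc A) (S ^^ j)"
proof (induction j)
  case (Suc j)
  have "klin_on (spA A) (sc A) (\<lambda>x. S ((S ^^ j) x))" by (intro klin_anti spA_lin Suc)
  then show ?case using lin_spA[OF vector_space_A] by (simp add: o_def)
qed (simp add: lin_iff vector_space_A)

lemma klin_pow: "klin_on U (sc A) f \<Longrightarrow> klin_on U (sc A) (\<lambda>x. (S ^^ j) (f x))"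
  by (rule klin_comp_lin[OF pow_lin])

lemma cou_pow: "\<epsilon> ((S ^^ j) a) = \<epsilon> a"
  by (induction j) (auto simp: cou_anti)

lemma pow_comult:
  assumes s: "vector_space s" and phi: "bil (spA A) (spA A) s \<phi>"
  shows "SW s \<phi> ((S ^^ j) a) = SW s (twist j (\<lambda>x y. \<phi> ((S ^^ j) x) ((S ^^ j) y))) a"
  using phi
proof (induction j arbitrary: \<phi>)
  case (Suc j)
  have b: "bil (spA A) (spA A) s (\<lambda>x y. \<phi> (S y) (S x))"
    by (auto intro!: bilI klin_comp_bil[OF Suc.prems] klins)
  have "SW s \<phi> ((S ^^ Suc j) a) = SW s (\<lambda>x y. \<phi> (S y) (S x)) ((S ^^ j) a)"
    using anti_comult[OF s Suc.prems] by simp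
  also have "\<dots> = SW s (twist (Suc j) (\<lambda>x y. \<phi> ((S ^^ Suc j) x) ((S ^^ Suc j) y))) a"
    unfolding Suc.IH[OF b] by (cases "even j") (simp_all add: twist_def[abs_def])
  finally show ?case .
qed (simp add: twist_def[abs_def])

text \<open>The usual argument \<open>f = f * (g * h) = (f * g) * h = h\<close> for convolution,
  taken with respect to the opposite comultiplication when \<open>j\<close> is odd.\<close>

lemma conv_inverse_unique:
  assumes fg: "\<And>a. SW (sc A) (twist j (\<lambda>x y. f x * g y)) a = sc A (\<epsilon> a) 1"
    and gh: "\<And>a. SW (sc A) (twist j (\<lambda>x y. g x * h y)) a = sc A (\<epsilon> a) 1"
    and f: "klin_on (spA A) (sc A) f" and h: "klin_on (spA A) (sc A) h"
  shows "f a = h a"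
proof -
  have kf: "klin_on U (sc A) (\<lambda>x. f (i x))" if "klin_on U (sc A) i" for U :: "('k, 'x::ab_group_add) kspace" and i
    using klin_comp[OF f, of U i] that by simp
  have o: "SW (sc A) (\<lambda>x y. c * \<phi> x y) r = c * SW (sc A) \<phi> r" "SW (sc A) (\<lambda>x y. \<phi> x y * c) r = SW (sc A) \<phi> r * c" for \<phi> c r
    using SW_out[OF kclosed_spA klin_mult_right[OF klin_idA], of \<phi> c r]
      SW_out[OF kclosed_spA klin_mult_left[OF klin_idA], of \<phi> r c] by simp_all
  show ?thesis
  proof (cases "even j")
    case True
    have "f a = SW (sc A) (\<lambda>x r. sc A (\<epsilon> r) (f x)) a"
      by (rule SW_counit_right[OF vector_space_A f, symmetric])
    also have "\<dots> = SW (sc A) (\<lambda>x r. SW (sc A) (\<lambda>y z. f x * g y * h z) r) a"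
      using gh True by (simp add: twist_def[abs_def] mult.assoc o scale_mult_right[symmetric])
    also have "\<dots> = SW (sc A) (\<lambda>w z. SW (sc A) (\<lambda>x y. f x * g y * h z) w) a"
      by (rule SW_coassoc[OF vector_space_A, symmetric])
    also have "\<dots> = SW (sc A) (\<lambda>w z. sc A (\<epsilon> w) (h z)) a"
      using fg True by (simp add: twist_def[abs_def] o scale_mult_left[symmetric])
    also have "\<dots> = h a" by (rule SW_counit_left[OF vector_space_A h])
    finally show ?thesis .
  next
    case False
    have "f a = SW (sc A) (\<lambda>r x. sc A (\<epsilon> r) (f x)) a"
      by (rule SW_counit_left[OF vector_space_A f, symmetric])
    also have "\<dots> = SW (sc A) (\<lambda>r x. SW (sc A) (\<lambda>z y. f x * g y * h z) r) a"
      using gh False by (simp add: twist_def[abs_def] mult.assoc o scale_mult_right[symmetric])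
    also have "\<dots> = SW (sc A) (\<lambda>z w. SW (sc A) (\<lambda>y x. f x * g y * h z) w) a"
      by (rule SW_coassoc[OF vector_space_A])
    also have "\<dots> = SW (sc A) (\<lambda>z w. sc A (\<epsilon> w) (h z)) a"
      using fg False by (simp add: twist_def[abs_def] o scale_mult_left[symmetric])
    also have "\<dots> = h a" by (rule SW_counit_right[OF vector_space_A h])
    finally show ?thesis .
  qed
qed

text \<open>
  A linear \<open>S'\<close> with \<open>S' S = id\<close> on the image of \<open>S\<^sup>j\<^sup>+\<^sup>1\<close> gives
  \<open>u = S' S\<^sup>j\<^sup>+\<^sup>1\<close> with \<open>S u = S\<^sup>j\<^sup>+\<^sup>1\<close>.  Both \<open>u\<close> and \<open>S\<^sup>j\<close> are compatible with the
  comultiplication (up to a flip for odd \<open>j\<close>), so both are convolution inverse to \<open>S\<^sup>j\<^sup>+\<^sup>1\<close>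
  and therefore equal.
\<close>

lemma kernel_descent:
  assumes ker: "\<And>a. (S ^^ Suc (Suc j)) a = 0 \<Longrightarrow> (S ^^ Suc j) a = 0"
    and a0: "(S ^^ Suc j) a0 = 0"
  shows "(S ^^ j) a0 = 0"
proof -
  interpret FD: finite_dimensional_vector_space "sc A" basis
    using basis by unfold_locales auto
  interpret FP: finite_dimensional_vector_space_pair_1 "sc A" basis "sc A" by unfold_locales
  interpret T: Vector_Spaces.linear "sc A" "sc A" "S ^^ Suc j" by (rule pow_lin)
  interpret L: Vector_Spaces.linear "sc A" "sc A" S by (rule anti_linear)
  let ?V = "range (S ^^ Suc j)"
  have V: "VA.subspace ?V" by (rule T.subspace_image) (rule VA.subspace_UNIV)
  have SV: "S ` ?V \<subseteq> ?V"
  proof -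
    have "S ((S ^^ Suc j) a) = (S ^^ Suc j) (S a)" for a by (simp add: funpow_swap1)
    then show ?thesis by blast
  qed
  have inj: "inj_on S ?V"
  proof (rule inj_onI)
    fix x y assume xy: "x \<in> ?V" "y \<in> ?V" "S x = S y"
    then obtain c d where cd: "x = (S ^^ Suc j) c" "y = (S ^^ Suc j) d" by blast
    have "(S ^^ Suc (Suc j)) (c - d) = 0"
      using xy(3) cd T.diff L.diff by simp
    from ker[OF this] show "x = y" using cd T.diff by simp
  qed
  have spV: "VA.span ?V = ?V" using VA.span_eq_iff V by blast
  \<comment> \<open>\<open>S\<close> maps the finite-dimensional \<open>?V\<close> injectively into
    itself, hence onto.\<close>
  have "VA.dim (S ` ?V) = VA.dim ?V"
    by (rule FP.dim_image_eq[OF anti_linear]) (simp only: spV inj)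
  then have "S ` ?V = ?V"
    using FD.subspace_dim_equal[OF L.subspace_image[OF V] V SV] by simp
  then have surj: "\<exists>c. (S ^^ Suc j) a = (S ^^ Suc (Suc j)) c" for a
    by (auto simp: image_iff set_eq_iff)
  obtain S' where S': "lin (sc A) (sc A) S'" "\<And>v. v \<in> ?V \<Longrightarrow> S' (S v) = v"
    using FP.linear_exists_left_inverse_on[OF anti_linear V inj] by blast
  have S'_pow: "S' ((S ^^ Suc (Suc j)) c) = (S ^^ Suc j) c" for c
    using S'(2)[of "(S ^^ Suc j) c"] by simp
  define u where "u a = S' ((S ^^ Suc j) a)" for a
  have ku: "klin_on U (sc A) (\<lambda>x. u (f x))" if "klin_on U (sc A) f" for U :: "('k, 'x::ab_group_add) kspace" and f
    unfolding u_def by (intro klin_comp_lin[OF S'(1)] klin_pow that)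
  have Su: "S (u a) = (S ^^ Suc j) a" for a
  proof -
    obtain c where c: "(S ^^ Suc j) a = (S ^^ Suc (Suc j)) c" using surj by blast
    then have "u a = (S ^^ Suc j) c" by (simp only: u_def S'_pow)
    then show ?thesis using c by simp
  qed
  have eps_u: "\<epsilon> (u a) = \<epsilon> a" for a
    using Su[of a] cou_anti[of "u a"] cou_pow[of "Suc j" a] by simp
  have com_u: "SW (sc A) \<phi> (u a) = SW (sc A) (twist j (\<lambda>x y. \<phi> (u x) (u y))) a"
    if phi: "bil (spA A) (spA A) (sc A) \<phi>" for \<phi> a
  proof -
    \<comment> \<open>Writing \<open>S\<^sup>j\<^sup>+\<^sup>1 a\<close> as
      \<open>S\<^sup>j\<^sup>+\<^sup>2 c\<close> gives
      \<open>u a = S\<^sup>j\<^sup>+\<^sup>1 c\<close>. The compatibility of \<open>u\<close> at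
      \<open>a\<close> is then that of this power at \<open>c\<close>, with one \<open>S\<close>
      cancelled in each factor by \<open>S'\<close>.\<close>
    obtain c where c: "(S ^^ Suc j) a = (S ^^ Suc (Suc j)) c" using surj by blast
    let ?\<psi> = "\<lambda>x y. \<phi> (S' y) (S' x)"
    have psi: "bil (spA A) (spA A) (sc A) ?\<psi>"
      by (auto intro!: bilI klin_comp_bil[OF phi] klin_comp_lin[OF S'(1)] klins)
    have "SW (sc A) (twist j (\<lambda>x y. \<phi> (u x) (u y))) a = SW (sc A) ?\<psi> ((S ^^ Suc j) a)"
      unfolding pow_comult[OF vector_space_A psi] by (cases "even j") (simp_all add: twist_def[abs_def] u_def)
    also have "\<dots> = SW (sc A) (twist (Suc (Suc j)) (\<lambda>x y. \<phi> ((S ^^ Suc j) y) ((S ^^ Suc j) x))) c"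
      unfolding c pow_comult[OF vector_space_A psi] by (simp only: S'_pow)
    also have "\<dots> = SW (sc A) \<phi> ((S ^^ Suc j) c)"
      unfolding pow_comult[OF vector_space_A phi] by (cases "even j") (simp_all add: twist_def[abs_def])
    also have "(S ^^ Suc j) c = u a" using c by (simp only: u_def S'_pow)
    finally show ?thesis by simp
  qed
  have bm: "bil (spA A) (spA A) (sc A) (\<lambda>x y. S x * y)" "bil (spA A) (spA A) (sc A) (\<lambda>x y. x * S y)"
    by (auto intro!: bilI klins)
  have "SW (sc A) (twist j (\<lambda>x y. (S ^^ Suc j) x * u y)) a = sc A (\<epsilon> a) 1" for a
    using com_u[OF bm(1), of a] SW_antipode_left[OF klin_idA, of "u a"] unfolding Su by (simp add: eps_u)
  moreover have "SW (sc A) (twist j (\<lambda>x y. (S ^^ j) x * (S ^^ Suc j) y)) a = sc A (\<epsilon> a) 1" for a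
    using pow_comult[OF vector_space_A bm(2), of j a] SW_antipode_right[OF klin_idA, of "(S ^^ j) a"]
    by (simp add: cou_pow)
  ultimately have "(S ^^ j) a0 = u a0"
    using conv_inverse_unique[of j "S ^^ j" "S ^^ Suc j" u a0] ku[OF klin_idA] klin_pow[OF klin_idA] by blast
  also have "\<dots> = 0" using a0 S'(1) Vector_Spaces.linear.axioms(3)[OF S'(1)] by (simp only: u_def module_hom.zero)
  finally show ?thesis .
qed

text \<open>Otherwise the kernels of the powers form a strictly increasing chain of subspaces, with
  dimensions beyond that of \<open>A\<close>.\<close>

lemma kernel_stable: "\<exists>n. \<forall>a. (S ^^ Suc n) a = 0 \<longrightarrow> (S ^^ n) a = 0"
proof (rule ccontr)
  assume neg: "\<nexists>n. \<forall>a. (S ^^ Suc n) a = 0 \<longrightarrow> (S ^^ n) a = 0"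
  interpret FD: finite_dimensional_vector_space "sc A" basis
    using basis by unfold_locales auto
  let ?K = "\<lambda>n. {a. (S ^^ n) a = 0}"
  have sub: "VA.subspace (?K n)" for n
  proof -
    interpret T: Vector_Spaces.linear "sc A" "sc A" "S ^^ n" by (rule pow_lin)
    show ?thesis by (rule T.subspace_kernel)
  qed
  have S0: "S 0 = 0"
    using klin_zero[OF kclosed_spA klin_anti[OF klin_idA]] by simp
  have le: "?K n \<subseteq> ?K (Suc n)" for n by (auto simp: S0)
  have lt: "VA.dim (?K n) < VA.dim (?K (Suc n))" for n
  proof (rule ccontr)
    assume "\<not> VA.dim (?K n) < VA.dim (?K (Suc n))"
    then have "?K n = ?K (Suc n)"
      by (intro FD.subspace_dim_equal sub le) simp
    then show False using neg by blast
  qed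
  have "n \<le> VA.dim (?K n)" for n
  proof (induction n)
    case (Suc n)
    show ?case using order.strict_trans1[OF Suc lt[of n]] by (simp only: Suc_le_eq)
  qed simp
  from this[of "Suc (card basis)"] FD.dim_subset[of "?K (Suc (card basis))" UNIV] show False by simp
qed

text \<open>\<open>kernel_descent\<close> lowers the exponent of a stable kernel to 0, where
  stability says that \<open>S\<close> is injective.\<close>

lemma bij_anti: "bij S"
proof -
  interpret FD: finite_dimensional_vector_space "sc A" basis
    using basis by unfold_locales auto
  interpret L: Vector_Spaces.linear "sc A" "sc A" S by (rule anti_linear)
  obtain n where n: "\<And>a. (S ^^ Suc n) a = 0 \<Longrightarrow> (S ^^ n) a = 0" using kernel_stable by blast
  have d: "(\<forall>a. (S ^^ Suc n) a = 0 \<longrightarrow> (S ^^ n) a = 0) \<Longrightarrow> (\<forall>a. (S ^^ Suc 0) a = 0 \<longrightarrow> (S ^^ 0) a = 0)" for n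
    by (induction n) (use kernel_descent in blast)+
  have "\<forall>a. (S ^^ Suc 0) a = 0 \<longrightarrow> (S ^^ 0) a = 0" by (rule d[of n]) (use n in blast)
  then have "\<forall>a. S a = 0 \<longrightarrow> a = 0" by simp
  then have "inj S" by (simp add: L.inj_iff_eq_0)
  then show ?thesis using FD.linear_inj_imp_surj[OF anti_linear] by (simp add: bij_def)
qed

abbreviation SI where "SI \<equiv> inv_into UNIV (anti A)"

lemma S_SI [simp]: "S (SI a) = a" and SI_S [simp]: "SI (S a) = a"
  using bij_anti by (simp_all add: bij_is_inj bij_is_surj surj_f_inv_f)

lemma S_inj: "S a = S b \<Longrightarrow> a = b"
  by (metis SI_S)

lemma SI_lin: "lin (sc A) (sc A) SI"
proof -
  have a: "S (x + y) = S x + S y" and c: "S (sc A k x) = sc A k (S x)" for x y k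
    using anti_linear unfolding lin_iff by blast+
  have "SI (x + y) = SI x + SI y" "SI (sc A k x) = sc A k (SI x)" for x y k
    by (rule S_inj, simp add: a c)+
  then show ?thesis unfolding lin_iff using vector_space_A by blast
qed

lemma klin_SI: "klin_on U (sc A) f \<Longrightarrow> klin_on U (sc A) (\<lambda>x. SI (f x))"
  by (rule klin_comp_lin[OF SI_lin])

lemma SI_mult: "SI (a * b) = SI b * SI a"
  by (rule S_inj) (simp add: anti_mult)

lemma SI_one: "SI 1 = 1"
  by (rule S_inj) (simp add: anti_one)

lemma cou_SI: "\<epsilon> (SI a) = \<epsilon> a"
  using cou_anti[of "SI a"] by simp

lemma SI_comult:
  assumes s: "vector_space s" and phi: "bil (spA A) (spA A) s \<phi>"
  shows "SW s \<phi> (SI a) = SW s (\<lambda>x y. \<phi> (SI y) (SI x)) a"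
proof -
  have "bil (spA A) (spA A) s (\<lambda>x y. \<phi> (SI y) (SI x))"
    by (auto intro!: bilI klin_comp_bil[OF phi] klins klin_SI)
  from anti_comult[OF s this, of "SI a"] show ?thesis by simp
qed

text \<open>Applying the injective \<open>S\<close> turns this into the antipode law. Since
  \<open>S\<close> reverses products, it is the second leg that carries the inverse
  antipode.\<close>

lemma SW_SI_left: assumes f: "klin_on (spA A) s f" and s: "vector_space s"
  shows "SW s (\<lambda>x y. f (SI y * x)) a = s (\<epsilon> a) (f 1)"
proof -
  have "S (SW (sc A) (\<lambda>x y. SI y * x) a) = SW (sc A) (\<lambda>x y. S x * y) a"
    using SW_lin[OF anti_linear] by (simp add: anti_mult)
  also have "\<dots> = sc A (\<epsilon> a) 1"
    using SW_antipode_left[OF klin_idA, of a] by simp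
  also have "\<dots> = S (sc A (\<epsilon> a) 1)"
    using klin_scale[OF klin_anti[OF klin_idA]] by (simp add: anti_one)
  finally have e: "SW (sc A) (\<lambda>x y. SI y * x) a = sc A (\<epsilon> a) 1" by (rule S_inj)
  show ?thesis
    using arg_cong[OF e, of f] SW_out[OF kclosed_spA f, of "\<lambda>x y. SI y * x" a] klin_scale[OF f] by simp
qed

lemma SW_SI_right: assumes f: "klin_on (spA A) s f" and s: "vector_space s"
  shows "SW s (\<lambda>x y. f (y * SI x)) a = s (\<epsilon> a) (f 1)"
proof -
  have "S (SW (sc A) (\<lambda>x y. y * SI x) a) = SW (sc A) (\<lambda>x y. x * S y) a"
    using SW_lin[OF anti_linear] by (simp add: anti_mult)
  also have "\<dots> = sc A (\<epsilon> a) 1"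
    using SW_antipode_right[OF klin_idA, of a] by simp
  also have "\<dots> = S (sc A (\<epsilon> a) 1)"
    using klin_scale[OF klin_anti[OF klin_idA]] by (simp add: anti_one)
  finally have e: "SW (sc A) (\<lambda>x y. y * SI x) a = sc A (\<epsilon> a) 1" by (rule S_inj)
  show ?thesis
    using arg_cong[OF e, of f] SW_out[OF kclosed_spA f, of "\<lambda>x y. y * SI x" a] klin_scale[OF f] by simp
qed

end

section \<open>More on tensors\<close>

lemma bil_cong:
  assumes "bil V W s \<psi>" "\<And>v w. v \<in> vec V \<Longrightarrow> w \<in> vec W \<Longrightarrow> \<phi> v w = \<psi> v w" "kclosed V" "kclosed W"
  shows "bil V W s \<phi>"
  using assms by (simp add: bil_def klin_on_def kclosed_def)

lemma tens2_closed:
  assumes f: "klin_on (tspace V W 1) (scl Z) f" and Z: "kclosed Z"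
    and pure: "\<And>v w. v \<in> vec V \<Longrightarrow> w \<in> vec W \<Longrightarrow> f (tens2 V W v w) \<in> vec Z"
    and t: "t \<in> tens V W 1"
  shows "f t \<in> vec Z"
proof -
  have "t \<in> tens V W 1 \<and> f t \<in> vec Z"
    using t[unfolded tens_def]
  proof (induction rule: Modules.module.span_induct_alt[OF tscale_module, consumes 1, case_names base step])
    case base
    show ?case using tens_zero klin_zero[OF kclosed_tspace f] Z unfolding kclosed_def by metis
  next
    case (step c b t)
    then obtain v w where x: "v \<in> vec V" "w \<in> vec W" "b = tens2 V W v w" by (auto simp: tuples1 tens2_def)
    then have b: "b \<in> tens V W 1" by (simp add: tens2_tens)
    note cb = tens_scale[OF b, of c]
    have "f (tscale c b + t) = scl Z c (f b) + f t"
      using klin_add[OF f, of "tscale c b" t] klin_scale[OF f, of b c] b cb step by simp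
    moreover have "f b \<in> vec Z" using pure x by blast
    ultimately have "f (tscale c b + t) \<in> vec Z" using step(2) Z unfolding kclosed_def by metis
    then show ?case using step(2) tens_add[OF cb] by blast
  qed
  then show ?thesis ..
qed

text \<open>\<open>tlift2\<close> chooses a map separately for each value of the parameter, so the
  dependence on the parameter is controlled only on \<open>tens V W 1\<close>, where pure tensors
  determine everything.\<close>

lemma klin_tlift2_param:
  assumes s: "vector_space s" and U: "kclosed U"
    and b: "\<And>x. x \<in> vec U \<Longrightarrow> bil V W s (\<phi> x)"
    and k: "\<And>v w. v \<in> vec V \<Longrightarrow> w \<in> vec W \<Longrightarrow> klin_on U s (\<lambda>x. \<phi> x v w)"
    and t: "t \<in> tens V W 1"
  shows "klin_on U s (\<lambda>x. tlift2 V W s (\<phi> x) t)"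
proof (rule klin_onI)
  note L = lin_klin_on[OF tlift2_linear[OF s b]]
  note P = tlift2_tens2[OF s b]
  fix x y assume x: "x \<in> vec U" and y: "y \<in> vec U"
  then have xy: "x + y \<in> vec U" using U by (simp add: kclosed_def)
  show "tlift2 V W s (\<phi> (x + y)) t = tlift2 V W s (\<phi> x) t + tlift2 V W s (\<phi> y) t"
    by (rule tens2_eqI[OF L[OF xy] klin_plus[OF s L[OF x] L[OF y]] _ t])
      (simp add: P x y xy klin_add[OF k])
next
  note L = lin_klin_on[OF tlift2_linear[OF s b]]
  note P = tlift2_tens2[OF s b]
  fix c x assume x: "x \<in> vec U"
  then have cx: "scl U c x \<in> vec U" using U by (simp add: kclosed_def)
  show "tlift2 V W s (\<phi> (scl U c x)) t = s c (tlift2 V W s (\<phi> x) t)"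
    by (rule tens2_eqI[OF L[OF cx] klin_scl[OF s L[OF x]] _ t])
      (simp add: P x cx klin_scale[OF k])
qed

section \<open>The dual algebra\<close>

context fd_hopf
begin

abbreviation DA where "DA \<equiv> dual (sc A)"
abbreviation TD where "TD \<equiv> tens2 (dual (sc A)) (spA A)"
abbreviation DD where "DD \<equiv> tens (dual (sc A)) (spA A) 1"

lemma kclosed_DA [simp]: "kclosed DA"
  by (rule kclosed_dual[OF vector_space_A])

lemma dualI: "klin_on (spA A) (*) q \<Longrightarrow> q \<in> vec DA"
  by (simp add: dual_klin)

lemma eps_dual [simp]: "\<epsilon> \<in> vec DA"
  using cou_linear by (simp add: dual_def)

text \<open>The product of the dual algebra in terms of \<open>SW\<close>: it agrees with
  \<open>convolution\<close> on linear functionals and is associative on all functions.\<close>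

definition cnv :: "('a \<Rightarrow> 'k) \<Rightarrow> ('a \<Rightarrow> 'k) \<Rightarrow> 'a \<Rightarrow> 'k" where
  "cnv q q' = (\<lambda>x. SW (*) (\<lambda>u v. q u * q' v) x)"

lemma cnv_dual [simp]: "cnv q q' \<in> vec DA"
  unfolding dual_klin cnv_def by (intro klins)

lemma convolution_cnv: "q \<in> vec DA \<Longrightarrow> q' \<in> vec DA \<Longrightarrow> convolution A q q' = cnv q q'"
  unfolding convolution_def cnv_def
  by (intro ext sw_SW) (auto intro!: bilI klins simp: dual_klin)

lemma klin_cnv: "klin_on U tscale f \<Longrightarrow> klin_on U tscale (\<lambda>x. cnv (f x) q)"
  "klin_on U tscale f \<Longrightarrow> klin_on U tscale (\<lambda>x. cnv q (f x))"
proof -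
  assume "klin_on U tscale f"
  then have "klin_on U (*) (\<lambda>x. f x z)" for z by (simp add: klin_on_def tscale_def)
  then show "klin_on U tscale (\<lambda>x. cnv (f x) q)" "klin_on U tscale (\<lambda>x. cnv q (f x))"
    unfolding cnv_def by (auto intro!: klin_fun klins)
qed

lemma cnv_assoc: "cnv (cnv p q) r = cnv p (cnv q r)"
proof
  fix x
  have "cnv (cnv p q) r x = SW (*) (\<lambda>w z. SW (*) (\<lambda>u v. p u * q v * r z) w) x"
    using SW_lin[of "(*)" "(*)" "\<lambda>c. c * r _"] by (simp add: cnv_def lin_iff vector_space_times algebra_simps)
  also have "\<dots> = SW (*) (\<lambda>u w. SW (*) (\<lambda>v z. p u * q v * r z) w) x"
    by (rule SW_coassoc[OF vector_space_times])
  also have "\<dots> = cnv p (cnv q r) x"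
    by (simp add: cnv_def SW_scale[OF vector_space_times] mult.assoc)
  finally show "cnv (cnv p q) r x = cnv p (cnv q r) x" .
qed

lemma cnv_eps: "q \<in> vec DA \<Longrightarrow> cnv \<epsilon> q = q" "q \<in> vec DA \<Longrightarrow> cnv q \<epsilon> = q"
  using SW_counit_left[OF vector_space_times, of q] SW_counit_right[OF vector_space_times, of q]
  by (auto simp: cnv_def dual_klin mult.commute)

text \<open>The functionals \<open>co b\<close> form a basis of the dual, in which \<open>q\<close>
  has the coordinates \<open>q b\<close>.\<close>

lemma dual_expand: assumes f: "klin_on DA s f" and q: "q \<in> vec DA"
  shows "f q = (\<Sum>b\<in>basis. s (q b) (f (co b)))"
proof -
  have e1: "q a = (\<Sum>b\<in>basis. co b a * q b)" for a
    using klin_expand[of "(*)" q a] q by (simp add: dual_klin)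
  have e2: "(\<Sum>b\<in>I. tscale (q b) (co b)) a = (\<Sum>b\<in>I. q b * co b a)" for a I
    by (induction I rule: infinite_finite_induct) (simp_all add: tscale_def)
  have "q = (\<Sum>b\<in>basis. tscale (q b) (co b))"
  proof
    show "q a = (\<Sum>b\<in>basis. tscale (q b) (co b)) a" for a
      unfolding e2 using e1[of a] by (simp only: mult.commute)
  qed
  then have "f q = f (\<Sum>b\<in>basis. tscale (q b) (co b))" by (rule arg_cong)
  also have "\<dots> = (\<Sum>b\<in>basis. s (q b) (f (co b)))"
    using klin_sum[OF kclosed_DA f, of basis "\<lambda>b. tscale (q b) (co b)"] klin_scale[OF f]
      kclosed_scale[OF kclosed_DA] by (simp add: co_dual)
  finally show ?thesis .
qed

text \<open>The functional that results when an element of \<open>A\<close> with outer legs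
  \<open>b\<close> and \<open>c\<close> is moved past \<open>q\<close> in the double.\<close>

definition tw :: "'a \<Rightarrow> 'a \<Rightarrow> ('a \<Rightarrow> 'k) \<Rightarrow> 'a \<Rightarrow> 'k" where
  "tw b c q = (\<lambda>x. q (SI c * x * b))"

lemma tw_dual [simp]: assumes "q \<in> vec DA" shows "tw b c q \<in> vec DA"
proof -
  have "klin_on (spA A) (*) (\<lambda>x. q (SI c * x * b))"
    by (rule klin_dual[OF assms]) (intro klins)
  then show ?thesis by (simp only: tw_def dual_klin)
qed

lemma klin_tw:
  "q \<in> vec DA \<Longrightarrow> klin_on U (sc A) f \<Longrightarrow> klin_on U tscale (\<lambda>x. tw (f x) c q)"
  "q \<in> vec DA \<Longrightarrow> klin_on U (sc A) f \<Longrightarrow> klin_on U tscale (\<lambda>x. tw b (f x) q)"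
  "klin_on U tscale g \<Longrightarrow> klin_on U tscale (\<lambda>x. tw b c (g x))"
proof -
  show "klin_on U tscale (\<lambda>x. tw b c (g x))" if "klin_on U tscale g"
    using that by (simp add: klin_on_def tscale_def tw_def fun_eq_iff)
qed (unfold tw_def, (intro klin_fun klin_dual klins klin_SI; assumption)+)

lemma klin_TD_left: "klin_on U tscale f \<Longrightarrow> (\<And>x. x \<in> vec U \<Longrightarrow> f x \<in> vec DA) \<Longrightarrow> klin_on U tscale (\<lambda>x. TD (f x) c)"
  by (rule klin_comp[OF klin_tens2(2)]) auto

lemma klin_TD_right: "q \<in> vec DA \<Longrightarrow> klin_on U (sc A) f \<Longrightarrow> klin_on U tscale (\<lambda>x. TD q (f x))"
  by (rule klin_comp[OF klin_tens2(1)]) auto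

lemma klin_idD: "klin_on DA tscale (\<lambda>q. q)"
  using klin_id[of DA] by simp

lemmas dklins = klin_TD_left klin_TD_right klin_tw klin_cnv klin_idD klins

section \<open>The Drinfel'd double is an associative algebra\<close>

text \<open>The product of two pure tensors of the double, in \<open>SW\<close> form so that
  coassociativity applies directly.\<close>

definition dpure :: "('a \<Rightarrow> 'k) \<Rightarrow> 'a \<Rightarrow> ('a \<Rightarrow> 'k) \<Rightarrow> 'a \<Rightarrow> ('k, 'a \<Rightarrow> 'k, 'a) tensor" where
  "dpure q a q' a' = SW tscale (\<lambda>a1 r. SW tscale (\<lambda>a2 a3. TD (cnv q (tw a1 a3 q')) (a2 * a')) r) a"

lemma klin_dpure:
  shows "q' \<in> vec DA \<Longrightarrow> klin_on DA tscale (\<lambda>q. dpure q a q' a')"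
    and "q' \<in> vec DA \<Longrightarrow> klin_on (spA A) tscale (\<lambda>a. dpure q a q' a')"
    and "klin_on DA tscale (\<lambda>q'. dpure q a q' a')"
    and "q' \<in> vec DA \<Longrightarrow> klin_on (spA A) tscale (\<lambda>a'. dpure q a q' a')"
  unfolding dpure_def by (auto intro!: dklins)

lemma dpure_DD: "dpure q a q' a' \<in> DD"
proof -
  have k: "kclosed (tspace DA (spA A) 1)" by simp
  have "SW tscale (\<lambda>a2 a3. TD (cnv q (tw a1 a3 q')) (a2 * a')) r \<in> DD" for a1 r
    using SW_closed[OF k, of "\<lambda>a2 a3. TD (cnv q (tw a1 a3 q')) (a2 * a')" r] by (simp add: tens2_tens)
  then show ?thesis
    unfolding dpure_def using SW_closed[OF k] by simp
qed

lemma dmult_inner: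
  assumes "q \<in> vec DA" "q' \<in> vec DA"
  shows "sw_iter A 3 tscale (\<lambda>hs. TD (convolution A q (\<lambda>x. q' (SI (hs ! 2) * x * hs ! 0))) (hs ! 1 * a')) a
    = dpure q a q' a'"
proof -
  have e: "convolution A q (\<lambda>x. q' (SI c * x * b)) = cnv q (tw b c q')" for b c
    using convolution_cnv[OF assms(1) tw_dual[OF assms(2)]] by (simp add: tw_def)
  show ?thesis
    unfolding dpure_def by (subst sw_iter3) (auto simp: e One_nat_def intro!: dklins assms)
qed

text \<open>A \<open>tlift2\<close> can be evaluated only after its body is known to be bilinear;
  \<open>bil_cong\<close> carries bilinearity over from \<open>dpure\<close>.\<close>

lemma dmult_bil1:
  assumes "q \<in> vec DA"
  shows "bil DA (spA A) tscale (\<lambda>q' a'. sw_iter A 3 tscale (\<lambda>hs. TD (convolution A q (\<lambda>x. q' (SI (hs ! 2) * x * hs ! 0))) (hs ! 1 * a')) a)"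
  by (rule bil_cong[where \<psi> = "dpure q a"]) (auto intro!: bilI klin_dpure dmult_inner assms)

text \<open>Left multiplication by the pure tensor of \<open>q\<close> and \<open>a\<close>. It is
  linear on the whole type, which makes it easier to compose than
  \<open>double_mult\<close>.\<close>

definition dleft :: "('a \<Rightarrow> 'k) \<Rightarrow> 'a \<Rightarrow> ('k, 'a \<Rightarrow> 'k, 'a) tensor \<Rightarrow> ('k, 'a \<Rightarrow> 'k, 'a) tensor" where
  "dleft q a = tlift2 DA (spA A) tscale (dpure q a)"

lemma bil_dpure: "bil DA (spA A) tscale (dpure q a)"
  by (auto intro!: bilI klin_dpure)

lemma dleft_lin: "lin tscale tscale (dleft q a)"
  unfolding dleft_def by (rule tlift2_linear[OF vector_space_tscale bil_dpure])

lemma dleft_TD: "q' \<in> vec DA \<Longrightarrow> dleft q a (TD q' a') = dpure q a q' a'"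
  unfolding dleft_def by (rule tlift2_tens2[OF vector_space_tscale bil_dpure]) auto

lemma bil_dleft: "t \<in> DD \<Longrightarrow> bil DA (spA A) tscale (\<lambda>q a. dleft q a t)"
  unfolding dleft_def
  by (intro bilI klin_tlift2_param vector_space_tscale bil_dpure klin_dpure) auto

lemma dmult_dleft: assumes q: "q \<in> vec DA" and t: "t \<in> DD"
  shows "tlift2 DA (spA A) tscale (\<lambda>q' a'. sw_iter A 3 tscale (\<lambda>hs. TD (convolution A q (\<lambda>x. q' (SI (hs ! 2) * x * hs ! 0))) (hs ! 1 * a')) a) t
   = dleft q a t"
  by (rule tens2_eqI[OF lin_klin_on[OF tlift2_linear[OF vector_space_tscale dmult_bil1[OF q]]] lin_klin_on[OF dleft_lin] _ t])
    (simp add: tlift2_tens2[OF vector_space_tscale dmult_bil1[OF q]] dleft_TD dmult_inner q)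

lemma dmult_bil2: "t \<in> DD \<Longrightarrow> bil DA (spA A) tscale (\<lambda>q a. tlift2 DA (spA A) tscale (\<lambda>q' a'. sw_iter A 3 tscale (\<lambda>hs. TD (convolution A q (\<lambda>x. q' (SI (hs ! 2) * x * hs ! 0))) (hs ! 1 * a')) a) t)"
  by (rule bil_cong[OF bil_dleft]) (auto simp: dmult_dleft)

lemma dmult_TD: "q \<in> vec DA \<Longrightarrow> t \<in> DD \<Longrightarrow> double_mult A (TD q a) t = dleft q a t"
  unfolding double_mult_def
  by (subst tlift2_tens2[OF vector_space_tscale dmult_bil2]) (auto simp: dmult_dleft)

lemma dmult_klin_left: "t \<in> DD \<Longrightarrow> klin_on (tspace DA (spA A) 1) tscale (\<lambda>d. double_mult A d t)"
  unfolding double_mult_def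
  by (intro lin_klin_on tlift2_linear vector_space_tscale dmult_bil2)

lemma DD_add: "d \<in> DD \<Longrightarrow> e \<in> DD \<Longrightarrow> d + e \<in> DD" and DD_scale: "d \<in> DD \<Longrightarrow> tscale c d \<in> DD"
  by (rule tens_add tens_scale; assumption)+

lemma TD_DD [simp]: "q \<in> vec DA \<Longrightarrow> TD q a \<in> DD"
  by (rule tens2_tens) auto

text \<open>The second argument sits inside the choice made by the outer \<open>tlift2\<close>, so
  linearity is checked for pure tensors \<open>d\<close>, where the product is
  \<open>dleft\<close>.\<close>

lemma dmult_klin_right: assumes d: "d \<in> DD" shows "klin_on (tspace DA (spA A) 1) tscale (double_mult A d)"
proof (rule klin_onI)
  fix x y assume "x \<in> vec (tspace DA (spA A) 1)" "y \<in> vec (tspace DA (spA A) 1)"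
  then have xy: "x \<in> DD" "y \<in> DD" "x + y \<in> DD" by (auto intro: DD_add)
  show "double_mult A d (x + y) = double_mult A d x + double_mult A d y"
    by (rule tens2_eqI[OF dmult_klin_left[OF xy(3)] klin_plus[OF vector_space_tscale dmult_klin_left[OF xy(1)] dmult_klin_left[OF xy(2)]] _ d])
      (use dleft_lin in \<open>simp add: dmult_TD xy lin_iff\<close>)
next
  fix c x assume "x \<in> vec (tspace DA (spA A) 1)"
  then have x: "x \<in> DD" "tscale c x \<in> DD" by (auto intro: DD_scale)
  show "double_mult A d (scl (tspace DA (spA A) 1) c x) = tscale c (double_mult A d x)"
    unfolding tspace_simps
    by (rule tens2_eqI[OF dmult_klin_left[OF x(2)] klin_scl[OF vector_space_tscale dmult_klin_left[OF x(1)]] _ d])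
      (use dleft_lin in \<open>simp add: dmult_TD x lin_iff\<close>)
qed

lemma dmult_TD_TD: "q \<in> vec DA \<Longrightarrow> q' \<in> vec DA \<Longrightarrow> double_mult A (TD q a) (TD q' a') = dpure q a q' a'"
  by (simp add: dmult_TD dleft_TD)

lemma dleft_DD: "t \<in> DD \<Longrightarrow> dleft q a t \<in> DD"
  using tens2_closed[of DA "spA A" "tspace DA (spA A) 1" "dleft q a"] lin_klin_on[OF dleft_lin]
  by (simp add: dleft_TD dpure_DD)

lemma dmult_DD: "d \<in> DD \<Longrightarrow> t \<in> DD \<Longrightarrow> double_mult A d t \<in> DD"
  using tens2_closed[of DA "spA A" "tspace DA (spA A) 1" "\<lambda>d. double_mult A d t"] dmult_klin_left
  by (simp add: dmult_TD dleft_DD)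

lemma dpure_one_left: assumes "q \<in> vec DA" "q' \<in> vec DA"
  shows "dpure q 1 q' a' = TD (cnv q q') a'"
proof -
  have "dpure q 1 q' a' = SW tscale (\<lambda>a2 a3. TD (cnv q (tw 1 a3 q')) (a2 * a')) 1"
    unfolding dpure_def by (rule SW_one[OF vector_space_tscale]) (auto intro!: bilI dklins assms)
  also have "\<dots> = TD (cnv q (tw 1 1 q')) (1 * a')"
    by (rule SW_one[OF vector_space_tscale]) (auto intro!: bilI dklins assms)
  finally show ?thesis by (simp add: tw_def SI_one)
qed

text \<open>The counit is multiplicative and invariant under \<open>SI\<close>, so twisting it only
  produces scalars, which the counit laws absorb.\<close>

lemma dpure_eps_right: assumes q: "q \<in> vec DA"
  shows "dpure q a \<epsilon> a' = TD q (a * a')"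
proof -
  have tw_eps: "tw b c \<epsilon> = tscale (\<epsilon> b) (tscale (\<epsilon> c) \<epsilon>)" for b c
    by (auto simp: tw_def tscale_def cou_mult cou_SI)
  have "klin_on DA tscale (\<lambda>p. TD (cnv q p) m)" for m
    by (intro dklins) auto
  then have e: "TD (cnv q (tw b c \<epsilon>)) m = tscale (\<epsilon> b) (tscale (\<epsilon> c) (TD q m))" for b c m
    using klin_scale[of DA tscale "\<lambda>p. TD (cnv q p) m"] kclosed_scale[OF kclosed_DA]
    by (simp add: tw_eps cnv_eps q)
  have "dpure q a \<epsilon> a' = SW tscale (\<lambda>a1 r. tscale (\<epsilon> a1) (SW tscale (\<lambda>a2 a3. tscale (\<epsilon> a3) (TD q (a2 * a'))) r)) a"
    unfolding dpure_def e SW_scale[OF vector_space_tscale] ..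
  also have "\<dots> = SW tscale (\<lambda>a1 r. tscale (\<epsilon> a1) (TD q (r * a'))) a"
    by (subst SW_counit_right[OF vector_space_tscale, of "\<lambda>r. TD q (r * a')"]) (auto intro!: dklins q)
  also have "\<dots> = TD q (a * a')"
    by (rule SW_counit_left[OF vector_space_tscale]) (auto intro!: dklins q)
  finally show ?thesis .
qed

lemma klin_idT: "klin_on (tspace V W p) tscale (\<lambda>t. t)"
  using klin_id[of "tspace V W p"] by simp

lemma one_dmult: assumes t: "t \<in> DD" shows "double_mult A (TD \<epsilon> 1) t = t"
  by (rule tens2_eqI[OF dmult_klin_right[OF TD_DD[OF eps_dual]] klin_idT _ t])
    (simp add: dmult_TD_TD dpure_one_left cnv_eps)

lemma dmult_one: assumes t: "t \<in> DD" shows "double_mult A t (TD \<epsilon> 1) = t"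
  by (rule tens2_eqI[OF dmult_klin_left[OF TD_DD[OF eps_dual]] klin_idT _ t])
    (simp add: dmult_TD_TD dpure_eps_right)

end

text \<open>
  The algebra \<open>A\<close> and its dual act on a space; the identities are only required on a subset \<open>X\<close>
  so that the regular representation of the double, whose elements form a subset of a function
  type, is covered.
\<close>

locale dual_action = fd_hopf A for A :: "('k::field, 'a::ring_1) hopf" +
  fixes s :: "'k \<Rightarrow> 'x::ab_group_add \<Rightarrow> 'x" and X :: "'x set"
    and act :: "'a \<Rightarrow> 'x \<Rightarrow> 'x" and dact :: "('a \<Rightarrow> 'k) \<Rightarrow> 'x \<Rightarrow> 'x"
  assumes vs: "vector_space s"
    and act_X: "x \<in> X \<Longrightarrow> act a x \<in> X" and dact_X: "q \<in> vec DA \<Longrightarrow> x \<in> X \<Longrightarrow> dact q x \<in> X"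
    and klin_act0: "x \<in> X \<Longrightarrow> klin_on (spA A) s (\<lambda>a. act a x)" and act_lin: "lin s s (act a)"
    and klin_dact0: "x \<in> X \<Longrightarrow> klin_on DA s (\<lambda>q. dact q x)" and dact_lin: "q \<in> vec DA \<Longrightarrow> lin s s (dact q)"
begin

lemma klin_act: "x \<in> X \<Longrightarrow> klin_on U (sc A) f \<Longrightarrow> klin_on U s (\<lambda>y. act (f y) x)"
  using klin_comp[OF klin_act0, of x U f] by simp

lemma klin_act_right: "klin_on U s f \<Longrightarrow> klin_on U s (\<lambda>y. act a (f y))"
  by (rule klin_comp_lin[OF act_lin])

lemma klin_dact: "x \<in> X \<Longrightarrow> klin_on U tscale f \<Longrightarrow> (\<And>y. y \<in> vec U \<Longrightarrow> f y \<in> vec DA) \<Longrightarrow> klin_on U s (\<lambda>y. dact (f y) x)"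
  using klin_comp[OF klin_dact0, of x U f] by simp

lemma klin_dact_right: "q \<in> vec DA \<Longrightarrow> klin_on U s f \<Longrightarrow> klin_on U s (\<lambda>y. dact q (f y))"
  by (rule klin_comp_lin[OF dact_lin])

text \<open>The exchange rule of the double as an identity of operators at \<open>x\<close>.\<close>

definition mixD :: "'x \<Rightarrow> bool" where
  "mixD x \<longleftrightarrow> (\<forall>a. \<forall>q\<in>vec DA. act a (dact q x) =
     SW s (\<lambda>a1 r. SW s (\<lambda>a2 a3. dact (tw a1 a3 q) (act a2 x)) r) a)"

text \<open>The Yetter-Drinfel'd condition at \<open>x\<close> with its component in
  \<open>A\<close> contracted by \<open>q\<close>.\<close>

definition mixY :: "'x \<Rightarrow> bool" where
  "mixY x \<longleftrightarrow> (\<forall>a. \<forall>q\<in>vec DA. SW s (\<lambda>a1 a2. dact (\<lambda>z. q (z * a1)) (act a2 x)) a =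
     SW s (\<lambda>a1 a2. act a1 (dact (\<lambda>z. q (a2 * z)) x)) a)"

lemma mult_dual: assumes "q \<in> vec DA"
  shows "(\<lambda>z. q (b * (z * c))) \<in> vec DA" "(\<lambda>z. q (b * z)) \<in> vec DA" "(\<lambda>z. q (z * c)) \<in> vec DA"
  by (rule dualI, intro klin_dual[OF assms] klins)+

text \<open>\<open>mixY\<close> is used for the functional \<open>q (SI a3 * ?)\<close>. This brings
  \<open>SI a3\<close> next to \<open>a2\<close>, where the pair cancels by
  \<open>SW_SI_left\<close>.\<close>

lemma mixY_mixD: assumes x: "x \<in> X" and Y: "mixY x" shows "mixD x"
  unfolding mixD_def
proof (intro allI ballI)
  fix a q assume q: "q \<in> vec DA"
  note k = klin_act_right klin_dact[OF x] klin_fun klin_dual[OF q] klins klin_SI vs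
  have "SW s (\<lambda>a1 r. SW s (\<lambda>a2 a3. dact (tw a1 a3 q) (act a2 x)) r) a =
    SW s (\<lambda>u a3. SW s (\<lambda>a1 a2. dact (tw a1 a3 q) (act a2 x)) u) a"
    by (rule SW_coassoc[OF vs, symmetric])
  also have "\<dots> = SW s (\<lambda>u a3. SW s (\<lambda>a1 a2. act a1 (dact (\<lambda>z. q (SI a3 * (a2 * z))) x)) u) a"
  proof -
    have "SW s (\<lambda>a1 a2. dact (tw a1 a3 q) (act a2 x)) u =
       SW s (\<lambda>a1 a2. act a1 (dact (\<lambda>z. q (SI a3 * (a2 * z))) x)) u" for u a3
      using bspec[OF spec[OF Y[unfolded mixY_def], of u] mult_dual(2)[OF q, of "SI a3"]] by (simp add: tw_def mult.assoc)
    then show ?thesis by simp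
  qed
  also have "\<dots> = SW s (\<lambda>a1 r. SW s (\<lambda>a2 a3. act a1 (dact (\<lambda>z. q (SI a3 * (a2 * z))) x)) r) a"
    by (rule SW_coassoc[OF vs])
  also have "\<dots> = SW s (\<lambda>a1 r. s (\<epsilon> r) (act a1 (dact q x))) a"
  proof -
    have "SW s (\<lambda>a2 a3. act a1 (dact (\<lambda>z. q (SI a3 * (a2 * z))) x)) r = s (\<epsilon> r) (act a1 (dact q x))" for a1 r
    proof -
      have "klin_on (spA A) s (\<lambda>y. act a1 (dact (\<lambda>z. q (y * z)) x))"
        by (intro k mult_dual q)
      from SW_SI_left[OF this vs, of r] show ?thesis by (simp add: mult.assoc)
    qed
    then show ?thesis by simp
  qed
  also have "\<dots> = act a (dact q x)"
    by (rule SW_counit_right[OF vs]) (intro klin_act dact_X x q klins)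
  finally show "act a (dact q x) = SW s (\<lambda>a1 r. SW s (\<lambda>a2 a3. dact (tw a1 a3 q) (act a2 x)) r) a" by simp
qed

text \<open>The reverse computation: the exchange rule for \<open>q (a4 * ?)\<close> produces
  \<open>a4 * SI a3\<close>, which cancels by \<open>SW_SI_right\<close>.\<close>

lemma mixD_mixY: assumes x: "x \<in> X" and D: "mixD x" shows "mixY x"
  unfolding mixY_def
proof (intro allI ballI)
  fix a q assume q: "q \<in> vec DA"
  have m: "act b (dact p x) = SW s (\<lambda>a1 r. SW s (\<lambda>a2 a3. dact (tw a1 a3 p) (act a2 x)) r) b" if "p \<in> vec DA" for b p
    using D that unfolding mixD_def by blast
  have "SW s (\<lambda>u a4. act u (dact (\<lambda>z. q (a4 * z)) x)) a =
    SW s (\<lambda>u a4. SW s (\<lambda>a1 r. SW s (\<lambda>a2 a3. dact (\<lambda>z. q (a4 * (SI a3 * (z * a1)))) (act a2 x)) r) u) a"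
    by (simp add: m[OF mult_dual(2)[OF q]] tw_def mult.assoc)
  also have "\<dots> = SW s (\<lambda>a1 p. SW s (\<lambda>r a4. SW s (\<lambda>a2 a3. dact (\<lambda>z. q (a4 * (SI a3 * (z * a1)))) (act a2 x)) r) p) a"
    by (rule SW_coassoc[OF vs])
  also have "\<dots> = SW s (\<lambda>a1 p. SW s (\<lambda>a2 t. SW s (\<lambda>a3 a4. dact (\<lambda>z. q (a4 * (SI a3 * (z * a1)))) (act a2 x)) t) p) a"
    by (simp only: SW_coassoc[OF vs])
  also have "\<dots> = SW s (\<lambda>a1 p. SW s (\<lambda>a2 t. s (\<epsilon> t) (dact (\<lambda>z. q (z * a1)) (act a2 x))) p) a"
  proof -
    have "SW s (\<lambda>a3 a4. dact (\<lambda>z. q (a4 * (SI a3 * (z * a1)))) (act a2 x)) t = s (\<epsilon> t) (dact (\<lambda>z. q (z * a1)) (act a2 x))" for a1 a2 t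
    proof -
      have "klin_on (spA A) s (\<lambda>y. dact (\<lambda>z. q (y * (z * a1))) (act a2 x))"
        by (intro klin_dact act_X x klin_fun klin_dual[OF q] klins mult_dual q)
      from SW_SI_right[OF this vs, of t] show ?thesis by (simp add: mult.assoc)
    qed
    then show ?thesis by simp
  qed
  also have "\<dots> = SW s (\<lambda>a1 p. dact (\<lambda>z. q (z * a1)) (act p x)) a"
  proof -
    have "SW s (\<lambda>a2 t. s (\<epsilon> t) (dact (\<lambda>z. q (z * a1)) (act a2 x))) p = dact (\<lambda>z. q (z * a1)) (act p x)" for a1 p
      by (rule SW_counit_right[OF vs]) (intro klin_dact_right mult_dual q klin_act x klins)
    then show ?thesis by simp
  qed
  finally show "SW s (\<lambda>a1 a2. dact (\<lambda>z. q (z * a1)) (act a2 x)) a = SW s (\<lambda>a1 a2. act a1 (dact (\<lambda>z. q (a2 * z)) x)) a" by simp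
qed

text \<open>The only candidate for an action of the double, since \<open>q \<otimes> a\<close> is
  the product of \<open>q\<close> and \<open>a\<close> there.\<close>

definition dm :: "('k, 'a \<Rightarrow> 'k, 'a) tensor \<Rightarrow> 'x \<Rightarrow> 'x" where
  "dm d x = tlift2 DA (spA A) s (\<lambda>q a. dact q (act a x)) d"

lemma dm_bil: "x \<in> X \<Longrightarrow> bil DA (spA A) s (\<lambda>q a. dact q (act a x))"
  by (intro bilI klin_dact_right klin_dact klin_act act_X klins klin_idD) auto

lemma dm_TD: "x \<in> X \<Longrightarrow> q \<in> vec DA \<Longrightarrow> dm (TD q a) x = dact q (act a x)"
  unfolding dm_def by (rule tlift2_tens2[OF vs dm_bil]) auto

lemma dm_lin_left: "x \<in> X \<Longrightarrow> lin tscale s (\<lambda>d. dm d x)"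
  unfolding dm_def by (rule tlift2_linear[OF vs dm_bil])

lemma dm_klin_left: "x \<in> X \<Longrightarrow> klin_on (tspace DA (spA A) 1) s (\<lambda>d. dm d x)"
  by (rule lin_klin_on[OF dm_lin_left])

lemma dm_X:
  assumes X: "0 \<in> X" "\<And>x y. x \<in> X \<Longrightarrow> y \<in> X \<Longrightarrow> x + y \<in> X" "\<And>c x. x \<in> X \<Longrightarrow> s c x \<in> X"
    and x: "x \<in> X" and d: "d \<in> DD"
  shows "dm d x \<in> X"
  using tens2_closed[of DA "spA A" "\<lparr>vec = X, scl = s\<rparr>" "\<lambda>d. dm d x" d] assms dm_klin_left[OF x]
  by (simp add: kclosed_def dm_TD act_X dact_X)

text \<open>On pure tensors the exchange rule moves \<open>a\<close> past \<open>q'\<close>, after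
  which the two given actions combine. Closure of \<open>X\<close> allows the extension to all of
  \<open>DD\<close>.\<close>

lemma dm_mult:
  assumes am: "\<And>a b x. x \<in> X \<Longrightarrow> act (a * b) x = act a (act b x)"
    and dmu: "\<And>q q' x. x \<in> X \<Longrightarrow> q \<in> vec DA \<Longrightarrow> q' \<in> vec DA \<Longrightarrow> dact (cnv q q') x = dact q (dact q' x)"
    and mix: "\<And>x. x \<in> X \<Longrightarrow> mixD x"
    and X: "0 \<in> X" "\<And>x y. x \<in> X \<Longrightarrow> y \<in> X \<Longrightarrow> x + y \<in> X" "\<And>c x. x \<in> X \<Longrightarrow> s c x \<in> X"
    and x: "x \<in> X" and d: "d \<in> DD" and d': "d' \<in> DD"
  shows "dm (double_mult A d d') x = dm d (dm d' x)"
proof -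
  have pure: "dm (double_mult A (TD q a) (TD q' a')) x = dact q (act a (dact q' (act a' x)))"
    if q: "q \<in> vec DA" "q' \<in> vec DA" for q a q' a'
  proof -
    have "dm (double_mult A (TD q a) (TD q' a')) x =
       SW s (\<lambda>a1 r. SW s (\<lambda>a2 a3. dact q (dact (tw a1 a3 q') (act a2 (act a' x)))) r) a"
      unfolding dmult_TD_TD[OF q] dpure_def SW_lin[OF dm_lin_left[OF x]]
      by (simp add: dm_TD x dmu am act_X q)
    also have "\<dots> = dact q (act a (dact q' (act a' x)))"
      using mix[OF act_X[OF x, of a']] q unfolding mixD_def by (simp add: SW_lin[OF dact_lin[OF q(1)]])
    finally show ?thesis .
  qed
  have dl: "klin_on (tspace DA (spA A) 1) s (\<lambda>d'. dm (TD q a) (dm d' x))" if q: "q \<in> vec DA" for q a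
  proof -
    have "klin_on (tspace DA (spA A) 1) s (\<lambda>d'. dact q (act a (dm d' x)))"
      by (intro klin_dact_right klin_act_right q dm_klin_left x)
    moreover have "dm (TD q a) (dm d' x) = dact q (act a (dm d' x))" if "d' \<in> DD" for d'
      using dm_X[OF X x that] q by (rule dm_TD)
    ultimately show ?thesis by (simp add: klin_on_def DD_add DD_scale)
  qed
  have comp: "klin_on (tspace DA (spA A) 1) s (\<lambda>d. dm (double_mult A e d) x)" if "e \<in> DD" for e
    by (rule klin_comp[OF dm_klin_left[OF x]]) (auto intro: dmult_klin_right that dmult_DD)
  have comp': "klin_on (tspace DA (spA A) 1) s (\<lambda>d. dm (double_mult A d d') x)"
    by (rule klin_comp[OF dm_klin_left[OF x]]) (auto intro: dmult_klin_left d' dmult_DD)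
  have "dm (double_mult A (TD q a) d') x = dm (TD q a) (dm d' x)" if q: "q \<in> vec DA" for q a
    by (rule tens2_eqI[OF comp[OF TD_DD[OF q]] dl[OF q] _ d'])
      (simp add: pure q dm_TD x act_X dact_X)
  then show ?thesis
    by (intro tens2_eqI[OF comp' dm_klin_left[OF dm_X[OF X x d']] _ d])
qed

end

section \<open>Associativity of the double through its regular representation\<close>

context fd_hopf
begin

text \<open>Since the inverse antipode reverses the comultiplication, the second leg of
  \<open>c\<close> goes to \<open>q\<close> and the first to \<open>p\<close>, while the legs of
  \<open>b\<close> keep their order.\<close>

lemma tw_cnv: assumes q: "q \<in> vec DA" and p: "p \<in> vec DA"
  shows "tw b c (cnv q p) x = SW (*) (\<lambda>s t. SW (*) (\<lambda>b1 b2. cnv (tw b1 t q) (tw b2 s p) x) b) c"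
proof -
  note k = klin_dual[OF q] klin_dual[OF p] klins klin_SI vector_space_times
  have "tw b c (cnv q p) x = SW (*) (\<lambda>u v. q u * p v) (SI c * (x * b))"
    by (simp add: tw_def cnv_def mult.assoc)
  also have "\<dots> = SW (*) (\<lambda>u1 u2. SW (*) (\<lambda>v1 v2. q (u1 * v1) * p (u2 * v2)) (x * b)) (SI c)"
    by (rule SW_mult[OF vector_space_times]) (auto intro!: bilI k)
  also have "\<dots> = SW (*) (\<lambda>s t. SW (*) (\<lambda>v1 v2. q (SI t * v1) * p (SI s * v2)) (x * b)) c"
    by (rule SI_comult[OF vector_space_times]) (auto intro!: bilI k)
  also have "\<dots> = SW (*) (\<lambda>s t. SW (*) (\<lambda>x1 x2. SW (*) (\<lambda>b1 b2. q (SI t * (x1 * b1)) * p (SI s * (x2 * b2))) b) x) c"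
    by (subst SW_mult[OF vector_space_times, of "\<lambda>v1 v2. q (SI _ * v1) * p (SI _ * v2)"]) (auto intro!: bilI k)
  also have "\<dots> = SW (*) (\<lambda>s t. SW (*) (\<lambda>b1 b2. SW (*) (\<lambda>x1 x2. q (SI t * (x1 * b1)) * p (SI s * (x2 * b2))) x) b) c"
    by (subst (2) SW_swap[OF vector_space_times]) (rule refl)
  finally show ?thesis by (simp add: cnv_def tw_def mult.assoc)
qed

lemma tw_cnv_fun: "q \<in> vec DA \<Longrightarrow> p \<in> vec DA \<Longrightarrow>
   tw b c (cnv q p) = SW tscale (\<lambda>s t. SW tscale (\<lambda>b1 b2. cnv (tw b1 t q) (tw b2 s p)) b) c"
  by (rule ext) (simp add: SW_apply tw_cnv)

text \<open>The regular representation restricted to \<open>A\<close> and its dual. With it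
  \<open>dm_mult\<close> becomes associativity, and only triple products whose first two factors
  come from \<open>A\<close> or the dual remain to be checked.\<close>

interpretation reg: dual_action A tscale DD "\<lambda>a. dleft \<epsilon> a" "\<lambda>q. dleft q 1"
proof (intro dual_action.intro dual_action_axioms.intro fd_hopf_axioms vector_space_tscale dleft_lin)
  show "klin_on (spA A) tscale (\<lambda>a. dleft \<epsilon> a x)" if "x \<in> DD" for x
    using bil_right[OF bil_dleft[OF that] eps_dual] .
  show "klin_on DA tscale (\<lambda>q. dleft q 1 x)" if "x \<in> DD" for x
    using bil_left[OF bil_dleft[OF that], of 1] by simp
qed (auto simp: dleft_DD)

lemma dpure_eps: assumes p: "p \<in> vec DA"
  shows "dpure \<epsilon> a p c = SW tscale (\<lambda>a1 r. SW tscale (\<lambda>a2 a3. TD (tw a1 a3 p) (a2 * c)) r) a"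
  unfolding dpure_def by (simp add: cnv_eps p)

lemma dleft_SW: "dleft q a (SW tscale \<phi> b) = SW tscale (\<lambda>x y. dleft q a (\<phi> x y)) b"
  by (rule SW_lin[OF dleft_lin])

lemma dleft_cnv: assumes "t \<in> DD" "q \<in> vec DA" "q' \<in> vec DA"
  shows "dleft (cnv q q') 1 t = dleft q 1 (dleft q' 1 t)"
  by (rule tens2_eqI[OF lin_klin_on[OF dleft_lin] klin_comp_lin[OF dleft_lin lin_klin_on[OF dleft_lin]] _ assms(1)])
    (simp add: dleft_TD dpure_one_left assms cnv_assoc)

text \<open>Twists compose because \<open>SI (a3 * b3) = SI b3 * SI a3\<close>. The rest is
  splitting \<open>a * b\<close> into three legs and exchanging the sums over \<open>a\<close> and
  \<open>b\<close>.\<close>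

lemma dleft_mult: assumes t: "t \<in> DD"
  shows "dleft \<epsilon> (a * b) t = dleft \<epsilon> a (dleft \<epsilon> b t)"
proof (rule tens2_eqI[OF lin_klin_on[OF dleft_lin] klin_comp_lin[OF dleft_lin lin_klin_on[OF dleft_lin]] _ t])
  fix p c assume p: "p \<in> vec DA"
  note s = vector_space_tscale
  let ?F = "\<lambda>x y z. TD (tw x z p) (y * c)"
  have "dpure \<epsilon> (a * b) p c = SW tscale (\<lambda>x r. SW tscale (\<lambda>y z. ?F x y z) r) (a * b)"
    by (rule dpure_eps[OF p])
  also have "\<dots> = SW tscale (\<lambda>a1 ra. SW tscale (\<lambda>b1 rb. SW tscale (\<lambda>y z. ?F (a1 * b1) y z) (ra * rb)) b) a"
    by (rule SW_mult[OF s]) (auto intro!: bilI dklins simp: p)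
  also have "\<dots> = SW tscale (\<lambda>a1 ra. SW tscale (\<lambda>b1 rb. SW tscale (\<lambda>a2 a3. SW tscale (\<lambda>b2 b3. ?F (a1 * b1) (a2 * b2) (a3 * b3)) rb) ra) b) a"
  proof -
    have "SW tscale (\<lambda>y z. ?F x y z) (ra * rb) = SW tscale (\<lambda>a2 a3. SW tscale (\<lambda>b2 b3. ?F x (a2 * b2) (a3 * b3)) rb) ra" for x ra rb
      by (rule SW_mult[OF s]) (auto intro!: bilI dklins simp: p)
    then show ?thesis by simp
  qed
  also have "\<dots> = SW tscale (\<lambda>b1 rb. SW tscale (\<lambda>a1 ra. SW tscale (\<lambda>b2 b3. SW tscale (\<lambda>a2 a3. ?F (a1 * b1) (a2 * b2) (a3 * b3)) ra) rb) a) b"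
    by (subst SW_swap[OF s], subst (3) SW_swap[OF s], rule refl)
  also have "\<dots> = SW tscale (\<lambda>b1 rb. SW tscale (\<lambda>b2 b3. SW tscale (\<lambda>a1 ra. SW tscale (\<lambda>a2 a3. ?F (a1 * b1) (a2 * b2) (a3 * b3)) ra) a) rb) b"
    by (subst (2) SW_swap[OF s], rule refl)
  also have "\<dots> = dleft \<epsilon> a (dpure \<epsilon> b p c)"
  proof -
    have "tw a1 a3 (tw b1 b3 p) = tw (a1 * b1) (a3 * b3) p" for a1 a3 b1 b3
      by (simp add: tw_def SI_mult mult.assoc)
    then show ?thesis
      unfolding dpure_eps[OF p] dleft_SW by (simp add: dleft_TD dpure_eps p mult.assoc)
  qed
  finally show "dleft \<epsilon> (a * b) (TD p c) = dleft \<epsilon> a (dleft \<epsilon> b (TD p c))"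
    by (simp add: dleft_TD p)
qed

text \<open>On the pure tensor of \<open>p\<close> and \<open>c\<close> both sides become one sum
  over five legs of \<open>a\<close>: the outer two twist \<open>q\<close>, the second and fourth
  twist \<open>p\<close>, and the middle one multiplies \<open>c\<close>.\<close>

lemma dleft_mix: assumes t: "t \<in> DD" shows "reg.mixD t"
  unfolding reg.mixD_def
proof (intro allI ballI)
  fix a q assume q: "q \<in> vec DA"
  note s = vector_space_tscale
  show "dleft \<epsilon> a (dleft q 1 t) = SW tscale (\<lambda>a1 r. SW tscale (\<lambda>a2 a3. dleft (tw a1 a3 q) 1 (dleft \<epsilon> a2 t)) r) a"
  proof (rule tens2_eqI[OF klin_comp_lin[OF dleft_lin lin_klin_on[OF dleft_lin]] _ _ t])
    show "klin_on (tspace DA (spA A) 1) tscale (\<lambda>t. SW tscale (\<lambda>a1 r. SW tscale (\<lambda>a2 a3. dleft (tw a1 a3 q) 1 (dleft \<epsilon> a2 t)) r) a)"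
      by (intro klin_SW_body s klin_comp_lin[OF dleft_lin lin_klin_on[OF dleft_lin]])
    fix p c assume p: "p \<in> vec DA"
    let ?G = "\<lambda>a b m s t. TD (cnv (tw a t q) (tw b s p)) (m * c)"
    have TDlin: "klin_on DA tscale (\<lambda>f. TD f m)" for m by (rule klin_tens2)
    have TD_SW: "TD (SW tscale \<phi> x) m = SW tscale (\<lambda>u v. TD (\<phi> u v) m) x" if "\<And>u v. \<phi> u v \<in> vec DA" for \<phi> x m
      using SW_out[OF kclosed_DA TDlin, of \<phi> x m] that by simp
    have SWD: "SW tscale \<phi> x \<in> vec DA" if "\<And>u v. \<phi> u v \<in> vec DA" for \<phi> x
      using SW_closed[OF kclosed_DA, of \<phi> x] that by simp
    have "dleft \<epsilon> a (dleft q 1 (TD p c)) = SW tscale (\<lambda>a1 r. SW tscale (\<lambda>m a3. TD (tw a1 a3 (cnv q p)) (m * c)) r) a"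
      by (simp add: dleft_TD dpure_one_left p q dpure_eps)
    also have "\<dots> = SW tscale (\<lambda>a1 r. SW tscale (\<lambda>m a3. SW tscale (\<lambda>s t. SW tscale (\<lambda>a b. ?G a b m s t) a1) a3) r) a"
      by (simp add: tw_cnv_fun p q TD_SW SWD)
    also have "\<dots> = SW tscale (\<lambda>a1 r. SW tscale (\<lambda>w t. SW tscale (\<lambda>m s. SW tscale (\<lambda>a b. ?G a b m s t) a1) w) r) a"
      by (simp only: SW_coassoc[OF s])
    also have "\<dots> = SW tscale (\<lambda>a1 r. SW tscale (\<lambda>w t. SW tscale (\<lambda>a b. SW tscale (\<lambda>m s. ?G a b m s t) w) a1) r) a"
    proof -
      have "SW tscale (\<lambda>m s. SW tscale (\<lambda>a b. ?G a b m s t) a1) w = SW tscale (\<lambda>a b. SW tscale (\<lambda>m s. ?G a b m s t) w) a1" for a1 w t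
        by (rule SW_swap[OF s])
      then show ?thesis by simp
    qed
    also have "\<dots> = SW tscale (\<lambda>a1 r. SW tscale (\<lambda>a b. SW tscale (\<lambda>w t. SW tscale (\<lambda>m s. ?G a b m s t) w) r) a1) a"
    proof -
      have "SW tscale (\<lambda>w t. SW tscale (\<lambda>a b. SW tscale (\<lambda>m s. ?G a b m s t) w) a1) r = SW tscale (\<lambda>a b. SW tscale (\<lambda>w t. SW tscale (\<lambda>m s. ?G a b m s t) w) r) a1" for a1 r
        by (rule SW_swap[OF s])
      then show ?thesis by simp
    qed
    also have "\<dots> = SW tscale (\<lambda>a q'. SW tscale (\<lambda>b r. SW tscale (\<lambda>w t. SW tscale (\<lambda>m s. ?G a b m s t) w) r) q') a"
      by (rule SW_coassoc[OF s])
    also have "\<dots> = SW tscale (\<lambda>a q'. SW tscale (\<lambda>y t. SW tscale (\<lambda>b w. SW tscale (\<lambda>m s. ?G a b m s t) w) y) q') a"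
      by (simp only: SW_coassoc[OF s, symmetric])
    also have "\<dots> = SW tscale (\<lambda>a1 r. SW tscale (\<lambda>a2 a3. dleft (tw a1 a3 q) 1 (dleft \<epsilon> a2 (TD p c))) r) a"
      by (simp add: dleft_TD p dpure_eps dleft_SW q dpure_one_left)
    finally show "dleft \<epsilon> a (dleft q 1 (TD p c)) = SW tscale (\<lambda>a1 r. SW tscale (\<lambda>a2 a3. dleft (tw a1 a3 q) 1 (dleft \<epsilon> a2 (TD p c))) r) a" .
  qed
qed

text \<open>The factorisation
  \<open>q \<otimes> a = (q \<otimes> 1) (\<epsilon> \<otimes> a)\<close> makes the action assembled
  from the two subalgebras the full left multiplication.\<close>

lemma reg_dm: assumes d: "d \<in> DD" and t: "t \<in> DD" shows "reg.dm d t = double_mult A d t"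
proof (rule tens2_eqI[OF reg.dm_klin_left[OF t] dmult_klin_left[OF t] _ d])
  fix q a assume q: "q \<in> vec DA"
  have "dleft q 1 (dleft \<epsilon> a t) = dleft q a t"
  proof (rule tens2_eqI[OF klin_comp_lin[OF dleft_lin lin_klin_on[OF dleft_lin]] lin_klin_on[OF dleft_lin] _ t])
    fix p c assume p: "p \<in> vec DA"
    have "dleft q 1 (dleft \<epsilon> a (TD p c)) = SW tscale (\<lambda>a1 r. SW tscale (\<lambda>a2 a3. TD (cnv q (tw a1 a3 p)) (a2 * c)) r) a"
      by (simp add: dleft_TD p dpure_eps dleft_SW dpure_one_left q)
    then show "dleft q 1 (dleft \<epsilon> a (TD p c)) = dleft q a (TD p c)"
      by (simp add: dleft_TD p dpure_def)
  qed
  then show "reg.dm (TD q a) t = double_mult A (TD q a) t"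
    using q t by (simp add: reg.dm_TD dmult_TD)
qed

lemma dmult_assoc: assumes "d \<in> DD" "d' \<in> DD" "t \<in> DD"
  shows "double_mult A (double_mult A d d') t = double_mult A d (double_mult A d' t)"
  using reg.dm_mult[OF dleft_mult dleft_cnv dleft_mix tens_zero tens_add tens_scale, of t d d'] assms
  by (simp add: reg_dm dmult_DD)

end

section \<open>Yetter-Drinfel'd modules as modules over the double\<close>

locale yd_hopf = fd_hopf A + yetter_drinfeld A M
  for A :: "('k::field, 'a::ring_1) hopf" and M :: "('k, 'a, 'm::ab_group_add) yd"
begin

lemma spM_whole: "spM M = whole (msc M)" by (simp add: spM_def)

text \<open>The usual action of the dual on a right comodule, with \<open>q m\<close> the sum of
  \<open>q(m_1) m_0\<close>.\<close>

definition dM :: "('a \<Rightarrow> 'k) \<Rightarrow> 'm \<Rightarrow> 'm" where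
  "dM q m = contr (msc M) q (coact M m)"

lemma klin_contr: assumes t: "t \<in> tens (whole s) (spA A) 1" and s: "vector_space s"
  shows "klin_on DA s (\<lambda>q. contr s q t)"
  unfolding contr_def
  by (rule klin_tlift2_param[OF s kclosed_DA bil_contr[OF s] _ t])
    (auto intro!: klin_scl_left s klin_eval)

lemma dM_lin: "q \<in> vec DA \<Longrightarrow> lin (msc M) (msc M) (dM q)"
  unfolding dM_def[abs_def]
  using klin_comp_lin[OF contr_lin[OF vector_space_M] lin_klin[OF coact_linear]] klin_lin[OF vector_space_M vector_space_M]
  by blast

sublocale da: dual_action A "msc M" UNIV "act M" dM
proof (intro dual_action.intro dual_action_axioms.intro fd_hopf_axioms vector_space_M)
  show "klin_on (spA A) (msc M) (\<lambda>a. act M a x)" for x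
    by (rule spA_lin[OF act_linear_left])
  show "klin_on DA (msc M) (\<lambda>q. dM q x)" for x
    unfolding dM_def using klin_contr[OF _ vector_space_M] coact_closed by (simp add: spM_whole)
qed (auto intro: act_linear_right dM_lin)

lemma klin_actM: "klin_on U (sc A) f \<Longrightarrow> klin_on U (msc M) (\<lambda>y. act M (f y) x)"
  "klin_on U (msc M) g \<Longrightarrow> klin_on U (msc M) (\<lambda>y. act M a (g y))"
  by (rule da.klin_act da.klin_act_right, auto)+

lemma klin_dMl: "klin_on U tscale f \<Longrightarrow> (\<And>y. y \<in> vec U \<Longrightarrow> f y \<in> vec DA) \<Longrightarrow> klin_on U (msc M) (\<lambda>y. dM (f y) x)"
  by (rule da.klin_dact) auto

lemma klin_dMr: "q \<in> vec DA \<Longrightarrow> klin_on U (msc M) g \<Longrightarrow> klin_on U (msc M) (\<lambda>y. dM q (g y))"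
  by (rule da.klin_dact_right) auto

lemma klin_idM: "klin_on (spM M) (msc M) (\<lambda>x. x)"
  using klin_id[of "spM M"] by simp

lemmas mklins = klin_actM klin_dMl klin_dMr klin_idM co_dual klins vector_space_M

text \<open>The coaction of \<open>m\<close> is the sum of \<open>dM (co b) m\<close> tensor
  \<open>b\<close>: this is how it is recovered from the action of the dual.\<close>

lemma swm_sum: assumes u: "vector_space u" and phi: "bil (spM M) (spA A) u \<phi>"
  shows "swm A M u \<phi> m = (\<Sum>b\<in>basis. \<phi> (dM (co b) m) b)"
  unfolding swm_def dM_def
  using tlift2_expand[OF vector_space_M _ u, folded spM_whole, OF coact_closed phi] .

lemma dM_sum: "q \<in> vec DA \<Longrightarrow> dM q m = (\<Sum>b\<in>basis. msc M (q b) (dM (co b) m))"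
  using dual_expand[OF da.klin_dact0, of m q] by simp

lemma klin_tens2M:
  "klin_on U (msc M) f \<Longrightarrow> klin_on U tscale (\<lambda>x. tens2 (spM M) (spA A) (f x) a)"
  "klin_on U (sc A) g \<Longrightarrow> klin_on U tscale (\<lambda>x. tens2 (spM M) (spA A) v (g x))"
  by (rule klin_comp[OF klin_tens2(2)] klin_comp[OF klin_tens2(1)], auto)+

lemma contrM: "q \<in> vec DA \<Longrightarrow> contr (msc M) q (tens2 (spM M) (spA A) v a) = msc M (q a) v"
  using contr_tens2[OF vector_space_M] by (simp add: spM_whole)

lemma contr_linM: "q \<in> vec DA \<Longrightarrow> lin tscale (msc M) (contr (msc M) q)"
  by (rule contr_lin[OF vector_space_M])

lemma dM_eps: "dM \<epsilon> m = m"
proof -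
  have "m = swm A M (msc M) (\<lambda>x a. msc M (\<epsilon> a) x) m" by (simp add: coact_counit)
  also have "\<dots> = dM \<epsilon> m"
    unfolding dM_sum[OF eps_dual] by (rule swm_sum[OF vector_space_M]) (auto intro!: bilI mklins)
  finally show ?thesis by simp
qed

text \<open>Coassociativity of the coaction, contracted with \<open>q\<close> and \<open>q'\<close>
  on the two copies of \<open>A\<close>. The second application of the coaction yields the first
  copy, so the order of the convolution is preserved.\<close>

lemma dM_mult: assumes q: "q \<in> vec DA" and q': "q' \<in> vec DA"
  shows "dM (cnv q q') m = dM q (dM q' m)"
proof -
  interpret VM: vector_space "msc M" by (rule vector_space_M)
  let ?b = "\<lambda>(v, ws). msc M (q (ws ! 0) * q' (ws ! 1)) v"
  have ml: "multilinear (spM M) (spA A) 2 (msc M) ?b"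
    unfolding multilinear2 by (auto intro!: mklins klin_dual q q' simp: One_nat_def)
  let ?L = "tlift (spM M) (spA A) 2 (msc M) ?b"
  have L: "lin tscale (msc M) ?L" by (rule tlift_linear[OF vector_space_M ml])
  have Lp: "?L (tpure (spM M) (spA A) 2 (v, [a, b])) = msc M (q a * q' b) v" for v a b
    by (subst tlift_tpure[OF vector_space_M ml]) (auto simp: tuples2 One_nat_def)
  note s = vector_space_tscale
  have kt: "klin_on U tscale (\<lambda>y. tpure (spM M) (spA A) 2 (f y, [a, b]))" if "klin_on U (msc M) f" for U :: "('k, 'z::ab_group_add) kspace" and f a b
    by (rule klin_comp[OF klin_tpure(3)]) (use that in auto)
  have e1: "swm A M tscale (\<lambda>y b. tpure (spM M) (spA A) 2 (y, [b, a])) x =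
     (\<Sum>b\<in>basis. tpure (spM M) (spA A) 2 (dM (co b) x, [b, a]))" for x a
    by (rule swm_sum[OF s]) (auto intro!: bilI klin_tpure)
  have e2: "sw A tscale (\<lambda>a1 a2. tpure (spM M) (spA A) 2 (x, [a1, a2])) a =
     SW tscale (\<lambda>a1 a2. tpure (spM M) (spA A) 2 (x, [a1, a2])) a" for x a
    by (rule sw_SW[OF s]) (auto intro!: bilI klin_tpure)
  have "?L (swm A M tscale (\<lambda>x a. swm A M tscale (\<lambda>y b. tpure (spM M) (spA A) 2 (y, [b, a])) x) m)
     = (\<Sum>c\<in>basis. \<Sum>b\<in>basis. msc M (q b * q' c) (dM (co b) (dM (co c) m)))"
    unfolding e1
    by (subst swm_sum[OF s]) (auto intro!: bilI klin_sum_fun kt klin_tpure mklins simp: lin_sum[OF L] Lp)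
  also have "\<dots> = (\<Sum>c\<in>basis. msc M (q' c) (dM q (dM (co c) m)))"
    unfolding dM_sum[OF q] by (simp add: VM.scale_sum_right mult.commute)
  also have "\<dots> = dM q (dM q' m)"
  proof -
    have "dM q (msc M c x) = msc M c (dM q x)" for c x using dM_lin[OF q] unfolding lin_iff by blast
    then show ?thesis unfolding dM_sum[OF q', of m] lin_sum[OF dM_lin[OF q]] by simp
  qed
  finally have 1: "?L (swm A M tscale (\<lambda>x a. swm A M tscale (\<lambda>y b. tpure (spM M) (spA A) 2 (y, [b, a])) x) m) = dM q (dM q' m)" .
  have "?L (swm A M tscale (\<lambda>x a. sw A tscale (\<lambda>a1 a2. tpure (spM M) (spA A) 2 (x, [a1, a2])) a) m)
     = (\<Sum>b\<in>basis. SW (msc M) (\<lambda>a1 a2. msc M (q a1 * q' a2) (dM (co b) m)) b)"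
    unfolding e2
    by (subst swm_sum[OF s]) (auto intro!: bilI mklins kt simp: lin_sum[OF L] SW_lin[OF L] Lp)
  also have "\<dots> = dM (cnv q q') m"
    unfolding dM_sum[OF cnv_dual]
  proof (rule sum.cong[OF refl])
    fix b
    have "lin (*) (msc M) (\<lambda>c. msc M c (dM (co b) m))"
      by (simp add: lin_iff vector_space_times vector_space_M VM.scale_left_distrib)
    from SW_lin[OF this, of "\<lambda>u v. q u * q' v" b]
    show "SW (msc M) (\<lambda>a1 a2. msc M (q a1 * q' a2) (dM (co b) m)) b = msc M (cnv q q' b) (dM (co b) m)"
      by (simp add: cnv_def)
  qed
  finally show ?thesis using 1 coact_coassoc[of m] by simp
qed

text \<open>\<open>yd_compat\<close> contracted with \<open>q\<close>: the components
  \<open>b * a1\<close> and \<open>a2 * b\<close> turn into the shifted functionals.\<close>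

lemma mixY: "da.mixY m"
  unfolding da.mixY_def
proof (intro allI ballI)
  fix a q assume q: "q \<in> vec DA"
  note s = vector_space_tscale
  note Q = contr_linM[OF q]
  have e1: "swm A M tscale (\<lambda>x b. tens2 (spM M) (spA A) x (b * a1)) x =
      (\<Sum>b\<in>basis. tens2 (spM M) (spA A) (dM (co b) x) (b * a1))" for a1 x
    by (rule swm_sum[OF s]) (auto intro!: bilI klin_tens2M mklins)
  have e2: "swm A M tscale (\<lambda>x b. tens2 (spM M) (spA A) (act M a1 x) (a2 * b)) m =
      (\<Sum>b\<in>basis. tens2 (spM M) (spA A) (act M a1 (dM (co b) m)) (a2 * b))" for a1 a2
    by (rule swm_sum[OF s]) (auto intro!: bilI klin_tens2M mklins)
  have "contr (msc M) q (sw A tscale (\<lambda>a1 a2. swm A M tscale (\<lambda>x b. tens2 (spM M) (spA A) x (b * a1)) (act M a2 m)) a) =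
      SW (msc M) (\<lambda>a1 a2. \<Sum>b\<in>basis. msc M (q (b * a1)) (dM (co b) (act M a2 m))) a"
    unfolding e1 by (subst sw_SW[OF s]) (auto intro!: bilI klin_tens2M mklins simp: SW_lin[OF Q] lin_sum[OF Q] contrM q)
  also have "\<dots> = SW (msc M) (\<lambda>a1 a2. dM (\<lambda>z. q (z * a1)) (act M a2 m)) a"
    by (simp only: dM_sum[OF da.mult_dual(3)[OF q]])
  finally have 1: "contr (msc M) q (sw A tscale (\<lambda>a1 a2. swm A M tscale (\<lambda>x b. tens2 (spM M) (spA A) x (b * a1)) (act M a2 m)) a) =
     SW (msc M) (\<lambda>a1 a2. dM (\<lambda>z. q (z * a1)) (act M a2 m)) a" .
  have "contr (msc M) q (sw A tscale (\<lambda>a1 a2. swm A M tscale (\<lambda>x b. tens2 (spM M) (spA A) (act M a1 x) (a2 * b)) m) a) =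
      SW (msc M) (\<lambda>a1 a2. \<Sum>b\<in>basis. msc M (q (a2 * b)) (act M a1 (dM (co b) m))) a"
    unfolding e2 by (subst sw_SW[OF s]) (auto intro!: bilI klin_tens2M mklins simp: SW_lin[OF Q] lin_sum[OF Q] contrM q)
  also have "\<dots> = SW (msc M) (\<lambda>a1 a2. act M a1 (dM (\<lambda>z. q (a2 * z)) m)) a"
  proof -
    have "act M a1 (msc M c x) = msc M c (act M a1 x)" for a1 c x
      using act_linear_right[of a1] unfolding lin_iff by blast
    then show ?thesis
      by (simp only: dM_sum[OF da.mult_dual(2)[OF q]] lin_sum[OF act_linear_right])
  qed
  finally show "SW (msc M) (\<lambda>a1 a2. dM (\<lambda>z. q (z * a1)) (act M a2 m)) a = SW (msc M) (\<lambda>a1 a2. act M a1 (dM (\<lambda>z. q (a2 * z)) m)) a"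
    using 1 yd_compat[of m a] by simp
qed

lemma dm_mult: "d \<in> DD \<Longrightarrow> d' \<in> DD \<Longrightarrow> da.dm (double_mult A d d') m = da.dm d (da.dm d' m)"
  by (rule da.dm_mult) (auto simp: act_mult dM_mult intro: da.mixY_mixD mixY)

lemma dm_one: "da.dm (TD \<epsilon> 1) m = m"
  by (simp add: da.dm_TD dM_eps act_one)

lemma dm_lin_right: assumes d: "d \<in> DD" shows "lin (msc M) (msc M) (da.dm d)"
proof -
  have b: "bil DA (spA A) (msc M) (\<lambda>q a. dM q (act M a x))" for x
    by (rule da.dm_bil) simp
  have "klin_on (spM M) (msc M) (da.dm d)"
    unfolding da.dm_def[abs_def]
    by (rule klin_tlift2_param[OF vector_space_M kclosed_spM b _ d]) (intro mklins)
  then show ?thesis unfolding spM_whole by (rule klin_lin[OF vector_space_M vector_space_M])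
qed

lemma smult_double_module: "smult (double_module A M) = da.dm"
  unfolding double_module_def da.dm_def[abs_def] unfolding dM_def contr_def swm_def spM_whole by simp

end

section \<open>Extensions of Yetter-Drinfel'd modules\<close>

locale yd_two = fd_hopf A + M: yd_hopf A M + N: yd_hopf A N
  for A :: "('k::field, 'a::ring_1) hopf" and M :: "('k, 'a, 'm::ab_group_add) yd"
    and N :: "('k, 'a, 'n::ab_group_add) yd"
begin

text \<open>Hochschild 1-cocycles, that is derivations, of the double with values in the bimodule of
  \<open>k\<close>-linear maps from \<open>M\<close> to \<open>N\<close>.\<close>

definition dcocycle :: "(('k, 'a \<Rightarrow> 'k, 'a) tensor \<Rightarrow> 'm \<Rightarrow> 'n) \<Rightarrow> bool" where
  "dcocycle \<phi> \<longleftrightarrow> (\<forall>m. klin_on (tspace DA (spA A) 1) (msc N) (\<lambda>d. \<phi> d m)) \<and>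
     (\<forall>d\<in>DD. lin (msc M) (msc N) (\<phi> d)) \<and>
     (\<forall>d\<in>DD. \<forall>d'\<in>DD. \<forall>m. \<phi> (double_mult A d d') m = N.da.dm d (\<phi> d' m) + \<phi> d (M.da.dm d' m))"

end

text \<open>
  \<open>om\<close> and \<open>la\<close> are the data of an extension of \<open>M\<close> by \<open>N\<close>: on the sum of \<open>N\<close> and \<open>M\<close> the
  algebra \<open>A\<close> and its dual act by triangular matrices with off-diagonal entries \<open>om\<close>
  and \<open>la\<close>.
\<close>

locale ext_data = yd_two A M N
  for A :: "('k::field, 'a::ring_1) hopf" and M :: "('k, 'a, 'm::ab_group_add) yd"
    and N :: "('k, 'a, 'n::ab_group_add) yd" +
  fixes om :: "'a \<Rightarrow> 'm \<Rightarrow> 'n" and la :: "('a \<Rightarrow> 'k) \<Rightarrow> 'm \<Rightarrow> 'n"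
  assumes om_left: "klin_on (spA A) (msc N) (\<lambda>a. om a m)" and om_right: "lin (msc M) (msc N) (om a)"
    and la_left: "klin_on DA (msc N) (\<lambda>q. la q m)" and la_right: "q \<in> vec DA \<Longrightarrow> lin (msc M) (msc N) (la q)"
begin

definition sE :: "'k \<Rightarrow> 'n \<times> 'm \<Rightarrow> 'n \<times> 'm" where "sE c x = (msc N c (fst x), msc M c (snd x))"
definition actE :: "'a \<Rightarrow> 'n \<times> 'm \<Rightarrow> 'n \<times> 'm" where "actE a x = (act N a (fst x) + om a (snd x), act M a (snd x))"
definition dE :: "('a \<Rightarrow> 'k) \<Rightarrow> 'n \<times> 'm \<Rightarrow> 'n \<times> 'm" where "dE q x = (N.dM q (fst x) + la q (snd x), M.dM q (snd x))"

lemma vector_space_sE: "vector_space sE"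
proof -
  interpret VM: vector_space "msc M" by (rule M.vector_space_M)
  interpret VN: vector_space "msc N" by (rule N.vector_space_M)
  show ?thesis
    by unfold_locales (auto simp: sE_def VM.scale_left_distrib VN.scale_left_distrib VM.scale_right_distrib VN.scale_right_distrib)
qed

lemma fst_lin: "lin sE (msc N) fst" and snd_lin: "lin sE (msc M) snd"
  by (simp_all add: lin_iff vector_space_sE M.vector_space_M N.vector_space_M sE_def)

lemma klin_pair: "klin_on U (msc N) f \<Longrightarrow> klin_on U (msc M) g \<Longrightarrow> klin_on U sE (\<lambda>x. (f x, g x))"
  by (simp add: klin_on_def sE_def)

lemma klin_om: "klin_on U (sc A) f \<Longrightarrow> klin_on U (msc N) (\<lambda>y. om (f y) m)"
  "klin_on U (msc M) g \<Longrightarrow> klin_on U (msc N) (\<lambda>y. om a (g y))"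
  by (rule klin_comp[OF om_left] klin_comp_lin[OF om_right], simp_all)+

lemma klin_la: "klin_on U tscale f \<Longrightarrow> (\<And>y. y \<in> vec U \<Longrightarrow> f y \<in> vec DA) \<Longrightarrow> klin_on U (msc N) (\<lambda>y. la (f y) m)"
  "q \<in> vec DA \<Longrightarrow> klin_on U (msc M) g \<Longrightarrow> klin_on U (msc N) (\<lambda>y. la q (g y))"
  by (rule klin_comp[OF la_left] klin_comp_lin[OF la_right], simp_all)+

lemma klin_fst: "klin_on (whole sE) (msc N) fst" and klin_snd: "klin_on (whole sE) (msc M) snd"
  by (rule lin_klin fst_lin snd_lin)+

sublocale E: dual_action A sE UNIV actE dE
proof (intro dual_action.intro dual_action_axioms.intro fd_hopf_axioms vector_space_sE)
  show "klin_on (spA A) sE (\<lambda>a. actE a x)" for x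
    unfolding actE_def by (intro klin_pair klin_om N.mklins M.mklins)
  show "lin sE sE (actE a)" for a
    by (rule klin_lin[OF vector_space_sE vector_space_sE])
      (unfold actE_def, intro klin_pair klin_om N.mklins M.mklins klin_fst klin_snd)
  show "klin_on DA sE (\<lambda>q. dE q x)" for x
    unfolding dE_def by (intro klin_pair klin_la N.mklins M.mklins klin_idD)
  show "lin sE sE (dE q)" if "q \<in> vec DA" for q
    by (rule klin_lin[OF vector_space_sE vector_space_sE])
      (unfold dE_def, intro klin_pair klin_la N.mklins M.mklins klin_fst klin_snd that)
qed auto

definition phi :: "('k, 'a \<Rightarrow> 'k, 'a) tensor \<Rightarrow> 'm \<Rightarrow> 'n" where
  "phi d m = tlift2 DA (spA A) (msc N) (\<lambda>q a. N.dM q (om a m) + la q (act M a m)) d"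

lemma phi_bil: "bil DA (spA A) (msc N) (\<lambda>q a. N.dM q (om a m) + la q (act M a m))"
  by (auto intro!: bilI klin_la klin_om M.mklins N.mklins klin_idD)

lemma phi_TD: "q \<in> vec DA \<Longrightarrow> phi (TD q a) m = N.dM q (om a m) + la q (act M a m)"
  unfolding phi_def by (rule tlift2_tens2[OF N.vector_space_M phi_bil]) auto

lemma phi_klin_left: "klin_on (tspace DA (spA A) 1) (msc N) (\<lambda>d. phi d m)"
  unfolding phi_def by (rule lin_klin_on[OF tlift2_linear[OF N.vector_space_M phi_bil]])

lemma phi_lin_right: assumes d: "d \<in> DD" shows "lin (msc M) (msc N) (phi d)"
proof -
  have "klin_on (spM M) (msc N) (phi d)"
    unfolding phi_def[abs_def]
    by (rule klin_tlift2_param[OF N.vector_space_M kclosed_spM phi_bil _ d])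
      (intro klin_la klin_om M.mklins N.mklins)
  then show ?thesis unfolding M.spM_whole by (rule klin_lin[OF M.vector_space_M N.vector_space_M])
qed

text \<open>On pure tensors \<open>phi\<close> is the off-diagonal entry of the product of the
  triangular matrices of \<open>q\<close> and \<open>a\<close>.\<close>

lemma dmE: assumes d: "d \<in> DD" shows "E.dm d x = (N.da.dm d (fst x) + phi d (snd x), M.da.dm d (snd x))"
  by (rule tens2_eqI[OF E.dm_klin_left _ _ d])
    (auto intro!: klin_pair klin_plus N.vector_space_M N.da.dm_klin_left M.da.dm_klin_left phi_klin_left
      simp: E.dm_TD phi_TD N.da.dm_TD M.da.dm_TD dE_def actE_def add.assoc
        N.dM_lin[unfolded lin_iff])

text \<open>This condition and the next two are the off-diagonal parts of the axioms for the
  triangular action: module over \<open>A\<close>, module over the dual, Yetter-Drinfel'd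
  condition.\<close>

definition act_coc :: bool where "act_coc \<longleftrightarrow> (\<forall>a b m. om (a * b) m = act N a (om b m) + om a (act M b m))"

definition dual_coc :: bool where "dual_coc \<longleftrightarrow>
  (\<forall>q\<in>vec DA. \<forall>q'\<in>vec DA. \<forall>m. la (cnv q q') m = N.dM q (la q' m) + la q (M.dM q' m))"

definition mix_coc :: bool where "mix_coc \<longleftrightarrow> (\<forall>a m. \<forall>q\<in>vec DA.
   SW (msc N) (\<lambda>a1 a2. N.dM (\<lambda>z. q (z * a1)) (om a2 m) + la (\<lambda>z. q (z * a1)) (act M a2 m)) a =
   SW (msc N) (\<lambda>a1 a2. act N a1 (la (\<lambda>z. q (a2 * z)) m) + om a1 (M.dM (\<lambda>z. q (a2 * z)) m)) a)"

lemma N_add: "act N a (x + y) = act N a x + act N a y" "q \<in> vec DA \<Longrightarrow> N.dM q (x + y) = N.dM q x + N.dM q y"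
  "act N a 0 = 0" "q \<in> vec DA \<Longrightarrow> N.dM q 0 = 0"
proof -
  show "act N a (x + y) = act N a x + act N a y" using N.act_linear_right[of a] unfolding lin_iff by blast
  show "act N a 0 = 0" by (rule module_hom.zero[OF Vector_Spaces.linear.axioms(3)[OF N.act_linear_right]])
  assume "q \<in> vec DA"
  note l = N.dM_lin[OF this]
  show "N.dM q (x + y) = N.dM q x + N.dM q y" using l unfolding lin_iff by blast
  show "N.dM q 0 = 0" by (rule module_hom.zero[OF Vector_Spaces.linear.axioms(3)[OF l]])
qed

text \<open>The parts that involve only \<open>N\<close> or only \<open>M\<close> hold by
  \<open>mixY\<close> of these modules and cancel, so \<open>n\<close> disappears.\<close>

lemma mixE_iff: "E.mixY (n, m) \<longleftrightarrow> (\<forall>a. \<forall>q\<in>vec DA.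
   SW (msc N) (\<lambda>a1 a2. N.dM (\<lambda>z. q (z * a1)) (om a2 m) + la (\<lambda>z. q (z * a1)) (act M a2 m)) a =
   SW (msc N) (\<lambda>a1 a2. act N a1 (la (\<lambda>z. q (a2 * z)) m) + om a1 (M.dM (\<lambda>z. q (a2 * z)) m)) a)"
proof -
  have f: "fst (SW sE \<phi> a) = SW (msc N) (\<lambda>x y. fst (\<phi> x y)) a" "snd (SW sE \<phi> a) = SW (msc M) (\<lambda>x y. snd (\<phi> x y)) a" for \<phi> a
    by (rule SW_lin[OF fst_lin] SW_lin[OF snd_lin])+
  have 1: "SW (msc M) (\<lambda>a1 a2. M.dM (\<lambda>z. q (z * a1)) (act M a2 m)) a = SW (msc M) (\<lambda>a1 a2. act M a1 (M.dM (\<lambda>z. q (a2 * z)) m)) a"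
    and 2: "SW (msc N) (\<lambda>a1 a2. N.dM (\<lambda>z. q (z * a1)) (act N a2 n)) a = SW (msc N) (\<lambda>a1 a2. act N a1 (N.dM (\<lambda>z. q (a2 * z)) n)) a"
    if "q \<in> vec DA" for q a
    using M.mixY[of m] N.mixY[of n] that unfolding M.da.mixY_def N.da.mixY_def by blast+
  show ?thesis
    unfolding E.mixY_def prod_eq_iff f dE_def actE_def fst_conv snd_conv
    by (intro iff_allI ball_cong refl)
      (simp add: 1 2 N_add E.mult_dual SW_add[OF N.vector_space_M] add.assoc)
qed

text \<open>The triangular action satisfies the hypotheses of \<open>dm_mult\<close>. The cocycle
  identity is the off-diagonal entry of the result, read off at \<open>(0, m)\<close>.\<close>

lemma coc_dcocycle:
  assumes "act_coc" "dual_coc" "mix_coc"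
  shows "dcocycle phi"
proof -
  have am: "actE (a * b) x = actE a (actE b x)" for a b x
    using assms(1) by (simp add: actE_def act_coc_def M.act_mult N.act_mult N_add add.assoc)
  have dmu: "dE (cnv q q') x = dE q (dE q' x)" if "q \<in> vec DA" "q' \<in> vec DA" for q q' x
    using assms(2) that by (simp add: dE_def dual_coc_def M.dM_mult N.dM_mult N_add add.assoc)
  have mix: "E.mixD x" for x
    using assms(3) by (cases x) (auto intro!: E.mixY_mixD simp: mixE_iff mix_coc_def)
  have "phi (double_mult A d d') m = N.da.dm d (phi d' m) + phi d (M.da.dm d' m)" if d: "d \<in> DD" "d' \<in> DD" for d d' m
  proof -
    have z: "N.da.dm d 0 = 0" if "d \<in> DD" for d
      using Vector_Spaces.linear.axioms(3)[OF N.dm_lin_right[OF that]] by (rule module_hom.zero)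
    have "E.dm (double_mult A d d') (0, m) = E.dm d (E.dm d' (0, m))"
      by (rule E.dm_mult) (auto simp: am dmu mix d)
    then show ?thesis by (simp add: dmE d dmult_DD z)
  qed
  then show ?thesis
    unfolding dcocycle_def using phi_klin_left phi_lin_right by blast
qed

text \<open>Putting both factors equal to the unit gives \<open>x = x + x\<close>. The vanishing is
  what lets \<open>om\<close> and \<open>la\<close> be read off from \<open>phi\<close>.\<close>

lemma coc_unit:
  assumes "act_coc" "dual_coc"
  shows "om 1 m = 0" "la \<epsilon> m = 0" "phi (TD \<epsilon> a) m = om a m" "q \<in> vec DA \<Longrightarrow> phi (TD q 1) m = la q m"
proof -
  have 1: "om 1 m = 0" for m
    using assms(1)[unfolded act_coc_def, rule_format, of 1 1 m] by (simp add: M.act_one N.act_one)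
  have 2: "la \<epsilon> m = 0" for m
    using assms(2)[unfolded dual_coc_def, rule_format, of \<epsilon> \<epsilon> m] by (simp add: M.dM_eps N.dM_eps cnv_eps)
  show "om 1 m = 0" "la \<epsilon> m = 0" by (rule 1 2)+
  show "phi (TD \<epsilon> a) m = om a m" by (simp add: phi_TD 2 N.dM_eps)
  show "phi (TD q 1) m = la q m" if "q \<in> vec DA" using that by (simp add: phi_TD 1 M.act_one N_add)
qed

end

section \<open>Coboundaries, and extension data recovered from a cocycle of the double\<close>

context yd_two
begin

text \<open>Conceptually this is the direct sum of \<open>N\<close> and \<open>M\<close> with its
  splitting changed by \<open>f\<close>.\<close>

lemma coboundary_coc:
  assumes f: "lin (msc M) (msc N) f"
  defines "om \<equiv> \<lambda>a m. act N a (f m) - f (act M a m)" and "la \<equiv> \<lambda>q m. N.dM q (f m) - f (M.dM q m)"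
  shows "ext_data A M N om la" "ext_data.act_coc M N om" "ext_data.dual_coc A M N la" "ext_data.mix_coc A M N om la"
    "d \<in> DD \<Longrightarrow> ext_data.phi A M N om la d m = N.da.dm d (f m) - f (M.da.dm d m)"
proof -
  have fk: "klin_on U (msc M) g \<Longrightarrow> klin_on U (msc N) (\<lambda>x. f (g x))" for U :: "('k, 'z::ab_group_add) kspace" and g
    by (rule klin_comp_lin[OF f])
  have wN: "lin (msc M) (msc N) g" if "klin_on (spM M) (msc N) g" for g
    using that unfolding M.spM_whole by (rule klin_lin[OF M.vector_space_M N.vector_space_M])
  have ol: "om a m = act N a (f m) - f (act M a m)" "la q m = N.dM q (f m) - f (M.dM q m)" for a q m
    by (simp_all add: om_def la_def)
  show E: "ext_data A M N om la"
    unfolding om_def la_def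
    by (intro ext_data.intro yd_two_axioms ext_data_axioms.intro wN)
      (intro N.mklins M.mklins fk klin_idD; assumption)+
  interpret E: ext_data A M N om la by (rule E)
  have fd: "f (x - y) = f x - f y" "f (x + y) = f x + f y" for x y
    using f Vector_Spaces.linear.axioms(3)[OF f, THEN module_hom.diff] by (auto simp: lin_iff)
  have Nd: "act N a (x - y) = act N a x - act N a y" "q \<in> vec DA \<Longrightarrow> N.dM q (x - y) = N.dM q x - N.dM q y" for a q x y
    using N.act_linear_right[of a] N.dM_lin[of q] Vector_Spaces.linear.axioms(3)[THEN module_hom.diff] by blast+
  show "E.act_coc" unfolding E.act_coc_def by (simp add: om_def Nd M.act_mult N.act_mult)
  show "E.dual_coc" unfolding E.dual_coc_def by (simp add: la_def Nd M.dM_mult N.dM_mult)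
  show "E.mix_coc"
    unfolding E.mix_coc_def
  proof (intro allI ballI)
    fix a m q assume q: "q \<in> vec DA"
    have 1: "SW (msc M) (\<lambda>a1 a2. M.dM (\<lambda>z. q (z * a1)) (act M a2 m)) a = SW (msc M) (\<lambda>a1 a2. act M a1 (M.dM (\<lambda>z. q (a2 * z)) m)) a"
      and 2: "SW (msc N) (\<lambda>a1 a2. N.dM (\<lambda>z. q (z * a1)) (act N a2 (f m))) a = SW (msc N) (\<lambda>a1 a2. act N a1 (N.dM (\<lambda>z. q (a2 * z)) (f m))) a"
      using M.mixY[of m] N.mixY[of "f m"] q unfolding M.da.mixY_def N.da.mixY_def by blast+
    have df: "SW (msc N) (\<lambda>x y. \<phi> x y - \<psi> x y) a = SW (msc N) \<phi> a - SW (msc N) \<psi> a" for \<phi> \<psi>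
      using SW_add[OF N.vector_space_M, of "\<lambda>x y. \<phi> x y - \<psi> x y" \<psi> a] by (simp add: algebra_simps)
    show "SW (msc N) (\<lambda>a1 a2. N.dM (\<lambda>z. q (z * a1)) (om a2 m) + la (\<lambda>z. q (z * a1)) (act M a2 m)) a =
       SW (msc N) (\<lambda>a1 a2. act N a1 (la (\<lambda>z. q (a2 * z)) m) + om a1 (M.dM (\<lambda>z. q (a2 * z)) m)) a"
      using 2 arg_cong[OF 1, of f] by (simp add: om_def la_def Nd E.E.mult_dual q df SW_lin[OF f])
  qed
  show "E.phi d m = N.da.dm d (f m) - f (M.da.dm d m)" if "d \<in> DD"
    by (rule tens2_eqI[OF E.phi_klin_left klin_diff[OF N.vector_space_M N.da.dm_klin_left klin_comp_lin[OF f M.da.dm_klin_left]] _ that])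
      (auto simp: E.phi_TD N.da.dm_TD M.da.dm_TD ol Nd)
qed

text \<open>Converse of \<open>coc_dcocycle\<close>: restriction to \<open>A\<close> and the dual
  recovers the entries. The triangular matrices of elements of the double multiply correctly, which
  gives the exchange rule on the extension, and \<open>mixD_mixY\<close> translates it into
  \<open>mix_coc\<close>.\<close>

lemma dcocycle_data:
  assumes phi: "dcocycle \<phi>"
  defines "om \<equiv> \<lambda>a m. \<phi> (TD \<epsilon> a) m" and "la \<equiv> \<lambda>q m. \<phi> (TD q 1) m"
  shows "ext_data A M N om la" "ext_data.act_coc M N om" "ext_data.dual_coc A M N la" "ext_data.mix_coc A M N om la"
    "d \<in> DD \<Longrightarrow> ext_data.phi A M N om la d m = \<phi> d m"
proof -
  have ol: "om a m = \<phi> (TD \<epsilon> a) m" "la q m = \<phi> (TD q 1) m" for a q m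
    by (simp_all add: om_def la_def)
  have kl: "klin_on (tspace DA (spA A) 1) (msc N) (\<lambda>d. \<phi> d m)" for m using phi by (simp add: dcocycle_def)
  have lr: "lin (msc M) (msc N) (\<phi> d)" if "d \<in> DD" for d using phi that by (simp add: dcocycle_def)
  have mu: "\<phi> (double_mult A d d') m = N.da.dm d (\<phi> d' m) + \<phi> d (M.da.dm d' m)" if "d \<in> DD" "d' \<in> DD" for d d' m
    using phi that by (simp add: dcocycle_def)
  show E: "ext_data A M N om la"
  proof (intro ext_data.intro yd_two_axioms ext_data_axioms.intro)
    show "klin_on (spA A) (msc N) (\<lambda>a. om a m)" for m
      unfolding om_def by (rule klin_comp[OF kl]) (auto intro: klin_tens2)
    show "klin_on DA (msc N) (\<lambda>q. la q m)" for m
      unfolding la_def by (rule klin_comp[OF kl]) (auto intro: klin_tens2)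
  qed (auto simp: om_def la_def intro: lr)
  interpret E: ext_data A M N om la by (rule E)
  \<comment> \<open>Every pure tensor factors into its dual part and its \<open>A\<close> part, so
    \<open>\<phi>\<close> is determined by \<open>om\<close> and \<open>la\<close>.\<close>
  have TT: "TD q a = double_mult A (TD q 1) (TD \<epsilon> a)" if "q \<in> vec DA" for q a
    using that by (simp add: dmult_TD_TD dpure_one_left cnv_eps)
  have pure: "\<phi> (TD q a) m = N.dM q (om a m) + la q (act M a m)" if "q \<in> vec DA" for q a m
    using that by (simp add: TT[of q a] mu N.da.dm_TD M.da.dm_TD om_def la_def N.act_one M.dM_eps)
  show ph: "E.phi d m = \<phi> d m" if "d \<in> DD" for d m
    by (rule tens2_eqI[OF E.phi_klin_left kl _ that]) (simp add: E.phi_TD pure)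
  show "E.act_coc"
    unfolding E.act_coc_def
  proof (intro allI)
    fix a b m
    have "TD \<epsilon> (a * b) = double_mult A (TD \<epsilon> a) (TD \<epsilon> b)" by (simp add: dmult_TD_TD dpure_eps_right)
    then show "om (a * b) m = act N a (om b m) + om a (act M b m)"
      by (simp add: om_def mu N.da.dm_TD M.da.dm_TD N.dM_eps M.dM_eps)
  qed
  show "E.dual_coc"
    unfolding E.dual_coc_def
  proof (intro allI ballI)
    fix q q' m assume q: "q \<in> vec DA" "q' \<in> vec DA"
    then have "TD (cnv q q') 1 = double_mult A (TD q 1) (TD q' 1)" by (simp add: dmult_TD_TD dpure_one_left)
    then show "la (cnv q q') m = N.dM q (la q' m) + la q (M.dM q' m)"
      by (simp add: la_def mu N.da.dm_TD M.da.dm_TD N.act_one M.act_one q)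
  qed
  have z: "N.da.dm d 0 = 0" if "d \<in> DD" for d
    using Vector_Spaces.linear.axioms(3)[OF N.dm_lin_right[OF that]] by (rule module_hom.zero)
  have EE: "E.E.dm (double_mult A d d') x = E.E.dm d (E.E.dm d' x)" if d: "d \<in> DD" "d' \<in> DD" for d d' x
    using d N.dm_lin_right[OF d(1)] by (simp add: E.dmE dmult_DD ph mu M.dm_mult N.dm_mult lin_iff add.assoc)
  have TE: "E.E.dm (TD \<epsilon> a) x = E.actE a x" "q \<in> vec DA \<Longrightarrow> E.E.dm (TD q 1) x = E.dE q x" for a q x
    by (simp_all add: E.dmE ph N.da.dm_TD M.da.dm_TD N.dM_eps M.dM_eps N.act_one M.act_one E.actE_def E.dE_def ol)
  have TDE: "E.E.dm (TD p a) x = E.dE p (E.actE a x)" if "p \<in> vec DA" for p a x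
    by (subst TT[OF that]) (simp add: EE TE that)
  have "E.E.mixD x" for x
    unfolding E.E.mixD_def
  proof (intro allI ballI)
    fix a q assume q: "q \<in> vec DA"
    have "E.actE a (E.dE q x) = E.E.dm (double_mult A (TD \<epsilon> a) (TD q 1)) x"
      by (simp add: EE TE q)
    also have "\<dots> = SW E.sE (\<lambda>a1 r. SW E.sE (\<lambda>a2 a3. E.E.dm (TD (tw a1 a3 q) a2) x) r) a"
      by (simp add: dmult_TD_TD q dpure_eps SW_lin[OF E.E.dm_lin_left])
    also have "\<dots> = SW E.sE (\<lambda>a1 r. SW E.sE (\<lambda>a2 a3. E.dE (tw a1 a3 q) (E.actE a2 x)) r) a"
      by (simp add: TDE q)
    finally show "E.actE a (E.dE q x) = SW E.sE (\<lambda>a1 r. SW E.sE (\<lambda>a2 a3. E.dE (tw a1 a3 q) (E.actE a2 x)) r) a" .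
  qed
  then have "E.E.mixY (0, m)" for m by (auto intro: E.E.mixD_mixY)
  then show "E.mix_coc" unfolding E.mix_coc_def E.mixE_iff by blast
qed

end

section \<open>Cochains of total degree one\<close>

context yd_two
begin

abbreviation lN where "lN p \<equiv> tlift (spM N) (spA A) p"
abbreviation pN where "pN p \<equiv> tpure (spM N) (spA A) p"
abbreviation P0 where "P0 v \<equiv> pN 0 (v, [])"
abbreviation P1 where "P1 \<equiv> tens2 (spM N) (spA A)"
abbreviation P2 where "P2 v a b \<equiv> pN 2 (v, [a, b])"
abbreviation Q0 where "Q0 m \<equiv> tpure (spM M) (spA A) 0 (m, [])"
abbreviation Q1 where "Q1 m a \<equiv> tpure (spM M) (spA A) 1 (m, [a])"
abbreviation Q2 where "Q2 m a b \<equiv> tpure (spM M) (spA A) 2 (m, [a, b])"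
abbreviation TM where "TM n \<equiv> tens (spM M) (spA A) n"
abbreviation TN where "TN p \<equiv> tens (spM N) (spA A) p"

lemma P1_tpure: "pN 1 (v, [a]) = P1 v a"
  by (simp add: tens2_def)

lemma klin_P0: "klin_on U (msc N) f \<Longrightarrow> klin_on U tscale (\<lambda>x. P0 (f x))"
proof -
  have "klin_on (spM N) tscale P0"
    using multilinear_tpure[of "spM N" "spA A" 0] by (simp add: multilinear0)
  then show "klin_on U (msc N) f \<Longrightarrow> klin_on U tscale (\<lambda>x. P0 (f x))"
    by (rule klin_comp) auto
qed

lemma klin_P2:
  "klin_on U (msc N) f \<Longrightarrow> klin_on U tscale (\<lambda>x. P2 (f x) a b)"
  "klin_on U (sc A) g \<Longrightarrow> klin_on U tscale (\<lambda>x. P2 v (g x) b)"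
  "klin_on U (sc A) g \<Longrightarrow> klin_on U tscale (\<lambda>x. P2 v a (g x))"
  by (rule klin_comp[OF klin_tpure(3)] klin_comp[OF klin_tpure(1)] klin_comp[OF klin_tpure(2)], simp_all)+

lemma P_closed [simp]: "P0 v \<in> TN 0" "P1 v a \<in> TN 1" "P2 v a b \<in> TN 2"
  by (auto intro!: tpure_tens tens2_tens simp: tuples0 tuples2)

lemma tens_sum: "(\<And>i. i \<in> I \<Longrightarrow> f i \<in> tens V W p) \<Longrightarrow> (\<Sum>i\<in>I. f i) \<in> tens V W p"
  using kclosed_sum[OF kclosed_tspace, of I f V W p] by simp

lemma SW_tens: "(\<And>x y. \<phi> x y \<in> tens V W p) \<Longrightarrow> SW tscale \<phi> a \<in> tens V W p"
  using SW_closed[OF kclosed_tspace, of \<phi> V W p a] by simp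

text \<open>Inverse of \<open>P0\<close>, the identification of \<open>N\<close> with
  \<open>N\<close> tensor the zeroth power of \<open>A\<close>.\<close>

definition ct0 :: "('k, 'n, 'a) tensor \<Rightarrow> 'n" where
  "ct0 = lN 0 (msc N) (\<lambda>(v, vs). v)"

definition ct2 :: "('a \<Rightarrow> 'k) \<Rightarrow> ('a \<Rightarrow> 'k) \<Rightarrow> ('k, 'n, 'a) tensor \<Rightarrow> 'n" where
  "ct2 q q' = lN 2 (msc N) (\<lambda>(v, vs). msc N (q (vs ! 0) * q' (vs ! 1)) v)"

lemma tlift0:
  assumes "vector_space u" "klin_on (spM N) u (\<lambda>v. \<psi> (v, []))"
  shows "lin tscale u (lN 0 u \<psi>)" "lN 0 u \<psi> (P0 v) = \<psi> (v, [])"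
proof -
  have "multilinear (spM N) (spA A) 0 u \<psi>" using assms by (simp add: multilinear0)
  from tlift_linear[OF assms(1) this] tlift_tpure[OF assms(1) this, of "(v, [])"]
  show "lin tscale u (lN 0 u \<psi>)" "lN 0 u \<psi> (P0 v) = \<psi> (v, [])"
    by (auto simp: tuples0)
qed

lemma tlift1:
  assumes "vector_space u" "\<And>w. klin_on (spM N) u (\<lambda>v. \<psi> (v, [w]))" "\<And>v. klin_on (spA A) u (\<lambda>w. \<psi> (v, [w]))"
  shows "lin tscale u (lN 1 u \<psi>)" "lN 1 u \<psi> (P1 v a) = \<psi> (v, [a])"
proof -
  have "multilinear (spM N) (spA A) 1 u \<psi>" using assms by (simp add: multilinear1)
  from tlift_linear[OF assms(1) this] tlift_tpure[OF assms(1) this, of "(v, [a])"]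
  show "lin tscale u (lN 1 u \<psi>)" "lN 1 u \<psi> (P1 v a) = \<psi> (v, [a])"
    by (auto simp: tuples1 P1_tpure)
qed

lemma tlift1_sum:
  assumes "vector_space u" "\<And>w. klin_on (spM N) u (\<lambda>v. \<psi> (v, [w]))" "\<And>v. klin_on (spA A) u (\<lambda>w. \<psi> (v, [w]))"
  shows "lN 1 u \<psi> (\<Sum>b\<in>basis. P1 (x b) b) = (\<Sum>b\<in>basis. \<psi> (x b, [b]))"
  by (subst lin_sum[OF tlift1(1)[OF assms]]) (simp_all add: tlift1(2)[OF assms])

lemma ct0_lin: "lin tscale (msc N) ct0" and ct0_P0 [simp]: "ct0 (P0 v) = v"
  unfolding ct0_def using tlift0[OF N.vector_space_M, of "\<lambda>(v, vs). v"] by (auto intro: N.mklins)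

lemma P0_ct0: assumes t: "t \<in> TN 0" shows "P0 (ct0 t) = t"
  by (rule tens_eqI[OF klin_P0[OF lin_klin_on[OF ct0_lin]] klin_idT _ t]) (auto simp: tuples0)

lemma P0_inj: "P0 v = P0 w \<Longrightarrow> v = w"
  by (metis ct0_P0)

lemma ct2_ml: assumes "q \<in> vec DA" "q' \<in> vec DA"
  shows "multilinear (spM N) (spA A) 2 (msc N) (\<lambda>(v, vs). msc N (q (vs ! 0) * q' (vs ! 1)) v)"
  unfolding multilinear2 by (auto intro!: N.mklins klin_dual assms simp: One_nat_def)

lemma ct2_lin: "q \<in> vec DA \<Longrightarrow> q' \<in> vec DA \<Longrightarrow> lin tscale (msc N) (ct2 q q')"
  unfolding ct2_def by (rule tlift_linear[OF N.vector_space_M ct2_ml])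

lemma ct2_P2: "q \<in> vec DA \<Longrightarrow> q' \<in> vec DA \<Longrightarrow> ct2 q q' (P2 v a b) = msc N (q a * q' b) v"
  unfolding ct2_def by (subst tlift_tpure[OF N.vector_space_M ct2_ml]) (auto simp: tuples2 One_nat_def)

lemma zero_P2: "P2 0 a b = 0" and zero_P1: "P1 0 a = 0"
  using klin_zero[OF kclosed_spM klin_P2(1)[OF N.klin_idM]] klin_zero[OF kclosed_spM N.klin_tens2M(1)[OF N.klin_idM]] by auto

lemma contr_sep: assumes t: "t \<in> TN 1" and 0: "\<And>q. q \<in> vec DA \<Longrightarrow> contr (msc N) q t = 0"
  shows "t = 0"
  using tens2_expand[OF N.vector_space_M, folded N.spM_whole, OF t] by (simp add: 0 co_dual zero_P1)

text \<open>As in \<open>tens2_expand\<close>, a tensor with two factors in \<open>A\<close> is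
  rebuilt from its contractions by pairs of coordinate functionals.\<close>

lemma ct2_sep: assumes t: "t \<in> TN 2" and 0: "\<And>q q'. q \<in> vec DA \<Longrightarrow> q' \<in> vec DA \<Longrightarrow> ct2 q q' t = 0"
  shows "t = 0"
proof -
  have "t = (\<Sum>b\<in>basis. \<Sum>c\<in>basis. P2 (ct2 (co b) (co c) t) b c)"
  proof (rule tens_eqI[OF klin_idT _ _ t])
    show "klin_on (tspace (spM N) (spA A) 2) tscale (\<lambda>t. \<Sum>b\<in>basis. \<Sum>c\<in>basis. P2 (ct2 (co b) (co c) t) b c)"
      by (intro klin_sum_fun vector_space_tscale klin_P2 lin_klin_on ct2_lin co_dual)
    fix x assume "x \<in> tuples (spM N) (spA A) 2"
    then obtain v a a' where x: "x = (v, [a, a'])" by (auto simp: tuples2)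
    have sc: "P2 (msc N c w) b b' = tscale c (P2 w b b')" for c w b b'
      using klin_scale[OF klin_P2(1)[OF N.klin_idM], of w c] by simp
    have sm: "tscale c (\<Sum>i\<in>I. f i) = (\<Sum>i\<in>I. tscale c (f i))" for c I and f :: "_ \<Rightarrow> ('k, 'n, 'a) tensor"
      using Modules.module.scale_sum_right[OF tscale_module] by blast
    have "P2 v a a' = (\<Sum>b\<in>basis. tscale (co b a) (P2 v b a'))"
      by (rule klin_expand[OF klin_P2(2)[OF klin_idA]])
    also have "\<dots> = (\<Sum>b\<in>basis. tscale (co b a) (\<Sum>c\<in>basis. tscale (co c a') (P2 v b c)))"
      using klin_expand[OF klin_P2(3)[OF klin_idA], of v _ a'] by (intro sum.cong refl arg_cong[of _ _ "tscale _"])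
    also have "\<dots> = (\<Sum>b\<in>basis. \<Sum>c\<in>basis. P2 (ct2 (co b) (co c) (P2 v a a')) b c)"
      unfolding sm by (simp add: ct2_P2 co_dual sc) (simp add: tscale_def mult.assoc)
    finally show "pN 2 x = (\<Sum>b\<in>basis. \<Sum>c\<in>basis. P2 (ct2 (co b) (co c) (pN 2 x)) b c)"
      unfolding x .
  qed
  then show ?thesis by (simp add: 0 co_dual zero_P2)
qed

text \<open>The condition on the values in \<open>Y\<close> is left out: agreement on pure tensors
  already gives equality, so differentials can be tested for zero before their values are
  located.\<close>

definition klin0 :: "nat \<Rightarrow> ('k, 'a, 'm, 'n) cochain set" where
  "klin0 n = {g. klin_on (tspace (spM M) (spA A) n) tscale g \<and> (\<forall>t. t \<notin> TM n \<longrightarrow> g t = 0)}"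

lemma Y_klin0: "f \<in> Y A M N n p \<longleftrightarrow> f \<in> klin0 n \<and> (\<forall>t\<in>TM n. f t \<in> TN p)"
  by (auto simp: Y_def klin0_def tspace_def)

lemma klin0_eqI: assumes "g \<in> klin0 n" "h \<in> klin0 n"
    "\<And>x. x \<in> tuples (spM M) (spA A) n \<Longrightarrow> g (tpure (spM M) (spA A) n x) = h (tpure (spM M) (spA A) n x)"
  shows "g = h"
proof
  fix t show "g t = h t"
  proof (cases "t \<in> TM n")
    case True
    then show ?thesis using assms tens_eqI[of "spM M" "spA A" n tscale g h t] by (simp add: klin0_def)
  qed (use assms in \<open>simp add: klin0_def\<close>)
qed

lemma klin0_ext:
  shows "g \<in> klin0 0 \<Longrightarrow> h \<in> klin0 0 \<Longrightarrow> (\<And>m. g (Q0 m) = h (Q0 m)) \<Longrightarrow> g = h"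
    and "g \<in> klin0 1 \<Longrightarrow> h \<in> klin0 1 \<Longrightarrow> (\<And>m a. g (Q1 m a) = h (Q1 m a)) \<Longrightarrow> g = h"
    and "g \<in> klin0 2 \<Longrightarrow> h \<in> klin0 2 \<Longrightarrow> (\<And>m a b. g (Q2 m a b) = h (Q2 m a b)) \<Longrightarrow> g = h"
  by (erule (1) klin0_eqI, force simp: tuples0 tuples1 tuples2)+

lemma klin0_diff: "g \<in> klin0 n \<Longrightarrow> h \<in> klin0 n \<Longrightarrow> g - h \<in> klin0 n"
  and klin0_add: "g \<in> klin0 n \<Longrightarrow> h \<in> klin0 n \<Longrightarrow> g + h \<in> klin0 n"
  and klin0_zero: "0 \<in> klin0 n"
  by (auto simp: klin0_def plus_fun_def[of g h] fun_diff_def[of g h] zero_fun_def[where 'a="('k, 'm, 'a) tensor"]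
      intro!: klin_diff klin_plus klin_zero_fun vector_space_tscale)

lemma Y_closed: assumes f: "f \<in> klin0 n" and p: "\<And>x. x \<in> tuples (spM M) (spA A) n \<Longrightarrow> f (tpure (spM M) (spA A) n x) \<in> TN p"
  shows "f \<in> Y A M N n p"
proof -
  have k: "klin_on (tspace (spM M) (spA A) n) tscale f" using f by (simp add: klin0_def)
  have "t \<in> TM n \<and> f t \<in> TN p" if "t \<in> TM n" for t
    using that[unfolded tens_def]
  proof (induction rule: Modules.module.span_induct_alt[OF tscale_module, consumes 1, case_names base step])
    case base
    show ?case using tens_zero klin_zero[OF kclosed_tspace k] by metis
  next
    case (step c b t)
    then obtain x where x: "x \<in> tuples (spM M) (spA A) n" "b = tpure (spM M) (spA A) n x" by auto
    then have b: "b \<in> TM n" by (simp add: tpure_tens)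
    note cb = tens_scale[OF b, of c]
    have "f (tscale c b + t) = tscale c (f b) + f t"
      using klin_add[OF k, of "tscale c b" t] klin_scale[OF k, of b c] b cb step by simp
    moreover have "f b \<in> TN p" using p[OF x(1)] x(2) by simp
    then have "tscale c (f b) + f t \<in> TN p" using step(2) by (blast intro: tens_add tens_scale)
    ultimately show ?case using step(2) tens_add[OF cb] by metis
  qed
  then show ?thesis using f by (simp add: Y_klin0)
qed

text \<open>\<open>\<phi>\<close> is the function as the face maps state it and
  \<open>\<psi>\<close> its evaluated form. Multilinearity is visible for \<open>\<psi>\<close>, and
  agreement on tuples transfers it.\<close>

lemma ext_mult_klin0:
  assumes ml: "multilinear (spM M) (spA A) n tscale \<psi>" and eq: "\<And>x. x \<in> tuples (spM M) (spA A) n \<Longrightarrow> \<phi> x = \<psi> x"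
  shows "ext_mult A M n \<phi> \<in> klin0 n" "x \<in> tuples (spM M) (spA A) n \<Longrightarrow> ext_mult A M n \<phi> (tpure (spM M) (spA A) n x) = \<psi> x"
proof -
  have ml': "multilinear (spM M) (spA A) n tscale \<phi>"
    by (rule multilinear_cong[OF ml eq]) auto
  note L = tlift_klin[OF vector_space_tscale ml']
  have e: "ext_mult A M n \<phi> t = tlift (spM M) (spA A) n tscale \<phi> t" if "t \<in> TM n" for t
    using that by (simp add: ext_mult_def)
  have "klin_on (tspace (spM M) (spA A) n) tscale (ext_mult A M n \<phi>)"
    by (rule klin_cong[OF L]) (auto simp: e intro: tens_add tens_scale)
  then show "ext_mult A M n \<phi> \<in> klin0 n" by (simp add: klin0_def ext_mult_def)
  show "ext_mult A M n \<phi> (tpure (spM M) (spA A) n x) = \<psi> x" if "x \<in> tuples (spM M) (spA A) n"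
    using that tlift_tpure[OF vector_space_tscale ml' that] by (simp add: e tpure_tens eq)
qed

lemma ext_mult0:
  assumes "\<And>m. \<phi> (m, []) = \<psi> m" "klin_on (spM M) tscale \<psi>"
  shows "ext_mult A M 0 \<phi> \<in> klin0 0 \<and> (\<forall>m. ext_mult A M 0 \<phi> (Q0 m) = \<psi> m)"
  using ext_mult_klin0[of 0 "\<lambda>(m, as). \<psi> m" \<phi>] assms by (auto simp: multilinear0 tuples0)

lemma ext_mult1:
  assumes "\<And>m a. \<phi> (m, [a]) = \<psi> m a" "\<And>a. klin_on (spM M) tscale (\<lambda>m. \<psi> m a)" "\<And>m. klin_on (spA A) tscale (\<psi> m)"
  shows "ext_mult A M 1 \<phi> \<in> klin0 1 \<and> (\<forall>m a. ext_mult A M 1 \<phi> (Q1 m a) = \<psi> m a)"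
proof -
  have ml: "multilinear (spM M) (spA A) 1 tscale (\<lambda>(m, as). \<psi> m (hd as))" using assms by (simp add: multilinear1)
  have e: "\<phi> x = (\<lambda>(m, as). \<psi> m (hd as)) x" if "x \<in> tuples (spM M) (spA A) 1" for x
    using that assms(1) by (auto simp: tuples1)
  show ?thesis
    using ext_mult_klin0(1)[OF ml e] ext_mult_klin0(2)[OF ml e, of "(_, [_])"] by (simp add: tuples1)
qed

lemma ext_mult2:
  assumes "\<And>m a b. \<phi> (m, [a, b]) = \<psi> m a b" "\<And>a b. klin_on (spM M) tscale (\<lambda>m. \<psi> m a b)"
    "\<And>m b. klin_on (spA A) tscale (\<lambda>a. \<psi> m a b)" "\<And>m a. klin_on (spA A) tscale (\<psi> m a)"
  shows "ext_mult A M 2 \<phi> \<in> klin0 2 \<and> (\<forall>m a b. ext_mult A M 2 \<phi> (Q2 m a b) = \<psi> m a b)"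
proof -
  have ml: "multilinear (spM M) (spA A) 2 tscale (\<lambda>(m, as). \<psi> m (as ! 0) (as ! 1))" using assms by (simp add: multilinear2 One_nat_def)
  have e: "\<phi> x = (\<lambda>(m, as). \<psi> m (as ! 0) (as ! 1)) x" if "x \<in> tuples (spM M) (spA A) 2" for x
    using that assms(1) by (auto simp: tuples2 One_nat_def)
  show ?thesis
    using ext_mult_klin0(1)[OF ml e] ext_mult_klin0(2)[OF ml e, of "(_, [_, _])"] by (simp add: tuples2 One_nat_def)
qed

lemma sum_le: "(\<Sum>i\<le>0 + (1::nat). f i) = f 0 + f 1" "(\<Sum>i\<le>1 + (1::nat). f i) = f 0 + f 1 + f 2"
  for f :: "nat \<Rightarrow> 'z::ab_group_add"
  by (simp_all add: numeral_2_eq_2 One_nat_def add.assoc)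

lemma tscale_sgn: "tscale ((-1) ^ 0) x = x" "tscale ((-1) ^ 1) x = - x" "tscale ((-1) ^ 2) x = x" for x :: "'z \<Rightarrow> 'k"
  by (auto simp: tscale_def)

lemma d_expand:
  "d_m A M N 0 p f t = b_map A M N 0 p 0 f t - b_map A M N 0 p 1 f t"
  "d_m A M N 1 p f t = b_map A M N 1 p 0 f t - b_map A M N 1 p 1 f t + b_map A M N 1 p 2 f t"
  "d_c A M N n 0 f t = c_map A M N n 0 0 f t - c_map A M N n 0 1 f t"
  "d_c A M N n 1 f t = c_map A M N n 1 0 f t - c_map A M N n 1 1 f t + c_map A M N n 1 2 f t"
  unfolding d_m_def d_c_def sum_le tscale_sgn by (simp_all only: diff_conv_add_uminus)

lemma swm_N: "vector_space u \<Longrightarrow> (\<And>b. klin_on (spM N) u (\<lambda>v. \<phi> v b)) \<Longrightarrow> (\<And>v. klin_on (spA A) u (\<phi> v)) \<Longrightarrow>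
   swm A N u \<phi> m = (\<Sum>b\<in>basis. \<phi> (N.dM (co b) m) b)"
  by (rule N.swm_sum) (auto intro: bilI)

lemma swm_M: "vector_space u \<Longrightarrow> (\<And>b. klin_on (spM M) u (\<lambda>v. \<phi> v b)) \<Longrightarrow> (\<And>v. klin_on (spA A) u (\<phi> v)) \<Longrightarrow>
   swm A M u \<phi> m = (\<Sum>b\<in>basis. \<phi> (M.dM (co b) m) b)"
  by (rule M.swm_sum) (auto intro: bilI)

end

section \<open>Face maps on cochains of total degree one\<close>

context ext_data
begin

lemmas pklins = klin_P0 klin_P2 N.klin_tens2M klin_om klin_la M.mklins N.mklins vector_space_tscale


lemma b_map_01_0:
  assumes f0Q: "\<And>m. f0 (Q0 m) = (\<Sum>b\<in>basis. P1 (la (co b) m) b)"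
  shows "b_map A M N 0 1 0 f0 \<in> klin0 1 \<and> (\<forall>m a. b_map A M N 0 1 0 f0 (Q1 m a) =
      SW tscale (\<lambda>a1 a2. \<Sum>b\<in>basis. P1 (act N a1 (la (co b) m)) (a2 * b)) a)"
proof -
  have t: "lN 1 tscale (\<lambda>(v, vs). pN 1 (act N x v, map2 (*) [y] vs)) (f0 (Q0 m))
       = (\<Sum>b\<in>basis. P1 (act N x (la (co b) m)) (y * b))" for x y m
    unfolding f0Q by (subst tlift1_sum) (auto simp: P1_tpure intro!: pklins)
  have e: "sw_iter A 2 tscale (\<lambda>hs. lN 1 tscale
           (\<lambda>(v, vs). pN 1 (act N (hd hs) v, map2 (*) (tl hs) vs)) (f0 (Q0 m))) a
       = SW tscale (\<lambda>a1 a2. \<Sum>b\<in>basis. P1 (act N a1 (la (co b) m)) (a2 * b)) a" for m a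
    by (subst sw_iter2[OF vector_space_tscale]) (auto simp: t intro!: bilI pklins)
  show ?thesis
    unfolding b_map_def simp_thms if_True add_0
    by (rule ext_mult1) (simp add: e, (intro pklins)+)
qed

lemma b_map_01_1:
  assumes f0Q: "\<And>m. f0 (Q0 m) = (\<Sum>b\<in>basis. P1 (la (co b) m) b)"
  shows "b_map A M N 0 1 1 f0 \<in> klin0 1 \<and> (\<forall>m a. b_map A M N 0 1 1 f0 (Q1 m a) =
      SW tscale (\<lambda>a1 a2. \<Sum>b\<in>basis. P1 (la (co b) (act M a2 m)) (b * a1)) a)"
proof -
  have t: "lN 1 tscale (\<lambda>(v, vs). pN 1 (v, map2 (*) vs [x])) (f0 (Q0 m))
       = (\<Sum>b\<in>basis. P1 (la (co b) m) (b * x))" for x m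
    unfolding f0Q by (subst tlift1_sum) (auto simp: P1_tpure intro!: pklins)
  have e: "sw_iter A 2 tscale (\<lambda>hs. lN 1 tscale
           (\<lambda>(v, vs). pN 1 (v, map2 (*) vs (butlast hs))) (f0 (Q0 (act M (last hs) m)))) a
       = SW tscale (\<lambda>a1 a2. \<Sum>b\<in>basis. P1 (la (co b) (act M a2 m)) (b * a1)) a" for m a
    by (subst sw_iter2[OF vector_space_tscale]) (auto simp: t intro!: bilI pklins)
  have i: "((1::nat) = 0) = False" "((1::nat) \<le> 0) = False" by auto
  show ?thesis
    unfolding b_map_def i if_False add_0
    by (rule ext_mult1) (simp add: e, (intro pklins)+)
qed

lemma c_map_10_0:
  assumes f1Q: "\<And>m a. f1 (Q1 m a) = P0 (om a m)"
  shows "c_map A M N 1 0 0 f1 \<in> klin0 1 \<and> (\<forall>m a. c_map A M N 1 0 0 f1 (Q1 m a) =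
    SW tscale (\<lambda>a1 a2. \<Sum>b\<in>basis. P1 (N.dM (co b) (om a2 m)) (b * a1)) a)"
proof -
  have w: "swm A N tscale (\<lambda>v0 v1. pN 1 (v0, [v1 * x])) v = (\<Sum>b\<in>basis. P1 (N.dM (co b) v) (b * x))" for x v
    unfolding P1_tpure by (rule swm_N) (intro pklins)+
  have t: "lN 0 tscale (\<lambda>(v, vs). swm A N tscale
                  (\<lambda>v0 v1. pN 1 (v0, (v1 * x) # vs)) v) (f1 (Q1 m y))
       = (\<Sum>b\<in>basis. P1 (N.dM (co b) (om y m)) (b * x))" for x y m
    unfolding f1Q by (subst tlift0(2)) (auto simp: w intro!: pklins)
  have e: "sw A tscale (\<lambda>x y. lN 0 tscale (\<lambda>(v, vs). swm A N tscale
                  (\<lambda>v0 v1. pN 1 (v0, (v1 * x) # vs)) v) (f1 (Q1 m y))) a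
       = SW tscale (\<lambda>a1 a2. \<Sum>b\<in>basis. P1 (N.dM (co b) (om a2 m)) (b * a1)) a" for m a
    unfolding t by (rule sw_SW[OF vector_space_tscale]) (intro bilI pklins)
  show ?thesis
    unfolding c_map_def simp_thms if_True add_0
    by (rule ext_mult1) (simp add: e, (intro pklins)+)
qed

lemma c_map_10_1:
  assumes f1Q: "\<And>m a. f1 (Q1 m a) = P0 (om a m)"
  shows "c_map A M N 1 0 1 f1 \<in> klin0 1 \<and> (\<forall>m a. c_map A M N 1 0 1 f1 (Q1 m a) =
    SW tscale (\<lambda>a1 a2. \<Sum>b\<in>basis. P1 (om a1 (M.dM (co b) m)) (a2 * b)) a)"
proof -
  have t: "lN 0 tscale (\<lambda>(v, vs). pN 1 (v, vs @ [y])) (f1 (Q1 m x))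
       = P1 (om x m) y" for x y m
    unfolding f1Q by (subst tlift0(2)) (auto simp: P1_tpure intro!: pklins)
  have w: "swm A M tscale (\<lambda>m0 m1. lN 0 tscale (\<lambda>(v, vs). pN 1 (v, vs @ [y * m1])) (f1 (Q1 m0 x))) m
      = (\<Sum>b\<in>basis. P1 (om x (M.dM (co b) m)) (y * b))" for x y m
    unfolding t by (rule swm_M) (intro pklins)+
  have e: "sw A tscale (\<lambda>x y. swm A M tscale (\<lambda>m0 m1. lN 0 tscale (\<lambda>(v, vs). pN 1 (v, vs @ [y * m1])) (f1 (Q1 m0 x))) m) a
       = SW tscale (\<lambda>a1 a2. \<Sum>b\<in>basis. P1 (om a1 (M.dM (co b) m)) (a2 * b)) a" for m a
    unfolding w by (rule sw_SW[OF vector_space_tscale]) (intro bilI pklins)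
  have i: "((1::nat) = 0) = False" "((1::nat) \<le> 0) = False" by auto
  show ?thesis
    unfolding c_map_def i if_False add_0
    by (rule ext_mult1) (simp add: e, (intro pklins)+)
qed

lemma c_map_01_0:
  assumes f0Q: "\<And>m. f0 (Q0 m) = (\<Sum>b\<in>basis. P1 (la (co b) m) b)"
  shows "c_map A M N 0 1 0 f0 \<in> klin0 0 \<and> (\<forall>m. c_map A M N 0 1 0 f0 (Q0 m) =
     (\<Sum>b\<in>basis. \<Sum>c\<in>basis. P2 (N.dM (co c) (la (co b) m)) c b))"
proof -
  have w: "swm A N tscale (\<lambda>v0 v1. P2 v0 v1 x) v = (\<Sum>c\<in>basis. P2 (N.dM (co c) v) c x)" for x v
    by (rule swm_N) (intro pklins)+
  have t: "lN 1 tscale (\<lambda>(v, vs). swm A N tscale (\<lambda>v0 v1. pN 2 (v0, v1 # vs)) v) (f0 (Q0 m))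
       = (\<Sum>b\<in>basis. \<Sum>c\<in>basis. P2 (N.dM (co c) (la (co b) m)) c b)" for m
    unfolding f0Q by (subst tlift1_sum) (auto simp: w intro!: pklins)
  show ?thesis
    unfolding c_map_def simp_thms if_True one_add_one
    by (rule ext_mult0) (simp add: t, (intro pklins)+)
qed

text \<open>This face acts only on the values of the cochain and is not built with
  \<open>ext_mult\<close>; linearity and vanishing off the tensor product are inherited from
  \<open>f0\<close>.\<close>

lemma c_map_01_1:
  assumes f0: "f0 \<in> klin0 0" and f0Q: "\<And>m. f0 (Q0 m) = (\<Sum>b\<in>basis. P1 (la (co b) m) b)"
  shows "c_map A M N 0 1 1 f0 \<in> klin0 0 \<and> (\<forall>m. c_map A M N 0 1 1 f0 (Q0 m) = (\<Sum>b\<in>basis. SW tscale (\<lambda>x y. P2 (la (co b) m) x y) b))"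
proof -
  let ?p = "\<lambda>(v, vs). sw A tscale (\<lambda>x y. pN 2 (v, take (1 - 1) vs @ [x, y] @ drop 1 vs)) (vs ! (1 - 1))"
  have w: "?p (v, [a]) = SW tscale (\<lambda>x y. P2 v x y) a" for v a
    using sw_SW[OF vector_space_tscale, of "\<lambda>x y. P2 v x y" a] by (simp add: bil_def klin_P2 klin_idA One_nat_def)
  have k: "klin_on (spM N) tscale (\<lambda>v. SW tscale (\<lambda>x y. P2 v x y) a)" "klin_on (spA A) tscale (\<lambda>a. SW tscale (\<lambda>x y. P2 v x y) a)" for v a
    by (intro pklins)+
  have L: "lin tscale tscale (lN 1 tscale ?p)"
    by (rule tlift1(1)) (unfold w, (rule vector_space_tscale k)+)
  have i: "((1::nat) = 0) = False" "((1::nat) \<le> 1) = True" by auto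
  have e: "c_map A M N 0 1 1 f0 = (\<lambda>t. lN 1 tscale ?p (f0 t))"
    unfolding c_map_def i if_False if_True one_add_one ..
  have T0: "lN 1 tscale ?p 0 = 0"
    using Vector_Spaces.linear.axioms(3)[OF L] by (rule module_hom.zero)
  have k0: "klin_on (tspace (spM M) (spA A) 0) tscale f0" and z: "\<And>t. t \<notin> TM 0 \<Longrightarrow> f0 t = 0"
    using f0 by (auto simp: klin0_def)
  have "lN 1 tscale ?p (f0 t) = 0" if "t \<notin> TM 0" for t
    unfolding z[OF that] by (rule T0)
  then have "c_map A M N 0 1 1 f0 \<in> klin0 0"
    unfolding e klin0_def using klin_comp_lin[OF L k0] by blast
  moreover have "c_map A M N 0 1 1 f0 (Q0 m) = (\<Sum>b\<in>basis. SW tscale (\<lambda>x y. P2 (la (co b) m) x y) b)" for m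
    unfolding e f0Q by (subst tlift1_sum) (unfold w, (rule vector_space_tscale k refl)+)
  ultimately show ?thesis by blast
qed

lemma c_map_01_2:
  assumes f0Q: "\<And>m. f0 (Q0 m) = (\<Sum>b\<in>basis. P1 (la (co b) m) b)"
  shows "c_map A M N 0 1 2 f0 \<in> klin0 0 \<and> (\<forall>m. c_map A M N 0 1 2 f0 (Q0 m) = (\<Sum>c\<in>basis. \<Sum>b\<in>basis. P2 (la (co b) (M.dM (co c) m)) b c))"
proof -
  have t: "lN 1 tscale (\<lambda>(v, vs). pN 2 (v, vs @ [y])) (f0 (Q0 m))
       = (\<Sum>b\<in>basis. P2 (la (co b) m) b y)" for m y
    unfolding f0Q by (subst tlift1_sum) (auto intro!: pklins)
  have w: "swm A M tscale (\<lambda>m0 m1. lN 1 tscale (\<lambda>(v, vs). pN 2 (v, vs @ [m1])) (f0 (Q0 m0))) m =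
      (\<Sum>c\<in>basis. \<Sum>b\<in>basis. P2 (la (co b) (M.dM (co c) m)) b c)" for m
    unfolding t by (rule swm_M) (intro pklins)+
  have i: "((2::nat) = 0) = False" "((2::nat) \<le> 1) = False" by auto
  show ?thesis
    unfolding c_map_def i if_False one_add_one
    by (rule ext_mult0) (simp add: w, (intro pklins)+)
qed

lemma b_map_10:
  assumes f1Q: "\<And>m a. f1 (Q1 m a) = P0 (om a m)"
  shows "b_map A M N 1 0 0 f1 \<in> klin0 2 \<and> (\<forall>m a b. b_map A M N 1 0 0 f1 (Q2 m a b) = P0 (act N a (om b m)))"
    "b_map A M N 1 0 1 f1 \<in> klin0 2 \<and> (\<forall>m a b. b_map A M N 1 0 1 f1 (Q2 m a b) = P0 (om (a * b) m))"
    "b_map A M N 1 0 2 f1 \<in> klin0 2 \<and> (\<forall>m a b. b_map A M N 1 0 2 f1 (Q2 m a b) = P0 (om a (act M b m)))"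
proof -
  have t: "lN 0 tscale (\<lambda>(v, vs). pN 0 (act N x v, map2 (*) [] vs)) (f1 (Q1 m b)) = P0 (act N x (om b m))"
    "lN 0 tscale (\<lambda>(v, vs). pN 0 (v, map2 (*) vs [])) (f1 (Q1 m b)) = P0 (om b m)" for x m b
    unfolding f1Q by (subst tlift0(2), auto intro!: pklins)+
  have e: "sw_iter A 1 tscale (\<lambda>hs. lN 0 tscale (\<lambda>(v, vs). pN 0 (act N (hd hs) v, map2 (*) (tl hs) vs)) (f1 (Q1 m b))) a
     = P0 (act N a (om b m))" for m a b
    by (subst sw_iter1[OF vector_space_tscale]) (auto simp: t[simplified] intro!: pklins)
  have e': "sw_iter A 1 tscale (\<lambda>hs. lN 0 tscale (\<lambda>(v, vs). pN 0 (v, map2 (*) vs (butlast hs))) (f1 (Q1 (act M (last hs) m) b))) a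
     = P0 (om b (act M a m))" for m a b
    by (subst sw_iter1[OF vector_space_tscale]) (auto simp: t[simplified] intro!: pklins)
  have i: "((1::nat) = 0) = False" "((1::nat) \<le> 1) = True" "((2::nat) = 0) = False" "((2::nat) \<le> 1) = False" by auto
  show "b_map A M N 1 0 0 f1 \<in> klin0 2 \<and> (\<forall>m a b. b_map A M N 1 0 0 f1 (Q2 m a b) = P0 (act N a (om b m)))"
    unfolding b_map_def simp_thms if_True one_add_one add_0
    by (rule ext_mult2) (simp add: e, (intro pklins)+)
  show "b_map A M N 1 0 1 f1 \<in> klin0 2 \<and> (\<forall>m a b. b_map A M N 1 0 1 f1 (Q2 m a b) = P0 (om (a * b) m))"
    unfolding b_map_def i if_True if_False one_add_one add_0
    by (rule ext_mult2) (simp add: f1Q One_nat_def f1Q[unfolded One_nat_def], (intro pklins)+)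
  show "b_map A M N 1 0 2 f1 \<in> klin0 2 \<and> (\<forall>m a b. b_map A M N 1 0 2 f1 (Q2 m a b) = P0 (om a (act M b m)))"
    unfolding b_map_def i if_True if_False one_add_one add_0
    by (rule ext_mult2) (simp add: e', (intro pklins)+)
qed


lemma lin_comb: "lin s t f \<Longrightarrow> (\<Sum>b\<in>I. t (p b) (f (x b))) = f (\<Sum>b\<in>I. s (p b) (x b))"
  by (subst lin_sum, assumption) (simp add: lin_iff)

lemma la_sum: "p \<in> vec DA \<Longrightarrow> (\<Sum>b\<in>basis. msc N (p b) (la (co b) m)) = la p m"
  using dual_expand[OF la_left, of p m] by simp

lemma dMs: "p \<in> vec DA \<Longrightarrow> (\<Sum>b\<in>basis. msc M (p b) (M.dM (co b) m)) = M.dM p m"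
  "p \<in> vec DA \<Longrightarrow> (\<Sum>b\<in>basis. msc N (p b) (N.dM (co b) n)) = N.dM p n"
  using M.dM_sum N.dM_sum by simp_all

text \<open>The value at \<open>m\<close> lies in \<open>N\<close> tensor two copies of
  \<open>A\<close>. Its contraction by \<open>q\<close> and \<open>q'\<close> is the defect of
  \<open>dual_coc\<close>, and such contractions separate tensors.\<close>

lemma dc_iff_dual_coc:
  assumes f0: "f0 \<in> klin0 0" and f0Q: "\<And>m. f0 (Q0 m) = (\<Sum>b\<in>basis. P1 (la (co b) m) b)"
  shows "d_c A M N 0 1 f0 = 0 \<longleftrightarrow> dual_coc"
proof -
  interpret VN: vector_space "msc N" by (rule N.vector_space_M)
  note c = c_map_01_0[OF f0Q] c_map_01_1[OF f0 f0Q] c_map_01_2[OF f0Q]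
  have e: "d_c A M N 0 1 f0 = c_map A M N 0 1 0 f0 - c_map A M N 0 1 1 f0 + c_map A M N 0 1 2 f0"
    by (rule ext) (simp add: d_expand)
  have k: "d_c A M N 0 1 f0 \<in> klin0 0"
    unfolding e using c by (intro klin0_add klin0_diff) auto
  define V where "V m = (\<Sum>b\<in>basis. \<Sum>c\<in>basis. P2 (N.dM (co c) (la (co b) m)) c b) -
      (\<Sum>b\<in>basis. SW tscale (\<lambda>x y. P2 (la (co b) m) x y) b) + (\<Sum>c\<in>basis. \<Sum>b\<in>basis. P2 (la (co b) (M.dM (co c) m)) b c)" for m
  have v: "d_c A M N 0 1 f0 (Q0 m) = V m" for m
    unfolding d_expand V_def using c by simp
  have VT: "V m \<in> TN 2" for m
    unfolding V_def by (intro tens_add tens_diff tens_sum SW_tens P_closed)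
  have ct: "ct2 q q' (V m) = N.dM q (la q' m) - la (cnv q q') m + la q (M.dM q' m)" if q: "q \<in> vec DA" "q' \<in> vec DA" for q q' m
  proof -
    note L = ct2_lin[OF q]
    interpret L: Vector_Spaces.linear tscale "msc N" "ct2 q q'" by (rule L)
    have 1: "ct2 q q' (\<Sum>b\<in>basis. \<Sum>c\<in>basis. P2 (N.dM (co c) (la (co b) m)) c b) = N.dM q (la q' m)"
    proof -
      have "ct2 q q' (\<Sum>b\<in>basis. \<Sum>c\<in>basis. P2 (N.dM (co c) (la (co b) m)) c b) =
        (\<Sum>b\<in>basis. msc N (q' b) (\<Sum>c\<in>basis. msc N (q c) (N.dM (co c) (la (co b) m))))"
        by (simp add: lin_sum[OF L] ct2_P2 q VN.scale_sum_right mult.commute)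
      then show ?thesis by (simp add: dMs q lin_comb[OF N.dM_lin] la_sum)
    qed
    have 2: "ct2 q q' (\<Sum>b\<in>basis. SW tscale (\<lambda>x y. P2 (la (co b) m) x y) b) = la (cnv q q') m"
    proof -
      have "SW (msc N) (\<lambda>x y. msc N (q x * q' y) v) b = msc N (cnv q q' b) v" for v b
      proof -
        have "lin (*) (msc N) (\<lambda>c. msc N c v)"
          by (simp add: lin_iff vector_space_times N.vector_space_M VN.scale_left_distrib)
        from SW_lin[OF this, of "\<lambda>u v. q u * q' v" b] show ?thesis by (simp add: cnv_def)
      qed
      then show ?thesis by (simp add: lin_sum[OF L] SW_lin[OF L] ct2_P2 q la_sum)
    qed
    have 3: "ct2 q q' (\<Sum>c\<in>basis. \<Sum>b\<in>basis. P2 (la (co b) (M.dM (co c) m)) b c) = la q (M.dM q' m)"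
    proof -
      have "ct2 q q' (\<Sum>c\<in>basis. \<Sum>b\<in>basis. P2 (la (co b) (M.dM (co c) m)) b c) =
        (\<Sum>c\<in>basis. msc N (q' c) (\<Sum>b\<in>basis. msc N (q b) (la (co b) (M.dM (co c) m))))"
        by (simp add: lin_sum[OF L] ct2_P2 q VN.scale_sum_right mult.commute)
      then show ?thesis by (simp add: dMs q lin_comb[OF la_right] la_sum)
    qed
    show ?thesis unfolding V_def L.add L.diff 1 2 3 ..
  qed
  have "d_c A M N 0 1 f0 = 0 \<longleftrightarrow> (\<forall>m. V m = 0)"
    using klin0_ext(1)[OF k klin0_zero] v by auto
  also have "\<dots> \<longleftrightarrow> (\<forall>m. \<forall>q\<in>vec DA. \<forall>q'\<in>vec DA. ct2 q q' (V m) = 0)"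
  proof -
    have "ct2 q q' 0 = 0" if "q \<in> vec DA" "q' \<in> vec DA" for q q'
      using Vector_Spaces.linear.axioms(3)[OF ct2_lin[OF that]] by (rule module_hom.zero)
    then show ?thesis using ct2_sep[OF VT] by (intro iff_allI iffI) (simp, blast)
  qed
  also have "\<dots> \<longleftrightarrow> dual_coc"
  proof -
    have iff: "(a::'n) - b + c = 0 \<longleftrightarrow> b = a + c" for a b c by (auto simp: algebra_simps)
    have "ct2 q q' (V m) = 0 \<longleftrightarrow> la (cnv q q') m = N.dM q (la q' m) + la q (M.dM q' m)"
      if "q \<in> vec DA" "q' \<in> vec DA" for q q' m
      by (simp only: ct[OF that] iff)
    then show ?thesis unfolding dual_coc_def by blast
  qed
  finally show ?thesis .
qed

text \<open>The values lie in \<open>N\<close> tensor the zeroth power of \<open>A\<close>, so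
  injectivity of \<open>P0\<close> takes the place of contractions.\<close>

lemma dm_iff_act_coc:
  assumes f1Q: "\<And>m a. f1 (Q1 m a) = P0 (om a m)"
  shows "d_m A M N 1 0 f1 = 0 \<longleftrightarrow> act_coc"
proof -
  note c = b_map_10[OF f1Q]
  have e: "d_m A M N 1 0 f1 = b_map A M N 1 0 0 f1 - b_map A M N 1 0 1 f1 + b_map A M N 1 0 2 f1"
    by (rule ext) (simp add: d_expand)
  have k: "d_m A M N 1 0 f1 \<in> klin0 2"
    unfolding e using c by (intro klin0_add klin0_diff) auto
  have pl: "lin (msc N) tscale P0"
    using klin_P0[OF N.klin_idM] unfolding N.spM_whole by (rule klin_lin[OF N.vector_space_M vector_space_tscale])
  interpret P: Vector_Spaces.linear "msc N" tscale P0 by (rule pl)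
  have v: "d_m A M N 1 0 f1 (Q2 m a b) = P0 (act N a (om b m) - om (a * b) m + om a (act M b m))" for m a b
    unfolding d_expand P.add P.diff using c by simp
  have "d_m A M N 1 0 f1 = 0 \<longleftrightarrow> (\<forall>m a b. P0 (act N a (om b m) - om (a * b) m + om a (act M b m)) = 0)"
    using klin0_ext(3)[OF k klin0_zero] v by auto
  also have "\<dots> \<longleftrightarrow> (\<forall>m a b. act N a (om b m) - om (a * b) m + om a (act M b m) = 0)"
    using P0_inj[of _ 0] P.zero by metis
  also have "\<dots> \<longleftrightarrow> act_coc"
  proof -
    have iff: "(a::'n) - b + c = 0 \<longleftrightarrow> b = a + c" for a b c by (auto simp: algebra_simps)
    show ?thesis unfolding act_coc_def iff by blast
  qed
  finally show ?thesis .
qed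

lemma contr_P1: "q \<in> vec DA \<Longrightarrow> contr (msc N) q (\<Sum>b\<in>I. P1 (x b) (g b)) = (\<Sum>b\<in>I. msc N (q (g b)) (x b))"
  by (simp add: lin_sum[OF N.contr_linM] N.contrM)

text \<open>The component in \<open>Y\<^sup>1\<^sup>,\<^sup>1\<close>. The factor \<open>- 1\<close>
  is the sign of \<open>d_c\<close> for \<open>n = 1\<close>; contracting by \<open>q\<close> leaves
  the difference of the two sides of \<open>mix_coc\<close>.\<close>

lemma mixed_iff_mix_coc:
  assumes f0Q: "\<And>m. f0 (Q0 m) = (\<Sum>b\<in>basis. P1 (la (co b) m) b)"
    and f1Q: "\<And>m a. f1 (Q1 m a) = P0 (om a m)"
  shows "d_m A M N 0 1 f0 + (\<lambda>t. tscale (- 1) (d_c A M N 1 0 f1 t)) = 0 \<longleftrightarrow> mix_coc"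
proof -
  note c = b_map_01_0[OF f0Q] b_map_01_1[OF f0Q] c_map_10_0[OF f1Q] c_map_10_1[OF f1Q]
  have neg: "tscale (- 1) x = - x" for x :: "('k, 'n, 'a) tensor" using tscale_sgn(2)[of x] by simp
  define D where "D = d_m A M N 0 1 f0 + (\<lambda>t. tscale (- 1) (d_c A M N 1 0 f1 t))"
  have e: "D = (b_map A M N 0 1 0 f0 - b_map A M N 0 1 1 f0) - (c_map A M N 1 0 0 f1 - c_map A M N 1 0 1 f1)"
    by (rule ext) (simp add: D_def d_expand neg)
  have k: "D \<in> klin0 1"
    unfolding e using c by (intro klin0_diff) auto
  define V where "V m a = (SW tscale (\<lambda>a1 a2. \<Sum>b\<in>basis. P1 (act N a1 (la (co b) m)) (a2 * b)) a -
     SW tscale (\<lambda>a1 a2. \<Sum>b\<in>basis. P1 (la (co b) (act M a2 m)) (b * a1)) a) -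
     (SW tscale (\<lambda>a1 a2. \<Sum>b\<in>basis. P1 (N.dM (co b) (om a2 m)) (b * a1)) a -
     SW tscale (\<lambda>a1 a2. \<Sum>b\<in>basis. P1 (om a1 (M.dM (co b) m)) (a2 * b)) a)" for m a
  have v: "D (Q1 m a) = V m a" for m a
    unfolding e V_def using c by simp
  have VT: "V m a \<in> TN 1" for m a
    unfolding V_def by (intro tens_diff tens_sum SW_tens P_closed)
  let ?L = "\<lambda>q m a. SW (msc N) (\<lambda>a1 a2. N.dM (\<lambda>z. q (z * a1)) (om a2 m) + la (\<lambda>z. q (z * a1)) (act M a2 m)) a"
  let ?R = "\<lambda>q m a. SW (msc N) (\<lambda>a1 a2. act N a1 (la (\<lambda>z. q (a2 * z)) m) + om a1 (M.dM (\<lambda>z. q (a2 * z)) m)) a"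
  have ct: "contr (msc N) q (V m a) = ?R q m a - ?L q m a" if q: "q \<in> vec DA" for q m a
  proof -
    note L = N.contr_linM[OF q]
    interpret L: Vector_Spaces.linear tscale "msc N" "contr (msc N) q" by (rule L)
    have s: "(\<Sum>b\<in>basis. msc N (q (a2 * b)) (act N a1 (la (co b) m))) = act N a1 (la (\<lambda>z. q (a2 * z)) m)"
      "(\<Sum>b\<in>basis. msc N (q (b * a1)) (la (co b) m)) = la (\<lambda>z. q (z * a1)) m"
      "(\<Sum>b\<in>basis. msc N (q (b * a1)) (N.dM (co b) n)) = N.dM (\<lambda>z. q (z * a1)) n"
      "(\<Sum>b\<in>basis. msc N (q (a2 * b)) (om a1 (M.dM (co b) m))) = om a1 (M.dM (\<lambda>z. q (a2 * z)) m)" for a1 a2 m n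
      using la_sum[OF E.mult_dual(2)[OF q], of a2 m] la_sum[OF E.mult_dual(3)[OF q], of a1 m]
        dMs(2)[OF E.mult_dual(3)[OF q], of a1 n] dMs(1)[OF E.mult_dual(2)[OF q], of a2 m]
      by (simp_all add: lin_comb[OF N.act_linear_right] lin_comb[OF om_right])
    show ?thesis
      unfolding V_def L.add L.diff SW_lin[OF L] contr_P1[OF q] s SW_add[OF N.vector_space_M] by (simp add: algebra_simps)
  qed
  have "D = 0 \<longleftrightarrow> (\<forall>m a. V m a = 0)"
    using klin0_ext(2)[OF k klin0_zero] v by auto
  also have "\<dots> \<longleftrightarrow> (\<forall>m a. \<forall>q\<in>vec DA. contr (msc N) q (V m a) = 0)"
  proof -
    have "contr (msc N) q 0 = 0" if "q \<in> vec DA" for q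
      using Vector_Spaces.linear.axioms(3)[OF N.contr_linM[OF that]] by (rule module_hom.zero)
    then show ?thesis using contr_sep[OF VT] by (intro iff_allI iffI) (simp, blast)
  qed
  also have "\<dots> \<longleftrightarrow> mix_coc"
  proof -
    have "contr (msc N) q (V m a) = 0 \<longleftrightarrow> ?L q m a = ?R q m a" if "q \<in> vec DA" for q m a
      unfolding ct[OF that] by auto
    then show ?thesis unfolding mix_coc_def by blast
  qed
  finally show ?thesis unfolding D_def .
qed

end

context yd_two
begin

text \<open>The index of a total cochain counts arguments from \<open>A\<close>: entry 1 takes one
  such argument and has values in \<open>N\<close>, entry 0 takes none and has values in
  \<open>N\<close> tensor \<open>A\<close>.\<close>

definition omF :: "(nat \<Rightarrow> ('k, 'a, 'm, 'n) cochain) \<Rightarrow> 'a \<Rightarrow> 'm \<Rightarrow> 'n" where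
  "omF F a m = ct0 (F 1 (Q1 m a))"

definition laF :: "(nat \<Rightarrow> ('k, 'a, 'm, 'n) cochain) \<Rightarrow> ('a \<Rightarrow> 'k) \<Rightarrow> 'm \<Rightarrow> 'n" where
  "laF F q m = contr (msc N) q (F 0 (Q0 m))"

lemma le_one: "(\<forall>n\<le>(1::nat). P n) \<longleftrightarrow> P 0 \<and> P 1"
  by (auto simp: le_Suc_eq One_nat_def)

lemma tot_one: "F \<in> tot A M N 1 \<longleftrightarrow> F 0 \<in> Y A M N 0 1 \<and> F 1 \<in> Y A M N 1 0 \<and> (\<forall>n>1. F n = 0)"
  unfolding tot_def mem_Collect_eq le_one by simp

lemma klin_Q0: "klin_on (spM M) tscale Q0"
  using multilinear_tpure[of "spM M" "spA A" 0] by (simp add: multilinear0)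

lemma klin_Q1: "klin_on (spM M) tscale (\<lambda>m. Q1 m a)" "klin_on (spA A) tscale (\<lambda>a. Q1 m a)"
  by (simp_all add: tens2_def[symmetric] klin_tens2)

lemma Q_closed: "Q0 m \<in> TM 0" "Q1 m a \<in> TM 1"
  by (auto intro!: tpure_tens simp: tuples0 tuples1)

lemma cochain_data:
  assumes F: "F \<in> tot A M N 1"
  shows "ext_data A M N (omF F) (laF F)" "F 1 (Q1 m a) = P0 (omF F a m)"
    "F 0 (Q0 m) = (\<Sum>b\<in>basis. P1 (laF F (co b) m) b)"
proof -
  have Y: "F 0 \<in> Y A M N 0 1" "F 1 \<in> Y A M N 1 0" using F by (auto simp: tot_one)
  have k: "klin_on (tspace (spM M) (spA A) 0) tscale (F 0)" "klin_on (tspace (spM M) (spA A) 1) tscale (F 1)"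
    and c: "F 0 (Q0 m) \<in> TN 1" "F 1 (Q1 m a) \<in> TN 0" for m a
    using Y by (auto simp: Y_klin0 klin0_def Q_closed)
  have k0: "klin_on (spM M) tscale (\<lambda>m. F 0 (Q0 m))"
    by (rule klin_comp[OF k(1)]) (auto intro: klin_Q0 Q_closed)
  have k1: "klin_on (spM M) tscale (\<lambda>m. F 1 (Q1 m a))" "klin_on (spA A) tscale (\<lambda>a. F 1 (Q1 m a))" for m a
    by (rule klin_comp[OF k(2)], auto intro: klin_Q1 Q_closed)+
  have wN: "lin (msc M) (msc N) g" if "klin_on (spM M) (msc N) g" for g
    using that unfolding M.spM_whole by (rule klin_lin[OF M.vector_space_M N.vector_space_M])
  show "ext_data A M N (omF F) (laF F)"
  proof (intro ext_data.intro yd_two_axioms ext_data_axioms.intro)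
    show "klin_on (spA A) (msc N) (\<lambda>a. omF F a m)" for m
      unfolding omF_def by (rule klin_comp_lin[OF ct0_lin k1(2)])
    show "lin (msc M) (msc N) (omF F a)" for a
      by (rule wN) (unfold omF_def, rule klin_comp_lin[OF ct0_lin k1(1)])
    show "klin_on DA (msc N) (\<lambda>q. laF F q m)" for m
      unfolding laF_def by (rule N.klin_contr[OF _ N.vector_space_M]) (use c in \<open>simp add: N.spM_whole\<close>)
    show "lin (msc M) (msc N) (laF F q)" if "q \<in> vec DA" for q
      by (rule wN) (unfold laF_def, rule klin_comp_lin[OF N.contr_linM[OF that] k0])
  qed
  show "F 1 (Q1 m a) = P0 (omF F a m)" unfolding omF_def by (rule P0_ct0[OF c(2), symmetric])
  show "F 0 (Q0 m) = (\<Sum>b\<in>basis. P1 (laF F (co b) m) b)"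
    unfolding laF_def by (rule tens2_expand[OF N.vector_space_M, folded N.spM_whole, OF c(1)])
qed

text \<open>The components 0, 1 and 2 of the differential give the conditions on
  \<open>laF F\<close>, on the pair and on \<open>omF F\<close>; the higher components
  vanish.\<close>

lemma cocycle_iff:
  assumes F: "F \<in> tot A M N 1"
  shows "F \<in> tot_cocycles A M N 1 \<longleftrightarrow>
    ext_data.act_coc M N (omF F) \<and> ext_data.dual_coc A M N (laF F) \<and> ext_data.mix_coc A M N (omF F) (laF F)"
proof -
  interpret E: ext_data A M N "omF F" "laF F" by (rule cochain_data(1)[OF F])
  have f0: "F 0 \<in> klin0 0" using F by (simp add: tot_one Y_klin0)
  have t1: "tscale 1 x = x" for x :: "('k, 'n, 'a) tensor" by (auto simp: tscale_def)
  have d: "d_tot A M N 1 F 0 = d_c A M N 0 1 (F 0)"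
    "d_tot A M N 1 F 1 = d_m A M N 0 1 (F 0) + (\<lambda>t. tscale (- 1) (d_c A M N 1 0 (F 1) t))"
    "d_tot A M N 1 F 2 = d_m A M N 1 0 (F 1)" "n > 2 \<Longrightarrow> d_tot A M N 1 F n = 0" for n
    by (simp_all add: d_tot_def t1 One_nat_def)
  have all: "(\<forall>n. P n) \<longleftrightarrow> P 0 \<and> P 1 \<and> P 2 \<and> (\<forall>n>2. P n)" for P :: "nat \<Rightarrow> bool"
  proof -
    have "n = 0 \<or> n = 1 \<or> n = 2 \<or> n > 2" for n :: nat by arith
    then show ?thesis by metis
  qed
  have "d_tot A M N 1 F = 0 \<longleftrightarrow> (\<forall>n. d_tot A M N 1 F n = 0)"
  proof
    assume "\<forall>n. d_tot A M N 1 F n = 0"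
    then show "d_tot A M N 1 F = 0" unfolding zero_fun_def[where 'a=nat] by - (rule ext, blast)
  next
    assume "d_tot A M N 1 F = 0"
    then show "\<forall>n. d_tot A M N 1 F n = 0" by (simp only: zero_fun_apply simp_thms)
  qed
  also have "\<dots> \<longleftrightarrow> E.dual_coc \<and> E.mix_coc \<and> E.act_coc"
    unfolding all[of "\<lambda>n. d_tot A M N 1 F n = 0"] d(1-3) E.dc_iff_dual_coc[OF f0 cochain_data(3)[OF F]]
      E.mixed_iff_mix_coc[OF cochain_data(3)[OF F] cochain_data(2)[OF F]] E.dm_iff_act_coc[OF cochain_data(2)[OF F]]
    using d(4) by auto
  finally show ?thesis using F by (auto simp: tot_cocycles_def)
qed

lemma cochain_eqI:
  assumes F: "F \<in> tot A M N 1" and G: "G \<in> tot A M N 1"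
    and om: "\<And>a m. omF F a m = omF G a m" and la: "\<And>q m. q \<in> vec DA \<Longrightarrow> laF F q m = laF G q m"
  shows "F = G"
proof
  fix n :: nat
  have 0: "F 0 = G 0"
    using F G by (intro klin0_ext(1)) (auto simp: tot_one Y_klin0 cochain_data(3)[OF F] cochain_data(3)[OF G] la co_dual)
  have 1: "F 1 = G 1"
    using F G by (intro klin0_ext(2)) (auto simp: tot_one Y_klin0 cochain_data(2)[OF F] cochain_data(2)[OF G] om)
  have "n = 0 \<or> n = 1 \<or> n > 1" by arith
  then show "F n = G n" using F G 0 1 by (auto simp: tot_one)
qed

text \<open>The cochain belonging to \<open>la\<close> sends \<open>m\<close> to the sum of
  \<open>la (co b) m\<close> tensor \<open>b\<close>, from which only the values of
  \<open>la\<close> on linear functionals can be read back.\<close>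

lemma cochain_exists:
  assumes "ext_data A M N om la"
  shows "\<exists>F\<in>tot A M N 1. (\<forall>a m. omF F a m = om a m) \<and> (\<forall>q\<in>vec DA. \<forall>m. laF F q m = la q m)"
proof -
  interpret E: ext_data A M N om la by (rule assms)
  define f1 where "f1 = ext_mult A M 1 (\<lambda>(m, as). P0 (om (hd as) m))"
  define f0 where "f0 = ext_mult A M 0 (\<lambda>(m, as :: 'a list). \<Sum>b\<in>basis. P1 (la (co b) m) b)"
  have f1: "f1 \<in> klin0 1 \<and> (\<forall>m a. f1 (Q1 m a) = P0 (om a m))"
    unfolding f1_def by (rule ext_mult1) (simp, (intro E.pklins)+)
  have f0: "f0 \<in> klin0 0 \<and> (\<forall>m. f0 (Q0 m) = (\<Sum>b\<in>basis. P1 (la (co b) m) b))"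
    unfolding f0_def by (rule ext_mult0) (simp, (intro E.pklins)+)
  define F where "F = (\<lambda>n::nat. if n = 0 then f0 else if n = 1 then f1 else 0)"
  have Fn: "F 0 = f0" "F 1 = f1" "n > 1 \<Longrightarrow> F n = 0" for n by (auto simp: F_def)
  have "F \<in> tot A M N 1"
    unfolding tot_one Fn using f0 f1 by (auto intro!: Y_closed tens_sum simp: tuples0 tuples1 Fn)
  moreover have "omF F a m = om a m" for a m using f1 by (simp add: omF_def Fn)
  moreover have "laF F q m = la q m" if "q \<in> vec DA" for q m
    using f0 that by (simp add: laF_def Fn E.contr_P1 E.la_sum)
  ultimately show ?thesis by blast
qed

lemma tot_diff: assumes F: "F \<in> tot A M N 1" and G: "G \<in> tot A M N 1"
  shows "F - G \<in> tot A M N 1" "omF (F - G) a m = omF F a m - omF G a m"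
    "q \<in> vec DA \<Longrightarrow> laF (F - G) q m = laF F q m - laF G q m"
proof -
  show "F - G \<in> tot A M N 1"
    using F G by (auto simp: tot_one Y_klin0 intro: klin0_diff tens_diff)
  interpret C: Vector_Spaces.linear tscale "msc N" ct0 by (rule ct0_lin)
  show "omF (F - G) a m = omF F a m - omF G a m" by (simp add: omF_def C.diff)
  show "laF (F - G) q m = laF F q m - laF G q m" if "q \<in> vec DA"
  proof -
    interpret C: Vector_Spaces.linear tscale "msc N" "contr (msc N) q" by (rule N.contr_linM[OF that])
    show ?thesis by (simp add: laF_def C.diff)
  qed
qed

lemma tot_zero_mem: "0 \<in> tot A M N r"
  by (auto simp: tot_def Y_klin0 klin0_zero tens_zero)

text \<open>All three conditions are linear in the pair of maps. Negatives and sums are later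
  obtained from differences and zero.\<close>

lemma cocycle_diff:
  assumes F: "F \<in> tot_cocycles A M N 1" and G: "G \<in> tot_cocycles A M N 1"
  shows "F - G \<in> tot_cocycles A M N 1"
proof -
  have t: "F \<in> tot A M N 1" "G \<in> tot A M N 1" using F G by (auto simp: tot_cocycles_def)
  interpret F: ext_data A M N "omF F" "laF F" by (rule cochain_data(1)[OF t(1)])
  interpret G: ext_data A M N "omF G" "laF G" by (rule cochain_data(1)[OF t(2)])
  interpret D: ext_data A M N "omF (F - G)" "laF (F - G)" by (rule cochain_data(1)[OF tot_diff(1)[OF t]])
  have cF: "F.act_coc" "F.dual_coc" "F.mix_coc" and cG: "G.act_coc" "G.dual_coc" "G.mix_coc"
    using cocycle_iff[OF t(1)] cocycle_iff[OF t(2)] F G by auto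
  have Nd: "act N a (x - y) = act N a x - act N a y" "q \<in> vec DA \<Longrightarrow> N.dM q (x - y) = N.dM q x - N.dM q y" for a q x y
    using N.act_linear_right[of a] N.dM_lin[of q] Vector_Spaces.linear.axioms(3)[THEN module_hom.diff] by blast+
  have df: "SW (msc N) (\<lambda>x y. \<phi> x y - \<psi> x y) a = SW (msc N) \<phi> a - SW (msc N) \<psi> a" for \<phi> \<psi> a
    using SW_add[OF N.vector_space_M, of "\<lambda>x y. \<phi> x y - \<psi> x y" \<psi> a] by (simp add: algebra_simps)
  have "D.act_coc"
    using cF(1) cG(1) unfolding D.act_coc_def F.act_coc_def G.act_coc_def by (simp add: tot_diff[OF t] Nd)
  moreover have "D.dual_coc"
    using cF(2) cG(2) unfolding D.dual_coc_def F.dual_coc_def G.dual_coc_def by (simp add: tot_diff[OF t] Nd)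
  moreover have "D.mix_coc"
    unfolding D.mix_coc_def
  proof (intro allI ballI)
    fix a m q assume q: "q \<in> vec DA"
    have r: "(x - x') + (y - y') = (x + y) - (x' + (y'::'n))" for x x' y y' by simp
    show "SW (msc N) (\<lambda>a1 a2. N.dM (\<lambda>z. q (z * a1)) (omF (F - G) a2 m) + laF (F - G) (\<lambda>z. q (z * a1)) (act M a2 m)) a =
      SW (msc N) (\<lambda>a1 a2. act N a1 (laF (F - G) (\<lambda>z. q (a2 * z)) m) + omF (F - G) a1 (M.dM (\<lambda>z. q (a2 * z)) m)) a"
      using cF(3) cG(3) q unfolding F.mix_coc_def G.mix_coc_def
      by (simp only: tot_diff[OF t] Nd F.E.mult_dual q r df)
  qed
  ultimately show ?thesis using cocycle_iff[OF tot_diff(1)[OF t]] by blast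
qed

section \<open>Cochains of degree zero and coboundaries\<close>

lemma degree_zero_maps:
  assumes f: "lin (msc M) (msc N) f" and gQ: "\<And>m. g (Q0 m) = P0 (f m)"
  shows "b_map A M N 0 0 0 g \<in> klin0 1 \<and> (\<forall>m a. b_map A M N 0 0 0 g (Q1 m a) = P0 (act N a (f m)))"
    and "b_map A M N 0 0 1 g \<in> klin0 1 \<and> (\<forall>m a. b_map A M N 0 0 1 g (Q1 m a) = P0 (f (act M a m)))"
    and "c_map A M N 0 0 0 g \<in> klin0 0 \<and> (\<forall>m. c_map A M N 0 0 0 g (Q0 m) = (\<Sum>b\<in>basis. P1 (N.dM (co b) (f m)) b))"
    and "c_map A M N 0 0 1 g \<in> klin0 0 \<and> (\<forall>m. c_map A M N 0 0 1 g (Q0 m) = (\<Sum>b\<in>basis. P1 (f (M.dM (co b) m)) b))"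
proof -
  note k = klin_P0 N.klin_tens2M M.mklins N.mklins vector_space_tscale klin_comp_lin[OF f]
  have t: "lN 0 tscale (\<lambda>(v, vs). pN 0 (act N x v, map2 (*) [] vs)) (g (Q0 m)) = P0 (act N x (f m))"
    "lN 0 tscale (\<lambda>(v, vs). pN 0 (v, map2 (*) vs [])) (g (Q0 m)) = P0 (f m)" for x m
    unfolding gQ by (subst tlift0(2), auto intro!: k)+
  have e: "sw_iter A 1 tscale (\<lambda>hs. lN 0 tscale (\<lambda>(v, vs). pN 0 (act N (hd hs) v, map2 (*) (tl hs) vs)) (g (Q0 m))) a
     = P0 (act N a (f m))" for m a
    by (subst sw_iter1[OF vector_space_tscale]) (auto simp: t[simplified] intro!: k)
  have e': "sw_iter A 1 tscale (\<lambda>hs. lN 0 tscale (\<lambda>(v, vs). pN 0 (v, map2 (*) vs (butlast hs))) (g (Q0 (act M (last hs) m)))) a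
     = P0 (f (act M a m))" for m a
    by (subst sw_iter1[OF vector_space_tscale]) (auto simp: t[simplified] intro!: k)
  have i: "((1::nat) = 0) = False" "((1::nat) \<le> 0) = False" by auto
  show "b_map A M N 0 0 0 g \<in> klin0 1 \<and> (\<forall>m a. b_map A M N 0 0 0 g (Q1 m a) = P0 (act N a (f m)))"
    unfolding b_map_def simp_thms if_True add_0
    by (rule ext_mult1) (simp add: e, (intro k)+)
  show "b_map A M N 0 0 1 g \<in> klin0 1 \<and> (\<forall>m a. b_map A M N 0 0 1 g (Q1 m a) = P0 (f (act M a m)))"
    unfolding b_map_def i if_False add_0
    by (rule ext_mult1) (simp add: e', (intro k)+)
  have w: "swm A N tscale (\<lambda>v0 v1. pN 1 (v0, [v1])) v = (\<Sum>b\<in>basis. P1 (N.dM (co b) v) b)" for v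
    unfolding P1_tpure by (rule swm_N) (intro k)+
  have u: "lN 0 tscale (\<lambda>(v, vs). swm A N tscale (\<lambda>v0 v1. pN 1 (v0, v1 # vs)) v) (g (Q0 m))
       = (\<Sum>b\<in>basis. P1 (N.dM (co b) (f m)) b)" for m
    unfolding gQ by (subst tlift0(2)) (auto simp: w intro!: k)
  show "c_map A M N 0 0 0 g \<in> klin0 0 \<and> (\<forall>m. c_map A M N 0 0 0 g (Q0 m) = (\<Sum>b\<in>basis. P1 (N.dM (co b) (f m)) b))"
    unfolding c_map_def simp_thms if_True add_0
    by (rule ext_mult0) (simp add: u, (intro k)+)
  have t': "lN 0 tscale (\<lambda>(v, vs). pN 1 (v, vs @ [y])) (g (Q0 m)) = P1 (f m) y" for y m
    unfolding gQ by (subst tlift0(2)) (auto simp: P1_tpure intro!: k)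
  have w': "swm A M tscale (\<lambda>m0 m1. lN 0 tscale (\<lambda>(v, vs). pN 1 (v, vs @ [m1])) (g (Q0 m0))) m
      = (\<Sum>b\<in>basis. P1 (f (M.dM (co b) m)) b)" for m
    unfolding t' by (rule swm_M) (intro k)+
  show "c_map A M N 0 0 1 g \<in> klin0 0 \<and> (\<forall>m. c_map A M N 0 0 1 g (Q0 m) = (\<Sum>b\<in>basis. P1 (f (M.dM (co b) m)) b))"
    unfolding c_map_def i if_False add_0
    by (rule ext_mult0) (simp add: w', (intro k)+)
qed

lemma d_tot_zero:
  assumes G: "G \<in> tot A M N 0" and f: "lin (msc M) (msc N) f" and gQ: "\<And>m. G 0 (Q0 m) = P0 (f m)"
  shows "d_tot A M N 0 G \<in> tot A M N 1" "omF (d_tot A M N 0 G) a m = act N a (f m) - f (act M a m)"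
    "q \<in> vec DA \<Longrightarrow> laF (d_tot A M N 0 G) q m = N.dM q (f m) - f (M.dM q m)"
proof -
  note dz = degree_zero_maps[OF f, of "G 0", OF gQ]
  have t1: "tscale 1 x = x" for x :: "('k, 'n, 'a) tensor" by (auto simp: tscale_def)
  have d: "d_tot A M N 0 G 0 = c_map A M N 0 0 0 (G 0) - c_map A M N 0 0 1 (G 0)"
    "d_tot A M N 0 G 1 = b_map A M N 0 0 0 (G 0) - b_map A M N 0 0 1 (G 0)" "n > 1 \<Longrightarrow> d_tot A M N 0 G n = 0" for n
    by (auto simp: d_tot_def t1 d_expand fun_eq_iff)
  show "d_tot A M N 0 G \<in> tot A M N 1"
    unfolding tot_one d using dz d(3)
    by (auto intro!: Y_closed klin0_diff tens_diff tens_sum simp: tuples0 tuples1)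
  interpret C: Vector_Spaces.linear tscale "msc N" ct0 by (rule ct0_lin)
  show "omF (d_tot A M N 0 G) a m = act N a (f m) - f (act M a m)"
    unfolding omF_def d using dz by (simp add: C.diff)
  show "laF (d_tot A M N 0 G) q m = N.dM q (f m) - f (M.dM q m)" if q: "q \<in> vec DA"
  proof -
    interpret C: Vector_Spaces.linear tscale "msc N" "contr (msc N) q" by (rule N.contr_linM[OF q])
    have e: "contr (msc N) q (\<Sum>b\<in>basis. P1 (x b) b) = (\<Sum>b\<in>basis. msc N (q b) (x b))" for x
      by (simp add: lin_sum[OF N.contr_linM[OF q]] N.contrM q)
    have "(\<Sum>b\<in>basis. msc N (q b) (f (M.dM (co b) m))) = f (M.dM q m)"
      using f by (simp add: M.dM_sum[OF q, of m] lin_sum[OF f] lin_iff)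
    then show ?thesis
      unfolding laF_def d using dz by (simp add: C.diff e N.dM_sum[OF q, symmetric])
  qed
qed

text \<open>In degree zero both tensor powers of \<open>A\<close> are trivial, so a cochain amounts
  to a linear map from \<open>M\<close> to \<open>N\<close>.\<close>

lemma tot_zero_data:
  assumes G: "G \<in> tot A M N 0"
  obtains f where "lin (msc M) (msc N) f" "\<And>m. G 0 (Q0 m) = P0 (f m)"
proof
  have Y: "G 0 \<in> Y A M N 0 0" using G by (simp add: tot_def)
  have k: "klin_on (tspace (spM M) (spA A) 0) tscale (G 0)" and c: "G 0 (Q0 m) \<in> TN 0" for m
    using Y by (auto simp: Y_klin0 klin0_def Q_closed)
  have "klin_on (spM M) tscale (\<lambda>m. G 0 (Q0 m))"
    by (rule klin_comp[OF k]) (auto intro: klin_Q0 Q_closed)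
  then have "klin_on (spM M) (msc N) (\<lambda>m. ct0 (G 0 (Q0 m)))"
    by (rule klin_comp_lin[OF ct0_lin])
  then show "lin (msc M) (msc N) (\<lambda>m. ct0 (G 0 (Q0 m)))"
    unfolding M.spM_whole by (rule klin_lin[OF M.vector_space_M N.vector_space_M])
  show "G 0 (Q0 m) = P0 (ct0 (G 0 (Q0 m)))" for m by (rule P0_ct0[OF c, symmetric])
qed

lemma coboundary_tot: assumes "F \<in> tot_coboundaries A M N 1" shows "F \<in> tot A M N 1"
proof -
  obtain G where G: "G \<in> tot A M N 0" "F = d_tot A M N 0 G" using assms by (auto simp: tot_coboundaries_def)
  obtain f where f: "lin (msc M) (msc N) f" "\<And>m. G 0 (Q0 m) = P0 (f m)"
    by (rule tot_zero_data[OF G(1)]) blast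
  show ?thesis unfolding G(2) by (rule d_tot_zero(1)[OF G(1) f])
qed

text \<open>For the converse a degree zero cochain is built from \<open>f\<close>. Its differential
  has the same \<open>omF\<close> and \<open>laF\<close>, and these determine a cochain.\<close>

lemma coboundary_iff:
  assumes F: "F \<in> tot A M N 1"
  shows "F \<in> tot_coboundaries A M N 1 \<longleftrightarrow> (\<exists>f. lin (msc M) (msc N) f \<and>
    (\<forall>a m. omF F a m = act N a (f m) - f (act M a m)) \<and> (\<forall>q\<in>vec DA. \<forall>m. laF F q m = N.dM q (f m) - f (M.dM q m)))"
    (is "_ \<longleftrightarrow> ?R")
proof
  assume "F \<in> tot_coboundaries A M N 1"
  then obtain G where G: "G \<in> tot A M N 0" "F = d_tot A M N 0 G" by (auto simp: tot_coboundaries_def)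
  obtain f where f: "lin (msc M) (msc N) f" "\<And>m. G 0 (Q0 m) = P0 (f m)"
    by (rule tot_zero_data[OF G(1)]) blast
  show ?R using f(1) d_tot_zero(2,3)[OF G(1) f] unfolding G(2) by blast
next
  assume ?R
  then obtain f where f: "lin (msc M) (msc N) f" "\<And>a m. omF F a m = act N a (f m) - f (act M a m)"
    "\<And>q m. q \<in> vec DA \<Longrightarrow> laF F q m = N.dM q (f m) - f (M.dM q m)" by blast
  define g where "g = ext_mult A M 0 (\<lambda>(m, as :: 'a list). P0 (f m))"
  have g: "g \<in> klin0 0 \<and> (\<forall>m. g (Q0 m) = P0 (f m))"
    unfolding g_def by (rule ext_mult0) (simp, (intro klin_P0 klin_comp_lin[OF f(1)] M.klin_idM)+)
  define G where "G = (\<lambda>n::nat. if n = 0 then g else 0)"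
  have Gn: "G 0 = g" "n > 0 \<Longrightarrow> G n = 0" for n by (auto simp: G_def)
  have G: "G \<in> tot A M N 0"
    using g by (auto simp: tot_def Gn intro!: Y_closed simp: tuples0)
  have gQ: "G 0 (Q0 m) = P0 (f m)" for m using g by (simp add: Gn)
  note d = d_tot_zero[OF G f(1) gQ]
  have "F = d_tot A M N 0 G"
    by (rule cochain_eqI[OF F d(1)]) (simp_all add: d f)
  then show "F \<in> tot_coboundaries A M N 1" using G by (simp add: tot_coboundaries_def)
qed

end

section \<open>Ext by cocycles\<close>

text \<open>As a simplification rule, \<open>plus_fun_apply\<close> eta-expands sums of functions.\<close>

declare plus_fun_apply [simp del]

text \<open>For maps that are additive only on a part \<open>C\<close> of the type, such as the
  carrier of a module.\<close>

lemma sum_additive: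
  assumes "\<And>a b. a \<in> C \<Longrightarrow> b \<in> C \<Longrightarrow> f (a + b) = f a + f b" "0 \<in> C" "\<And>a b. a \<in> C \<Longrightarrow> b \<in> C \<Longrightarrow> a + b \<in> C"
    and "\<And>i. i \<in> I \<Longrightarrow> x i \<in> C"
  shows "(\<Sum>i\<in>I. x i) \<in> C \<and> f (\<Sum>i\<in>I. x i) = (\<Sum>i\<in>I. f (x i) :: 'b::ab_group_add)"
proof -
  have f0: "f 0 = 0" using assms(1)[OF assms(2,2)] by simp
  show ?thesis using assms(4)
    by (induction I rule: infinite_finite_induct) (auto simp: f0 assms(2) intro: assms(3) simp: assms(1))
qed

text \<open>A finitely supported function \<open>f\<close> stands for the formal sum of the \<open>f x\<close> times \<open>x\<close>.\<close>

definition fsum :: "('r::zero \<Rightarrow> 'x \<Rightarrow> 'y::ab_group_add) \<Rightarrow> ('x \<Rightarrow> 'r) \<Rightarrow> 'y" where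
  "fsum \<chi> f = (\<Sum>x | f x \<noteq> 0. \<chi> (f x) x)"

definition single :: "'x \<Rightarrow> 'r::zero \<Rightarrow> 'x \<Rightarrow> 'r" where
  "single x r = (\<lambda>y. if y = x then r else 0)"

lemma fsum_superset:
  assumes "finite T" "{x. f x \<noteq> 0} \<subseteq> T" "\<And>x. x \<in> T \<Longrightarrow> \<chi> 0 x = 0"
  shows "fsum \<chi> f = (\<Sum>x\<in>T. \<chi> (f x) x)"
  unfolding fsum_def by (rule sum.mono_neutral_left) (use assms in auto)

lemma fsum_single: "\<chi> 0 x = 0 \<Longrightarrow> fsum \<chi> (single x r) = \<chi> r x"
  by (subst fsum_superset[of "{x}"]) (auto simp: single_def)

text \<open>The addition is required to be that of the type, so that ordinary finite sums can be
  used. The carrier remains a subset because the double is a set of tensors inside a function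
  type.\<close>

locale lring =
  fixes R :: "('r::ab_group_add) ring"
  assumes zero_R [simp]: "zero R = 0" and add_R [simp]: "add R = (+)"
    and R_zero [simp]: "0 \<in> carrier R" and R_add [simp]: "r \<in> carrier R \<Longrightarrow> t \<in> carrier R \<Longrightarrow> r + t \<in> carrier R"
    and R_minus [simp]: "r \<in> carrier R \<Longrightarrow> - r \<in> carrier R"
    and R_mult [simp]: "r \<in> carrier R \<Longrightarrow> t \<in> carrier R \<Longrightarrow> mult R r t \<in> carrier R"
    and R_one [simp]: "one R \<in> carrier R"
    and R_assoc: "r \<in> carrier R \<Longrightarrow> t \<in> carrier R \<Longrightarrow> u \<in> carrier R \<Longrightarrow> mult R (mult R r t) u = mult R r (mult R t u)"
    and R_dist1: "r \<in> carrier R \<Longrightarrow> t \<in> carrier R \<Longrightarrow> u \<in> carrier R \<Longrightarrow> mult R (r + t) u = mult R r u + mult R t u"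
    and R_dist2: "r \<in> carrier R \<Longrightarrow> t \<in> carrier R \<Longrightarrow> u \<in> carrier R \<Longrightarrow> mult R r (t + u) = mult R r t + mult R r u"
    and R_one_left [simp]: "r \<in> carrier R \<Longrightarrow> mult R (one R) r = r"
    and R_one_right [simp]: "r \<in> carrier R \<Longrightarrow> mult R r (one R) = r"

locale lmod = lring R for R :: "('r::ab_group_add) ring" +
  fixes P :: "('r, 'p::ab_group_add) module"
  assumes zero_P [simp]: "zero P = 0" and add_P [simp]: "add P = (+)"
    and P_zero [simp]: "0 \<in> carrier P" and P_add [simp]: "x \<in> carrier P \<Longrightarrow> y \<in> carrier P \<Longrightarrow> x + y \<in> carrier P"
    and P_minus [simp]: "x \<in> carrier P \<Longrightarrow> - x \<in> carrier P"
    and P_smult [simp]: "r \<in> carrier R \<Longrightarrow> x \<in> carrier P \<Longrightarrow> smult P r x \<in> carrier P"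
    and P_assoc: "r \<in> carrier R \<Longrightarrow> t \<in> carrier R \<Longrightarrow> x \<in> carrier P \<Longrightarrow> smult P (mult R r t) x = smult P r (smult P t x)"
    and P_dist1: "r \<in> carrier R \<Longrightarrow> t \<in> carrier R \<Longrightarrow> x \<in> carrier P \<Longrightarrow> smult P (r + t) x = smult P r x + smult P t x"
    and P_dist2: "r \<in> carrier R \<Longrightarrow> x \<in> carrier P \<Longrightarrow> y \<in> carrier P \<Longrightarrow> smult P r (x + y) = smult P r x + smult P r y"
    and P_one [simp]: "x \<in> carrier P \<Longrightarrow> smult P (one R) x = x"

section \<open>Free modules and their evaluation maps\<close>

context lring
begin

abbreviation Fr where "Fr X \<equiv> free_left_module R X"

lemma Fr_carrier: "f \<in> carrier (Fr X) \<longleftrightarrow> (\<forall>x\<in>X. f x \<in> carrier R) \<and> (\<forall>x. x \<notin> X \<longrightarrow> f x = 0) \<and> finite {x. f x \<noteq> 0}"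
  by (simp add: free_left_module_def)

lemma Fr_val: "f \<in> carrier (Fr X) \<Longrightarrow> f x \<in> carrier R"
  by (cases "x \<in> X") (auto simp: Fr_carrier)

lemma Fr_supp: "f \<in> carrier (Fr X) \<Longrightarrow> f x \<noteq> 0 \<Longrightarrow> x \<in> X"
  and Fr_finite: "f \<in> carrier (Fr X) \<Longrightarrow> finite {x. f x \<noteq> 0}"
  by (auto simp: Fr_carrier)

lemma R_mult_zero [simp]: "r \<in> carrier R \<Longrightarrow> mult R r 0 = 0"
  using R_dist2[of r 0 0] by simp

lemma Fr_smult: "smult (Fr X) r f x = mult R r (f x)"
  by (simp add: free_left_module_def)

lemma Fr_add_mem: "f \<in> carrier (Fr X) \<Longrightarrow> g \<in> carrier (Fr X) \<Longrightarrow> f + g \<in> carrier (Fr X)"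
proof -
  assume f: "f \<in> carrier (Fr X)" and g: "g \<in> carrier (Fr X)"
  have "{x. (f + g) x \<noteq> 0} \<subseteq> {x. f x \<noteq> 0} \<union> {x. g x \<noteq> 0}" by (auto simp: plus_fun_apply)
  then have "finite {x. (f + g) x \<noteq> 0}" by (rule finite_subset) (use f g in \<open>auto simp: Fr_carrier\<close>)
  then show ?thesis using f g by (simp add: Fr_carrier plus_fun_apply)
qed

lemma lmod_Fr: "lmod R (Fr X)"
proof (intro lmod.intro lring_axioms lmod_axioms.intro)
  show "zero (Fr X) = 0" "add (Fr X) = (+)" by (simp_all add: free_left_module_def zero_fun_def fun_eq_iff plus_fun_apply)
  show "0 \<in> carrier (Fr X)" by (simp add: Fr_carrier)
  show "- x \<in> carrier (Fr X)" if "x \<in> carrier (Fr X)" for x using that by (simp add: Fr_carrier)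
  show "smult (Fr X) r x \<in> carrier (Fr X)" if r: "r \<in> carrier R" and x: "x \<in> carrier (Fr X)" for r x
  proof -
    have "{y. smult (Fr X) r x y \<noteq> 0} \<subseteq> {y. x y \<noteq> 0}" using r by (auto simp: Fr_smult)
    then have "finite {y. smult (Fr X) r x y \<noteq> 0}" by (rule finite_subset) (use x in \<open>auto simp: Fr_carrier\<close>)
    then show ?thesis using r x by (simp add: Fr_carrier Fr_smult)
  qed
qed (auto intro!: Fr_add_mem simp: Fr_smult fun_eq_iff plus_fun_apply R_assoc R_dist1 R_dist2 Fr_val)

lemma single_mem: "x \<in> X \<Longrightarrow> r \<in> carrier R \<Longrightarrow> single x r \<in> carrier (Fr X)"
  by (auto simp: Fr_carrier single_def)

lemma smult_single: "r \<in> carrier R \<Longrightarrow> t \<in> carrier R \<Longrightarrow> smult (Fr X) r (single x t) = single x (mult R r t)"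
  by (auto simp: Fr_smult single_def fun_eq_iff)

lemma fsum_add:
  assumes \<chi>: "\<And>x r t. x \<in> X \<Longrightarrow> r \<in> carrier R \<Longrightarrow> t \<in> carrier R \<Longrightarrow> \<chi> (r + t) x = \<chi> r x + \<chi> t x"
    and f: "f \<in> carrier (Fr X)" and g: "g \<in> carrier (Fr X)"
  shows "fsum \<chi> (f + g) = fsum \<chi> f + fsum \<chi> g"
proof -
  have z: "\<chi> 0 x = 0" if "x \<in> X" for x using \<chi>[OF that, of 0 0] by simp
  let ?T = "{x. f x \<noteq> 0} \<union> {x. g x \<noteq> 0}"
  have T: "finite ?T" "?T \<subseteq> X" using f g by (auto simp: Fr_carrier)
  have "fsum \<chi> h = (\<Sum>x\<in>?T. \<chi> (h x) x)" if "{x. h x \<noteq> 0} \<subseteq> ?T" for h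
    by (rule fsum_superset) (use T that z in auto)
  note e = this
  have "fsum \<chi> (f + g) = (\<Sum>x\<in>?T. \<chi> ((f + g) x) x)" by (rule e) (auto simp: plus_fun_apply)
  also have "\<dots> = (\<Sum>x\<in>?T. \<chi> (f x + g x) x)" by (simp add: plus_fun_apply)
  also have "\<dots> = (\<Sum>x\<in>?T. \<chi> (f x) x + \<chi> (g x) x)"
    by (rule sum.cong[OF refl], rule \<chi>) (use T Fr_val[OF f] Fr_val[OF g] in auto)
  also have "\<dots> = fsum \<chi> f + fsum \<chi> g" using e[OF Un_upper1] e[OF Un_upper2] by (simp add: sum.distrib)
  finally show ?thesis .
qed

text \<open>Multiplication by \<open>r\<close> may shrink the support. Keeping the sum over the old
  support allows module and cocycle identities to be applied term by term.\<close>

lemma fsum_smult: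
  assumes z: "\<And>x. x \<in> X \<Longrightarrow> \<chi> 0 x = 0" and f: "f \<in> carrier (Fr X)" and r: "r \<in> carrier R"
  shows "fsum \<chi> (smult (Fr X) r f) = (\<Sum>x | f x \<noteq> 0. \<chi> (mult R r (f x)) x)"
proof -
  have "{x. smult (Fr X) r f x \<noteq> 0} \<subseteq> {x. f x \<noteq> 0}" using r by (auto simp: Fr_smult)
  then have "fsum \<chi> (smult (Fr X) r f) = (\<Sum>x | f x \<noteq> 0. \<chi> (smult (Fr X) r f x) x)"
    by (intro fsum_superset z) (use f in \<open>auto simp: Fr_carrier\<close>)
  then show ?thesis by (simp only: Fr_smult)
qed

end

context lmod
begin

lemma smult_zero [simp]: "r \<in> carrier R \<Longrightarrow> smult P r 0 = 0" "x \<in> carrier P \<Longrightarrow> smult P 0 x = 0"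
  using P_dist2[of r 0 0] P_dist1[of 0 0 x] by simp_all

lemma smult_minus: "r \<in> carrier R \<Longrightarrow> x \<in> carrier P \<Longrightarrow> smult P r (- x) = - smult P r x"
  using P_dist2[of r x "- x"] by (simp add: add_eq_0_iff)

lemma P_diff: "x \<in> carrier P \<Longrightarrow> y \<in> carrier P \<Longrightarrow> x - y \<in> carrier P"
  using P_add[of x "- y"] by simp

lemma smult_diff: "r \<in> carrier R \<Longrightarrow> x \<in> carrier P \<Longrightarrow> y \<in> carrier P \<Longrightarrow> smult P r (x - y) = smult P r x - smult P r y"
  using P_dist2[of r x "- y"] by (simp add: smult_minus)

lemma abelian: "abelian_monoid P"
  by (rule abelian_monoidI) (auto simp: add.assoc add.commute)

lemma smult_sum: "r \<in> carrier R \<Longrightarrow> (\<And>i. i \<in> I \<Longrightarrow> x i \<in> carrier P) \<Longrightarrow>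
   (\<Sum>i\<in>I. x i) \<in> carrier P \<and> smult P r (\<Sum>i\<in>I. x i) = (\<Sum>i\<in>I. smult P r (x i))"
  by (rule sum_additive) (auto simp: P_dist2)

lemma finsum_sum:
  assumes "finite I" "\<And>i. i \<in> I \<Longrightarrow> f i \<in> carrier P"
  shows "finsum P f I = (\<Sum>i\<in>I. f i)"
  using assms
proof (induction I rule: finite_induct)
  case empty
  then show ?case using abelian_monoid.finsum_empty[OF abelian] by simp
next
  case (insert i I)
  then show ?case using abelian_monoid.finsum_insert[OF abelian, of I i f] by auto
qed

lemma Fr_suppP: "X \<subseteq> carrier P \<Longrightarrow> f \<in> carrier (Fr X) \<Longrightarrow> f x \<noteq> 0 \<Longrightarrow> x \<in> carrier P"
  using Fr_supp[of f X x] by blast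

lemma ev_fsum: assumes X: "X \<subseteq> carrier P" and f: "f \<in> carrier (Fr X)"
  shows "free_eval R P f = fsum (smult P) f"
  unfolding free_eval_def fsum_def zero_R
  by (rule finsum_sum) (use Fr_suppP[OF X f] Fr_val[OF f] Fr_finite[OF f] in auto)

lemma ev_mem: assumes X: "X \<subseteq> carrier P" and f: "f \<in> carrier (Fr X)" shows "free_eval R P f \<in> carrier P"
  unfolding ev_fsum[OF assms] fsum_def
  by (rule smult_sum[of 0, THEN conjunct1]) (use Fr_suppP[OF X f] Fr_val[OF f] Fr_finite[OF f] in auto)

lemma ev_add: assumes X: "X \<subseteq> carrier P" and f: "f \<in> carrier (Fr X)" and g: "g \<in> carrier (Fr X)"
  shows "free_eval R P (f + g) = free_eval R P f + free_eval R P g"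
  using fsum_add[of X "smult P", OF _ f g] X by (simp add: ev_fsum[OF X] f g Fr_add_mem P_dist1 subset_iff)

lemma ev_smult: assumes X: "X \<subseteq> carrier P" and f: "f \<in> carrier (Fr X)" and r: "r \<in> carrier R"
  shows "free_eval R P (smult (Fr X) r f) = smult P r (free_eval R P f)"
proof -
  interpret F: lmod R "Fr X" by (rule lmod_Fr)
  have "free_eval R P (smult (Fr X) r f) = (\<Sum>x | f x \<noteq> 0. smult P (mult R r (f x)) x)"
    unfolding ev_fsum[OF X F.P_smult[OF r f]] by (rule fsum_smult) (use X f r in \<open>auto simp: subset_iff\<close>)
  also have "\<dots> = (\<Sum>x | f x \<noteq> 0. smult P r (smult P (f x) x))"
    by (rule sum.cong) (use r Fr_suppP[OF X f] Fr_val[OF f] in \<open>auto simp: P_assoc\<close>)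
  also have "\<dots> = smult P r (\<Sum>x | f x \<noteq> 0. smult P (f x) x)"
    by (rule smult_sum[THEN conjunct2, symmetric]) (use r Fr_suppP[OF X f] Fr_val[OF f] Fr_finite[OF f] in auto)
  finally show ?thesis unfolding ev_fsum[OF X f] fsum_def .
qed

lemma ev_single: "X \<subseteq> carrier P \<Longrightarrow> x \<in> X \<Longrightarrow> r \<in> carrier R \<Longrightarrow> free_eval R P (single x r) = smult P r x"
  by (subst ev_fsum) (auto intro: single_mem simp: fsum_single subset_iff)

end

text \<open>The Ext side of the comparison uses only a \<open>k\<close>-algebra and two modules over
  it; the double enters as an instance at the end.\<close>

locale kalg_ext = lring R + M: lmod R M + N: lmod R N
  for R :: "('r::ab_group_add) ring" and M :: "('r, 'm::ab_group_add) module"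
    and N :: "('r, 'n::ab_group_add) module" +
  fixes sR :: "'k::field \<Rightarrow> 'r \<Rightarrow> 'r" and sM :: "'k \<Rightarrow> 'm \<Rightarrow> 'm" and sN :: "'k \<Rightarrow> 'n \<Rightarrow> 'n"
  assumes carrier_M [simp]: "carrier M = UNIV" and carrier_N [simp]: "carrier N = UNIV"
    and sR: "vector_space sR" and sM: "vector_space sM" and sN: "vector_space sN"
    and sR_mem [simp]: "r \<in> carrier R \<Longrightarrow> sR c r \<in> carrier R"
    and sR_left: "r \<in> carrier R \<Longrightarrow> t \<in> carrier R \<Longrightarrow> mult R (sR c r) t = sR c (mult R r t)"
    and sR_right: "r \<in> carrier R \<Longrightarrow> t \<in> carrier R \<Longrightarrow> mult R r (sR c t) = sR c (mult R r t)"
    and sM_left: "r \<in> carrier R \<Longrightarrow> smult M (sR c r) m = sM c (smult M r m)"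
    and sM_right: "r \<in> carrier R \<Longrightarrow> smult M r (sM c m) = sM c (smult M r m)"
    and sN_left: "r \<in> carrier R \<Longrightarrow> smult N (sR c r) n = sN c (smult N r n)"
begin

text \<open>Derivations of \<open>R\<close> with values in the \<open>k\<close>-linear maps from
  \<open>M\<close> to \<open>N\<close>; for the double this is \<open>dcocycle\<close>.\<close>

definition kcoc :: "('r \<Rightarrow> 'm \<Rightarrow> 'n) \<Rightarrow> bool" where
  "kcoc \<phi> \<longleftrightarrow> (\<forall>m. klin_on \<lparr>vec = carrier R, scl = sR\<rparr> sN (\<lambda>r. \<phi> r m)) \<and>
     (\<forall>r\<in>carrier R. lin sM sN (\<phi> r)) \<and>
     (\<forall>r\<in>carrier R. \<forall>t\<in>carrier R. \<forall>m. \<phi> (mult R r t) m = smult N r (\<phi> t m) + \<phi> r (smult M t m))"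

abbreviation "F0 \<equiv> res0 R M"
abbreviation "F1 \<equiv> res1 R M"
abbreviation "F2 \<equiv> res2 R M"
abbreviation "ev \<equiv> free_eval R M"
abbreviation "d1 \<equiv> free_eval R (res0 R M)"
abbreviation "d2 \<equiv> free_eval R (res1 R M)"
definition K where "K = {f \<in> carrier F0. ev f = 0}"
definition L where "L = {u \<in> carrier F1. d1 u = 0}"

sublocale F0: lmod R F0 unfolding res0_def by (rule lmod_Fr)
sublocale F1: lmod R F1 unfolding res1_def by (rule lmod_Fr)

lemma F0_eq: "F0 = Fr UNIV" by (simp add: res0_def)
lemma F1_eq: "F1 = Fr K" by (simp add: res1_def K_def)
lemma F2_eq: "F2 = Fr L" by (simp add: res2_def L_def)
lemma F_val:
  shows "x \<in> carrier F0 \<Longrightarrow> x m \<in> carrier R" and "u \<in> carrier F1 \<Longrightarrow> u x \<in> carrier R" and "w \<in> carrier F2 \<Longrightarrow> w u \<in> carrier R"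
  unfolding F0_eq F1_eq F2_eq by (rule Fr_val[of x _ m] Fr_val[of u _ x] Fr_val[of w _ u], assumption)+

lemma K_sub: "K \<subseteq> carrier F0" by (auto simp: K_def)
lemma L_sub: "L \<subseteq> carrier F1" by (auto simp: L_def)

lemmas ev_rules = M.ev_add[of UNIV, folded F0_eq, simplified] M.ev_smult[of UNIV, folded F0_eq, simplified]
lemmas d1_rules = F0.ev_add[OF K_sub, folded F1_eq] F0.ev_smult[OF K_sub, folded F1_eq] F0.ev_mem[OF K_sub, folded F1_eq]
lemmas d2_mem = F1.ev_mem[OF L_sub, folded F2_eq]

lemma ev_sum: "(\<And>i. i \<in> I \<Longrightarrow> x i \<in> carrier F0) \<Longrightarrow> ev (\<Sum>i\<in>I. x i) = (\<Sum>i\<in>I. ev (x i))"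
  by (rule sum_additive[where C = "carrier F0", THEN conjunct2]) (simp_all only: ev_rules F0.P_zero F0.P_add)

lemma d1_sum: "(\<And>i. i \<in> I \<Longrightarrow> x i \<in> carrier F1) \<Longrightarrow> d1 (\<Sum>i\<in>I. x i) = (\<Sum>i\<in>I. d1 (x i))"
  by (rule sum_additive[where C = "carrier F1", THEN conjunct2]) (simp_all only: d1_rules F1.P_zero F1.P_add)

lemma ev_d1: assumes u: "u \<in> carrier F1" shows "ev (d1 u) = 0"
proof -
  have x: "x \<in> carrier F0 \<and> ev x = 0" if "u x \<noteq> 0" for x
    using u that by (auto simp: F1_eq Fr_carrier K_def)
  have r: "u x \<in> carrier R" for x by (rule F_val(2)[OF u])
  have "d1 u = (\<Sum>x | u x \<noteq> 0. smult F0 (u x) x)"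
    using F0.ev_fsum[OF K_sub, folded F1_eq, OF u] by (simp add: fsum_def)
  then have "ev (d1 u) = (\<Sum>x | u x \<noteq> 0. ev (smult F0 (u x) x))"
    by (simp only:) (rule ev_sum, use x r in \<open>blast intro: F0.P_smult\<close>)
  also have "\<dots> = 0" by (rule sum.neutral) (use x r in \<open>simp add: ev_rules\<close>)
  finally show ?thesis .
qed

lemma d1_d2: assumes w: "w \<in> carrier F2" shows "d1 (d2 w) = 0"
proof -
  have x: "x \<in> carrier F1 \<and> d1 x = 0" if "w x \<noteq> 0" for x
    using w that by (auto simp: F2_eq Fr_carrier L_def)
  have r: "w x \<in> carrier R" for x by (rule F_val(3)[OF w])
  have "d2 w = (\<Sum>x | w x \<noteq> 0. smult F1 (w x) x)"
    using F1.ev_fsum[OF L_sub, folded F2_eq, OF w] by (simp add: fsum_def)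
  then have "d1 (d2 w) = (\<Sum>x | w x \<noteq> 0. d1 (smult F1 (w x) x))"
    by (simp only:) (rule d1_sum, use x r in \<open>blast intro: F1.P_smult\<close>)
  also have "\<dots> = 0" by (rule sum.neutral) (use x r in \<open>simp add: d1_rules\<close>)
  finally show ?thesis .
qed

lemma d1_K: "u \<in> carrier F1 \<Longrightarrow> d1 u \<in> K"
  by (simp add: K_def d1_rules ev_d1)

lemma single_F0: "r \<in> carrier R \<Longrightarrow> single m r \<in> carrier F0"
  unfolding F0_eq by (rule single_mem) auto

lemma single_F1: "x \<in> K \<Longrightarrow> r \<in> carrier R \<Longrightarrow> single x r \<in> carrier F1"
  unfolding F1_eq by (rule single_mem)

lemma ev_single0: "r \<in> carrier R \<Longrightarrow> ev (single m r) = smult M r m"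
  by (rule M.ev_single[of UNIV]) auto

lemma d1_single: "x \<in> K \<Longrightarrow> r \<in> carrier R \<Longrightarrow> d1 (single x r) = smult F0 r x"
  by (rule F0.ev_single[OF K_sub])

section \<open>Cocycles of the algebra as homomorphisms on syzygies\<close>

lemma kcoc_add: "kcoc \<phi> \<Longrightarrow> r \<in> carrier R \<Longrightarrow> t \<in> carrier R \<Longrightarrow> \<phi> (r + t) m = \<phi> r m + \<phi> t m"
  by (simp add: kcoc_def klin_on_def)

lemma kcoc_scale: "kcoc \<phi> \<Longrightarrow> r \<in> carrier R \<Longrightarrow> \<phi> (sR c r) m = sN c (\<phi> r m)"
  by (simp add: kcoc_def klin_on_def)

lemma kcoc_zero: "kcoc \<phi> \<Longrightarrow> \<phi> 0 m = 0"
  using kcoc_add[of \<phi> 0 0 m] by simp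

lemma kcoc_mult: "kcoc \<phi> \<Longrightarrow> r \<in> carrier R \<Longrightarrow> t \<in> carrier R \<Longrightarrow> \<phi> (mult R r t) m = smult N r (\<phi> t m) + \<phi> r (smult M t m)"
  by (simp add: kcoc_def)

lemma kcoc_lin: "kcoc \<phi> \<Longrightarrow> r \<in> carrier R \<Longrightarrow> lin sM sN (\<phi> r)"
  by (simp add: kcoc_def)

lemma kcoc_one: "kcoc \<phi> \<Longrightarrow> \<phi> (one R) m = 0"
  using kcoc_mult[of \<phi> "one R" "one R" m] by simp

lemma fsum_kcoc_add: "kcoc \<phi> \<Longrightarrow> x \<in> carrier F0 \<Longrightarrow> y \<in> carrier F0 \<Longrightarrow> fsum \<phi> (x + y) = fsum \<phi> x + fsum \<phi> y"
  by (rule fsum_add[of UNIV]) (auto simp: kcoc_add F0_eq)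

text \<open>By the cocycle identity, \<open>fsum \<phi>\<close> fails to be \<open>R\<close>-linear
  exactly by \<open>\<phi> r (ev x)\<close>, a term that vanishes on \<open>K\<close>.\<close>

lemma fsum_kcoc_smult: assumes \<phi>: "kcoc \<phi>" and r: "r \<in> carrier R" and x: "x \<in> carrier F0"
  shows "fsum \<phi> (smult F0 r x) = smult N r (fsum \<phi> x) + \<phi> r (ev x)"
proof -
  have v: "x m \<in> carrier R" for m by (rule F_val(1)[OF x])
  have "fsum \<phi> (smult F0 r x) = (\<Sum>m | x m \<noteq> 0. \<phi> (mult R r (x m)) m)"
    unfolding F0_eq by (rule fsum_smult) (use assms in \<open>auto simp: kcoc_zero F0_eq\<close>)
  also have "\<dots> = (\<Sum>m | x m \<noteq> 0. smult N r (\<phi> (x m) m)) + (\<Sum>m | x m \<noteq> 0. \<phi> r (smult M (x m) m))"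
    by (simp add: kcoc_mult[OF \<phi> r v] sum.distrib)
  also have "(\<Sum>m | x m \<noteq> 0. \<phi> r (smult M (x m) m)) = \<phi> r (ev x)"
    using lin_sum[OF kcoc_lin[OF \<phi> r], of "\<lambda>m. smult M (x m) m" "{m. x m \<noteq> 0}"] M.ev_fsum[of UNIV, folded F0_eq, OF _ x] by (simp add: fsum_def)
  also have "(\<Sum>m | x m \<noteq> 0. smult N r (\<phi> (x m) m)) = smult N r (fsum \<phi> x)"
    unfolding fsum_def by (rule N.smult_sum[OF r, THEN conjunct2, symmetric]) simp
  finally show ?thesis .
qed

text \<open>The homomorphism that \<open>\<phi>\<close> induces on the syzygy \<open>K\<close>,
  pulled back along \<open>F1 \<rightarrow> K\<close> so that it becomes an element of the Hom
  complex.\<close>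

definition Psi :: "('r \<Rightarrow> 'm \<Rightarrow> 'n) \<Rightarrow> (('m \<Rightarrow> 'r) \<Rightarrow> 'r) \<Rightarrow> 'n" where
  "Psi \<phi> = (\<lambda>u\<in>carrier F1. fsum \<phi> (d1 u))"

definition Z1 :: "((('m \<Rightarrow> 'r) \<Rightarrow> 'r) \<Rightarrow> 'n) set" where
  "Z1 = {h \<in> left_hom R F1 N. \<forall>f\<in>carrier F2. h (d2 f) = \<zero>\<^bsub>N\<^esub>}"

definition B1 :: "((('m \<Rightarrow> 'r) \<Rightarrow> 'r) \<Rightarrow> 'n) set" where
  "B1 = (\<lambda>h. \<lambda>x\<in>carrier F1. h (d1 x)) ` left_hom R F0 N"

lemma left_hom_iff: "h \<in> left_hom R P N \<longleftrightarrow> h \<in> carrier P \<rightarrow>\<^sub>E UNIV \<and>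
    (\<forall>x\<in>carrier P. \<forall>y\<in>carrier P. h (x + y) = h x + h y) \<and> (\<forall>r\<in>carrier R. \<forall>x\<in>carrier P. h (smult P r x) = smult N r (h x))"
  if "lmod R P"
proof -
  interpret P: lmod R P by fact
  show ?thesis by (simp add: left_hom_def)
qed

lemmas lh0 = left_hom_iff[OF F0.lmod_axioms]
lemmas lh1 = left_hom_iff[OF F1.lmod_axioms]

lemma Psi_Z1: assumes \<phi>: "kcoc \<phi>" shows "Psi \<phi> \<in> Z1"
proof -
  have z: "\<phi> r 0 = 0" if "r \<in> carrier R" for r
    using klin_zero[OF kclosed_whole lin_klin[OF kcoc_lin[OF \<phi> that]]] .
  have "Psi \<phi> (d2 f) = 0" if f: "f \<in> carrier F2" for f
    using d2_mem[OF f] by (simp add: Psi_def d1_d2[OF f]) (simp add: fsum_def)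
  moreover have "Psi \<phi> \<in> left_hom R F1 N"
    unfolding lh1 by (auto simp: Psi_def d1_rules fsum_kcoc_add[OF \<phi>] fsum_kcoc_smult[OF \<phi>] ev_d1 z)
  ultimately show ?thesis by (simp add: Z1_def)
qed

text \<open>The homomorphism on the free module \<open>F0\<close> with
  \<open>[m] \<mapsto> f m\<close>, for an arbitrary function \<open>f\<close>.\<close>

definition fext :: "('m \<Rightarrow> 'n) \<Rightarrow> ('m \<Rightarrow> 'r) \<Rightarrow> 'n" where
  "fext f = (\<lambda>x\<in>carrier F0. fsum (\<lambda>r m. smult N r (f m)) x)"

lemma fext_left_hom: "fext f \<in> left_hom R F0 N"
  unfolding lh0
proof (intro conjI ballI)
  show "fext f \<in> carrier F0 \<rightarrow>\<^sub>E UNIV" by (simp add: fext_def)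
  fix x assume x: "x \<in> carrier F0"
  show "fext f (x + y) = fext f x + fext f y" if y: "y \<in> carrier F0" for y
    using fsum_add[of UNIV "\<lambda>r m. smult N r (f m)" x y] x y by (simp add: fext_def F0_eq[symmetric] N.P_dist1)
  show "fext f (smult F0 r x) = smult N r (fext f x)" if r: "r \<in> carrier R" for r
  proof -
    have v: "x m \<in> carrier R" for m by (rule F_val(1)[OF x])
    have "fsum (\<lambda>r m. smult N r (f m)) (smult F0 r x) = (\<Sum>m | x m \<noteq> 0. smult N (mult R r (x m)) (f m))"
      unfolding F0_eq by (rule fsum_smult) (use r x in \<open>auto simp: F0_eq\<close>)
    also have "\<dots> = smult N r (\<Sum>m | x m \<noteq> 0. smult N (x m) (f m))"
      using N.smult_sum[OF r, of "{m. x m \<noteq> 0}" "\<lambda>m. smult N (x m) (f m)"] by (simp add: N.P_assoc r v)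
    finally show ?thesis using r x by (simp add: fext_def fsum_def)
  qed
qed

text \<open>A homomorphism on \<open>F0\<close> that agrees with \<open>fsum \<phi>\<close> on
  \<open>K\<close> differs from it by an additive map that vanishes on \<open>K\<close> and so
  factors through \<open>M\<close>; the factor is the required \<open>f\<close>.\<close>

lemma Psi_B1_iff: assumes \<phi>: "kcoc \<phi>"
  shows "Psi \<phi> \<in> B1 \<longleftrightarrow> (\<exists>f. lin sM sN f \<and> (\<forall>r\<in>carrier R. \<forall>m. \<phi> r m = smult N r (f m) - f (smult M r m)))"
proof
  assume "\<exists>f. lin sM sN f \<and> (\<forall>r\<in>carrier R. \<forall>m. \<phi> r m = smult N r (f m) - f (smult M r m))"
  then obtain f where f: "lin sM sN f" "\<And>r m. r \<in> carrier R \<Longrightarrow> \<phi> r m = smult N r (f m) - f (smult M r m)" by blast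
  have G: "fsum \<phi> x = fext f x - f (ev x)" if x: "x \<in> carrier F0" for x
  proof -
    have v: "x m \<in> carrier R" for m by (rule F_val(1)[OF x])
    have "fsum \<phi> x = (\<Sum>m | x m \<noteq> 0. smult N (x m) (f m)) - (\<Sum>m | x m \<noteq> 0. f (smult M (x m) m))"
      by (simp add: fsum_def f(2)[OF v] sum_subtractf)
    also have "(\<Sum>m | x m \<noteq> 0. f (smult M (x m) m)) = f (ev x)"
      using lin_sum[OF f(1), of "\<lambda>m. smult M (x m) m" "{m. x m \<noteq> 0}"] M.ev_fsum[of UNIV, folded F0_eq, OF _ x] by (simp add: fsum_def)
    finally show ?thesis using x by (simp add: fext_def fsum_def)
  qed
  have f0: "f 0 = 0" by (rule klin_zero[OF kclosed_whole lin_klin[OF f(1)]])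
  have "Psi \<phi> = (\<lambda>u\<in>carrier F1. fext f (d1 u))"
    unfolding Psi_def by (rule restrict_ext) (simp add: G d1_rules ev_d1 f0)
  then show "Psi \<phi> \<in> B1" unfolding B1_def using fext_left_hom by blast
next
  assume "Psi \<phi> \<in> B1"
  then obtain h where h: "h \<in> left_hom R F0 N" "Psi \<phi> = (\<lambda>x\<in>carrier F1. h (d1 x))" by (auto simp: B1_def)
  have hadd: "h (x + y) = h x + h y" if "x \<in> carrier F0" "y \<in> carrier F0" for x y using h(1) that unfolding lh0 by blast
  have hsm: "h (smult F0 r x) = smult N r (h x)" if "r \<in> carrier R" "x \<in> carrier F0" for r x using h(1) that unfolding lh0 by blast
  \<comment> \<open>\<open>single x (one R)\<close> is a preimage of \<open>x\<close> in
    \<open>F1\<close>, so an equation between functions on \<open>F1\<close> can be read on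
    \<open>K\<close>.\<close>
  have hK: "h x = fsum \<phi> x" if "x \<in> K" for x
  proof -
    have s: "single x (one R) \<in> carrier F1" by (rule single_F1[OF that]) simp
    have "d1 (single x (one R)) = x" using that K_sub by (subst d1_single) auto
    then show ?thesis using fun_cong[OF h(2), of "single x (one R)"] s by (simp add: Psi_def)
  qed
  define D where "D x = h x - fsum \<phi> x" for x
  define f where "f m = h (single m (one R))" for m
  have Dadd: "D (x + y) = D x + D y" if "x \<in> carrier F0" "y \<in> carrier F0" for x y
    using that by (simp add: D_def hadd fsum_kcoc_add[OF \<phi>])
  have D0: "D x = 0" if "x \<in> K" for x using hK[OF that] by (simp add: D_def)
  have s1: "single m (one R) \<in> carrier F0" for m by (rule single_F0) simp
  have Ds: "D (single m r) = smult N r (f m) - \<phi> r m" if r: "r \<in> carrier R" for m r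
  proof -
    have e: "smult F0 r (single m (one R)) = single m r" unfolding F0_eq using r by (subst smult_single) auto
    show ?thesis using hsm[OF r s1, of m] r by (simp add: e D_def f_def fsum_single kcoc_zero[OF \<phi>])
  qed
  have Df: "D x = f (ev x)" if x: "x \<in> carrier F0" for x
  proof -
    \<comment> \<open>\<open>x\<close> and \<open>[ev x]\<close> have the same image in
      \<open>M\<close>, so they differ by an element of \<open>K\<close>.\<close>
    let ?y = "x - single (ev x) (one R)"
    have y: "?y \<in> carrier F0" by (rule F0.P_diff[OF x s1])
    have "ev x = ev (?y + single (ev x) (one R))" by simp
    also have "\<dots> = ev ?y + ev x"
      using ev_single0[OF R_one, of "ev x"] by (simp only: ev_rules(1)[OF y s1] M.P_one carrier_M UNIV_I)
    finally have "?y \<in> K" using y by (simp add: K_def)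
    then have "D x = D (single (ev x) (one R))" using Dadd[OF y s1, of "ev x"] D0 by simp
    then show ?thesis by (simp add: Ds kcoc_one[OF \<phi>])
  qed
  have *: "\<phi> r m = smult N r (f m) - f (smult M r m)" if r: "r \<in> carrier R" for r m
    using Ds[OF r, of m] Df[OF single_F0[OF r], of m] by (simp add: ev_single0 r)
  have fa: "f (m + m') = f m + f m'" for m m'
    using Df[OF F0.P_add[OF s1 s1], of m m'] Dadd[OF s1 s1, of m m'] Df[OF s1]
    by (simp add: ev_rules s1 ev_single0)
  \<comment> \<open>As \<open>m \<mapsto> [m]\<close> is not linear, homogeneity of \<open>f\<close>
    is drawn from \<open>\<phi>\<close>, whose value at the scalar \<open>sR c (one R)\<close> is a
    multiple of \<open>\<phi> (one R) m = 0\<close>.\<close>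
  have fc: "f (sM c m) = sN c (f m)" for c m
  proof -
    interpret VN: vector_space sN by (rule sN)
    have "\<phi> (sR c (one R)) m = 0" by (simp add: kcoc_scale[OF \<phi>] kcoc_one[OF \<phi>])
    then show ?thesis using *[of "sR c (one R)" m] by (simp add: sN_left sM_left)
  qed
  have "lin sM sN f" by (simp add: lin_iff sM sN fa fc)
  then show "\<exists>f. lin sM sN f \<and> (\<forall>r\<in>carrier R. \<forall>m. \<phi> r m = smult N r (f m) - f (smult M r m))" using * by blast
qed

text \<open>
  A homomorphism \<open>g\<close> on \<open>K\<close> is turned into a cocycle with a linear section \<open>\<sigma>\<close> of the
  evaluation map; changing \<open>\<sigma>\<close> to the non-linear section \<open>m \<mapsto> single m 1\<close> costs a coboundary.
\<close>

lemma section_exists: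
  "\<exists>\<sigma>. (\<forall>m. \<sigma> m \<in> carrier F0 \<and> ev (\<sigma> m) = m) \<and> (\<forall>m m'. \<sigma> (m + m') = \<sigma> m + \<sigma> m') \<and> (\<forall>c m y. \<sigma> (sM c m) y = sR c (\<sigma> m y))"
proof -
  interpret VM: vector_space sM by (rule sM)
  interpret VR: vector_space sR by (rule sR)
  define sF where "sF c f = (\<lambda>y. sR c (f y))" for c and f :: "'m \<Rightarrow> 'r"
  interpret VF: vector_space sF
    by unfold_locales (auto simp: sF_def VR.scale_right_distrib VR.scale_left_distrib fun_eq_iff plus_fun_apply)
  interpret VP: vector_space_pair sM sF by unfold_locales
  obtain B where B: "VM.independent B" "VM.span B = UNIV"
    using VM.basis_exists[of UNIV] by (metis top.extremum_uniqueI)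
  \<comment> \<open>Prescribed on a basis of \<open>M\<close> and extended linearly; on other
    vectors \<open>\<sigma> m\<close> may differ from \<open>single m (one R)\<close>.\<close>
  obtain \<sigma> where s: "lin sM sF \<sigma>" "\<And>b. b \<in> B \<Longrightarrow> \<sigma> b = single b (one R)"
    using VP.linear_independent_extend[OF B(1), of "\<lambda>b. single b (one R)"] by blast
  interpret S: Vector_Spaces.linear sM sF \<sigma> by (rule s(1))
  \<comment> \<open>Scaling by \<open>c\<close> is multiplication by the ring element
    \<open>sR c (one R)\<close>, which keeps the values of \<open>\<sigma>\<close> inside the free
    module.\<close>
  have sc: "sF c x = smult F0 (sR c (one R)) x" if "x \<in> carrier F0" for c x
  proof
    fix y
    have "x y \<in> carrier R" using that by (rule F_val(1))
    then show "sF c x y = smult F0 (sR c (one R)) x y"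
      unfolding F0_eq Fr_smult by (simp add: sF_def sR_left)
  qed
  have "\<sigma> m \<in> carrier F0 \<and> ev (\<sigma> m) = m" for m
  proof -
    have "m \<in> VM.span B" using B(2) by simp
    then show ?thesis
    proof (induction rule: VM.span_induct_alt)
      case base
      have "ev 0 = 0" using ev_rules(1)[of 0 0] by simp
      then show ?case by (simp only: S.zero F0.P_zero simp_thms)
    next
      case (step c b m)
      have sb: "single b (one R) \<in> carrier F0" by (rule single_F0) simp
      have e: "\<sigma> (sM c b + m) = smult F0 (sR c (one R)) (single b (one R)) + \<sigma> m"
        using step(1) by (simp only: S.add S.scale s(2) sc[OF sb])
      show ?case unfolding e using step(2) sb by (simp add: ev_rules ev_single0 sM_left)
    qed
  qed
  then show ?thesis using S.add S.scale by (intro exI[of _ \<sigma>]) (auto simp: sF_def)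
qed

text \<open>\<open>h\<close> vanishes on the kernel of \<open>d1\<close>, so it comes from a
  homomorphism \<open>g\<close> on \<open>K\<close>. The failure of the linear section to be
  \<open>R\<close>-linear takes values in \<open>K\<close>, and \<open>g\<close> applied to it is
  the cocycle.\<close>

lemma Z1_representative: assumes h: "h \<in> Z1"
  shows "\<exists>\<phi>. kcoc \<phi> \<and> (\<exists>b\<in>B1. \<forall>u\<in>carrier F1. Psi \<phi> u = h u + b u)"
proof -
  have hadd: "h (x + y) = h x + h y" if "x \<in> carrier F1" "y \<in> carrier F1" for x y
    using h that unfolding Z1_def mem_Collect_eq lh1 by blast
  have hsm: "h (smult F1 r x) = smult N r (h x)" if "r \<in> carrier R" "x \<in> carrier F1" for r x
    using h that unfolding Z1_def mem_Collect_eq lh1 by blast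
  have hd2: "h (d2 w) = 0" if "w \<in> carrier F2" for w
    using h that by (simp add: Z1_def)
  define g where "g x = h (single x (one R))" for x
  have s1: "single x (one R) \<in> carrier F1" "d1 (single x (one R)) = x" if "x \<in> K" for x
    using that K_sub by (auto intro: single_F1 simp: d1_single)
  \<comment> \<open>\<open>u\<close> and \<open>[d1 u]\<close> differ by an element of
    \<open>L\<close>, which is in the image of \<open>d2\<close>, where \<open>h\<close>
    vanishes.\<close>
  have hg: "h u = g (d1 u)" if u: "u \<in> carrier F1" for u
  proof -
    note s = s1[OF d1_K[OF u]]
    let ?v = "u - single (d1 u) (one R)"
    have v: "?v \<in> carrier F1" by (rule F1.P_diff[OF u s(1)])
    have "d1 u = d1 (?v + single (d1 u) (one R))" by simp
    also have "\<dots> = d1 ?v + d1 u" by (simp only: d1_rules(1)[OF v s(1)] s(2))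
    finally have vL: "?v \<in> L" using v by (simp add: L_def)
    have w: "single ?v (one R) \<in> carrier F2" unfolding F2_eq by (rule single_mem[OF vL]) simp
    have "d2 (single ?v (one R)) = ?v" using F1.ev_single[OF L_sub vL, of "one R"] v by simp
    then have "h ?v = 0" using hd2[OF w] by simp
    then show ?thesis using hadd[OF v s(1)] by (simp add: g_def)
  qed
  have gadd: "g (x + y) = g x + g y" if "x \<in> K" "y \<in> K" for x y
    using hg[OF F1.P_add[OF s1(1)[OF that(1)] s1(1)[OF that(2)]]] hadd[OF s1(1)[OF that(1)] s1(1)[OF that(2)]]
    by (simp add: d1_rules s1 that g_def)
  have gsm: "g (smult F0 r x) = smult N r (g x)" if "r \<in> carrier R" "x \<in> K" for r x
    using hg[OF F1.P_smult[OF that(1) s1(1)[OF that(2)]]] hsm[OF that(1) s1(1)[OF that(2)]]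
    by (simp add: d1_rules s1 that g_def)
  have ev0: "ev 0 = 0" using ev_rules(1)[of 0 0] by simp
  have evm: "ev (- x) = - ev x" if "x \<in> carrier F0" for x
    using ev_rules(1)[of x "- x"] that by (simp add: ev0 add_eq_0_iff)
  have evd: "ev (x - y) = ev x - ev y" if "x \<in> carrier F0" "y \<in> carrier F0" for x y
    using ev_rules(1)[of x "- y"] that by (simp add: evm)
  have K0: "0 \<in> K" by (simp add: K_def ev0)
  have Kadd: "x + y \<in> K" if "x \<in> K" "y \<in> K" for x y using that by (simp add: K_def ev_rules)
  have Ksm: "smult F0 r x \<in> K" if "r \<in> carrier R" "x \<in> K" for r x using that by (simp add: K_def ev_rules)
  have gsum: "(\<Sum>i\<in>I. x i) \<in> K \<and> g (\<Sum>i\<in>I. x i) = (\<Sum>i\<in>I. g (x i))" if "\<And>i. i \<in> I \<Longrightarrow> x i \<in> K" for I x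
    by (rule sum_additive[OF gadd K0 Kadd that])
  obtain \<sigma> where \<sigma>: "\<And>m. \<sigma> m \<in> carrier F0" "\<And>m. ev (\<sigma> m) = m" "\<And>m m'. \<sigma> (m + m') = \<sigma> m + \<sigma> m'"
     "\<And>c m y. \<sigma> (sM c m) y = sR c (\<sigma> m y)" using section_exists by blast
  have \<sigma>v: "\<sigma> m y \<in> carrier R" for m y by (rule F_val(1)[OF \<sigma>(1)])
  have \<sigma>0: "\<sigma> 0 = 0" using \<sigma>(3)[of 0 0] by simp
  have \<sigma>c: "\<sigma> (sM c m) = smult F0 (sR c (one R)) (\<sigma> m)" for c m
    unfolding F0_eq by (rule ext) (simp add: Fr_smult \<sigma>(4) sR_left \<sigma>v)
  have cr: "smult F0 (sR c r) x = smult F0 (sR c (one R)) (smult F0 r x)" "smult F0 r (smult F0 (sR c (one R)) x) = smult F0 (sR c (one R)) (smult F0 r x)"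
    if "r \<in> carrier R" "x \<in> carrier F0" for c r x
    using that by (simp_all add: F0.P_assoc[symmetric] sR_left sR_right)
  have gc: "g (smult F0 (sR c (one R)) x) = sN c (g x)" if "x \<in> K" for c x
    using that by (simp add: gsm sN_left)
  define \<phi> where "\<phi> r m = g (smult F0 r (\<sigma> m) - \<sigma> (smult M r m))" for r m
  have kK: "smult F0 r (\<sigma> m) - \<sigma> (smult M r m) \<in> K" if "r \<in> carrier R" for r m
    using that by (simp add: K_def F0.P_diff evd ev_rules \<sigma>)
  have "kcoc \<phi>"
    unfolding kcoc_def
  proof (intro conjI allI ballI)
    fix m
    show "klin_on \<lparr>vec = carrier R, scl = sR\<rparr> sN (\<lambda>r. \<phi> r m)"
    proof (rule klin_onI; simp)
      fix r t assume r: "r \<in> carrier R" and t: "t \<in> carrier R"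
      have "smult F0 (r + t) (\<sigma> m) - \<sigma> (smult M (r + t) m) = (smult F0 r (\<sigma> m) - \<sigma> (smult M r m)) + (smult F0 t (\<sigma> m) - \<sigma> (smult M t m))"
        using r t by (simp add: F0.P_dist1 M.P_dist1 \<sigma>)
      then show "\<phi> (r + t) m = \<phi> r m + \<phi> t m" unfolding \<phi>_def using gadd[OF kK[OF r] kK[OF t]] by simp
    next
      fix c r assume r: "r \<in> carrier R"
      have "smult F0 (sR c r) (\<sigma> m) - \<sigma> (smult M (sR c r) m) = smult F0 (sR c (one R)) (smult F0 r (\<sigma> m) - \<sigma> (smult M r m))"
        using r cr(1)[OF r \<sigma>(1)[of m], of c] by (simp add: F0.smult_diff \<sigma>(1) sM_left \<sigma>c)
      then show "\<phi> (sR c r) m = sN c (\<phi> r m)" unfolding \<phi>_def using gc[OF kK[OF r]] by simp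
    qed
  next
    fix r assume r: "r \<in> carrier R"
    have "\<phi> r (m + m') = \<phi> r m + \<phi> r m'" for m m'
    proof -
      have "smult F0 r (\<sigma> (m + m')) - \<sigma> (smult M r (m + m')) = (smult F0 r (\<sigma> m) - \<sigma> (smult M r m)) + (smult F0 r (\<sigma> m') - \<sigma> (smult M r m'))"
        using r by (simp add: F0.P_dist2 M.P_dist2 \<sigma>)
      then show ?thesis unfolding \<phi>_def using gadd[OF kK[OF r] kK[OF r]] by simp
    qed
    moreover have "\<phi> r (sM c m) = sN c (\<phi> r m)" for c m
    proof -
      have "smult F0 r (\<sigma> (sM c m)) - \<sigma> (smult M r (sM c m)) = smult F0 (sR c (one R)) (smult F0 r (\<sigma> m) - \<sigma> (smult M r m))"
        using r cr(2)[OF r \<sigma>(1)[of m], of c] by (simp add: F0.smult_diff \<sigma>(1) sM_right \<sigma>c)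
      then show ?thesis unfolding \<phi>_def using gc[OF kK[OF r]] by simp
    qed
    ultimately show "lin sM sN (\<phi> r)" by (simp add: lin_iff sM sN)
  next
    fix r t m assume r: "r \<in> carrier R" and t: "t \<in> carrier R"
    have "smult F0 (mult R r t) (\<sigma> m) - \<sigma> (smult M (mult R r t) m) =
      smult F0 r (smult F0 t (\<sigma> m) - \<sigma> (smult M t m)) + (smult F0 r (\<sigma> (smult M t m)) - \<sigma> (smult M r (smult M t m)))"
      using r t by (simp add: F0.P_assoc M.P_assoc \<sigma>(1) F0.smult_diff)
    then show "\<phi> (mult R r t) m = smult N r (\<phi> t m) + \<phi> r (smult M t m)"
      unfolding \<phi>_def using gadd[OF Ksm[OF r kK[OF t]] kK[OF r]] gsm[OF r kK[OF t]] by simp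
  qed
  moreover
  \<comment> \<open>The correction between the two sections. It need not be linear, and
    \<open>fext\<close> accepts any function.\<close>
  define \<psi> where "\<psi> m = g (\<sigma> m - single m (one R))" for m
  have sF0: "single m r \<in> carrier F0" if "r \<in> carrier R" for m r by (rule single_F0[OF that])
  have pK: "\<sigma> m - single m (one R) \<in> K" for m
    by (simp add: K_def F0.P_diff \<sigma> sF0 evd ev_single0)
  have main: "fsum \<phi> x = g x + fext \<psi> x" if x: "x \<in> K" for x
  proof -
    have x0: "x \<in> carrier F0" "ev x = 0" using x by (auto simp: K_def)
    have v: "x m \<in> carrier R" for m by (rule F_val(1)[OF x0(1)])
    let ?T = "{m. x m \<noteq> 0}"
    have T: "finite ?T" using x0(1) by (simp add: F0_eq Fr_carrier)
    have xs: "(\<Sum>m\<in>?T. smult F0 (x m) (single m (one R))) = x"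
    proof
      fix y
      have "(\<Sum>m\<in>I. smult F0 (x m) (single m (one R))) y = (\<Sum>m\<in>I. if m = y then x y else 0)" if "finite I" for I
        using that
      proof (induction I rule: finite_induct)
        case (insert m I)
        then show ?case unfolding F0_eq by (auto simp: smult_single v plus_fun_apply) (auto simp: single_def)
      qed simp
      from this[OF T] show "(\<Sum>m\<in>?T. smult F0 (x m) (single m (one R))) y = x y" using T by simp
    qed
    \<comment> \<open>Additivity of \<open>\<sigma>\<close> turns this sum into
      \<open>\<sigma> (ev x)\<close>, and \<open>x\<close> lies in the kernel of
      \<open>ev\<close>.\<close>
    have sig: "(\<Sum>m\<in>?T. \<sigma> (smult M (x m) m)) = 0"
    proof -
      have "\<sigma> (\<Sum>m\<in>?T. smult M (x m) m) = (\<Sum>m\<in>?T. \<sigma> (smult M (x m) m))"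
        by (rule sum_additive[where C = UNIV, THEN conjunct2]) (auto simp: \<sigma>)
      moreover have "(\<Sum>m\<in>?T. smult M (x m) m) = 0"
        using x0(2) M.ev_fsum[of UNIV, folded F0_eq, OF _ x0(1)] by (simp add: fsum_def)
      ultimately show ?thesis by (simp add: \<sigma>0)
    qed
    have "fsum \<phi> x = g (\<Sum>m\<in>?T. smult F0 (x m) (\<sigma> m) - \<sigma> (smult M (x m) m))"
      unfolding fsum_def \<phi>_def by (rule gsum[THEN conjunct2, symmetric]) (rule kK[OF v])
    also have "(\<Sum>m\<in>?T. smult F0 (x m) (\<sigma> m) - \<sigma> (smult M (x m) m)) = (\<Sum>m\<in>?T. smult F0 (x m) (\<sigma> m))"
      by (simp add: sum_subtractf sig)
    \<comment> \<open>Each \<open>\<sigma> m\<close> is replaced by \<open>[m]\<close> plus the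
      correction, and the \<open>[m]\<close> recombine to \<open>x\<close>.\<close>
    also have "\<dots> = x + (\<Sum>m\<in>?T. smult F0 (x m) (\<sigma> m - single m (one R)))"
      by (simp add: F0.smult_diff v \<sigma> sF0 sum_subtractf xs)
    also have "g \<dots> = g x + (\<Sum>m\<in>?T. smult N (x m) (\<psi> m))"
    proof -
      have "smult F0 (x m) (\<sigma> m - single m (one R)) \<in> K" for m by (rule Ksm[OF v pK])
      from gsum[of ?T "\<lambda>m. smult F0 (x m) (\<sigma> m - single m (one R))", OF this] show ?thesis using gadd[OF x] by (simp add: gsm[OF v pK] \<psi>_def)
    qed
    finally show ?thesis using x0(1) by (simp add: fext_def fsum_def)
  qed
  have "Psi \<phi> u = h u + (\<lambda>x\<in>carrier F1. fext \<psi> (d1 x)) u" if "u \<in> carrier F1" for u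
    using that by (simp add: Psi_def main d1_K hg)
  ultimately show ?thesis unfolding B1_def using fext_left_hom[of \<psi>] by blast
qed

end

section \<open>The isomorphism\<close>

context kalg_ext
begin

lemma Z1_iff: "h \<in> Z1 \<longleftrightarrow> h \<in> carrier F1 \<rightarrow>\<^sub>E UNIV \<and> (\<forall>x\<in>carrier F1. \<forall>y\<in>carrier F1. h (x + y) = h x + h y) \<and>
   (\<forall>r\<in>carrier R. \<forall>x\<in>carrier F1. h (smult F1 r x) = smult N r (h x)) \<and> (\<forall>w\<in>carrier F2. h (d2 w) = 0)"
  unfolding Z1_def mem_Collect_eq lh1 by simp

definition Zgroup :: "((('m \<Rightarrow> 'r) \<Rightarrow> 'r) \<Rightarrow> 'n) monoid" where
  "Zgroup = \<lparr>carrier = Z1, mult = (\<lambda>g h. \<lambda>x\<in>carrier F1. g x \<oplus>\<^bsub>N\<^esub> h x), one = (\<lambda>x\<in>carrier F1. \<zero>\<^bsub>N\<^esub>)\<rparr>"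

lemma Zgroup_simps: "carrier Zgroup = Z1" "mult Zgroup g h = (\<lambda>x\<in>carrier F1. g x + h x)" "one Zgroup = (\<lambda>x\<in>carrier F1. 0)"
  by (simp_all add: Zgroup_def)

lemma Ext1_Zgroup: "Ext1 R M N = Zgroup Mod B1"
  by (simp add: Ext1_def Zgroup_def Z1_def B1_def)

lemma Z1_ext: "g \<in> Z1 \<Longrightarrow> h \<in> Z1 \<Longrightarrow> (\<And>u. u \<in> carrier F1 \<Longrightarrow> g u = h u) \<Longrightarrow> g = h"
  unfolding Z1_iff by (rule PiE_ext[of g "carrier F1" "\<lambda>_. UNIV" h]) blast+

lemma Z1_closed:
  "g \<in> Z1 \<Longrightarrow> h \<in> Z1 \<Longrightarrow> (\<lambda>x\<in>carrier F1. g x + h x) \<in> Z1"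
  "(\<lambda>x\<in>carrier F1. 0) \<in> Z1"
  "g \<in> Z1 \<Longrightarrow> (\<lambda>x\<in>carrier F1. - g x) \<in> Z1"
  unfolding Z1_iff by (auto simp: d2_mem N.P_dist2 N.smult_minus)

lemma comm_group_Zgroup: "comm_group Zgroup"
proof (rule comm_groupI; unfold Zgroup_simps)
  fix x assume x: "x \<in> Z1"
  show "(\<lambda>u\<in>carrier F1. (\<lambda>x\<in>carrier F1. 0) u + x u) = x"
    by (rule Z1_ext[OF Z1_closed(1)[OF Z1_closed(2) x] x]) simp
  show "\<exists>y\<in>Z1. (\<lambda>u\<in>carrier F1. y u + x u) = (\<lambda>x\<in>carrier F1. 0)"
    using Z1_closed(3)[OF x] by (intro bexI[of _ "\<lambda>x'\<in>carrier F1. - x x'"] restrict_ext) auto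
qed (auto intro: Z1_closed intro!: restrict_ext simp: add.assoc add.commute)

lemma inv_Zgroup: assumes "g \<in> Z1" shows "inv\<^bsub>Zgroup\<^esub> g = (\<lambda>x\<in>carrier F1. - g x)"
proof (rule group.inv_equality[OF comm_group.axioms(2)[OF comm_group_Zgroup]])
  show "(\<lambda>x\<in>carrier F1. - g x) \<otimes>\<^bsub>Zgroup\<^esub> g = \<one>\<^bsub>Zgroup\<^esub>"
    unfolding Zgroup_simps by (rule restrict_ext) simp
qed (use assms Z1_closed in \<open>auto simp: Zgroup_simps\<close>)

lemma subgroup_B1: "subgroup B1 Zgroup"
proof (rule group.subgroupI[OF comm_group.axioms(2)[OF comm_group_Zgroup]])
  have "(\<lambda>x\<in>carrier F1. h (d1 x)) \<in> Z1" if h: "h \<in> left_hom R F0 N" for h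
  proof -
    have h0: "h 0 = 0" using h[unfolded lh0] F0.P_zero by (metis add_0 add_cancel_right_right)
    show ?thesis
      using h unfolding Z1_iff lh0 by (auto simp: d1_rules d2_mem d1_d2 h0)
  qed
  then show "B1 \<subseteq> carrier Zgroup" by (auto simp: B1_def Zgroup_simps)
  then have sub: "B1 \<subseteq> Z1" by (simp add: Zgroup_simps)
  show "B1 \<noteq> {}" using fext_left_hom by (auto simp: B1_def)
  show "inv\<^bsub>Zgroup\<^esub> a \<in> B1" if a: "a \<in> B1" for a
  proof -
    obtain h where h: "h \<in> left_hom R F0 N" "a = (\<lambda>x\<in>carrier F1. h (d1 x))" using a by (auto simp: B1_def)
    have "inv\<^bsub>Zgroup\<^esub> a = (\<lambda>x\<in>carrier F1. (\<lambda>y\<in>carrier F0. - h y) (d1 x))"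
      unfolding inv_Zgroup[OF subsetD[OF sub a]] by (rule restrict_ext) (simp add: h(2) d1_rules)
    moreover have "(\<lambda>y\<in>carrier F0. - h y) \<in> left_hom R F0 N"
      using h(1) unfolding lh0 by (auto simp: N.smult_minus)
    ultimately show ?thesis unfolding B1_def by (intro image_eqI[where x = "\<lambda>y\<in>carrier F0. - h y"])
  qed
  show "a \<otimes>\<^bsub>Zgroup\<^esub> b \<in> B1" if a: "a \<in> B1" and b: "b \<in> B1" for a b
  proof -
    obtain h where h: "h \<in> left_hom R F0 N" "a = (\<lambda>x\<in>carrier F1. h (d1 x))" using a by (auto simp: B1_def)
    obtain g where g: "g \<in> left_hom R F0 N" "b = (\<lambda>x\<in>carrier F1. g (d1 x))" using b by (auto simp: B1_def)
    have "a \<otimes>\<^bsub>Zgroup\<^esub> b = (\<lambda>x\<in>carrier F1. (\<lambda>y\<in>carrier F0. h y + g y) (d1 x))"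
      by (auto simp: Zgroup_simps h(2) g(2) d1_rules intro!: restrict_ext)
    moreover have "(\<lambda>y\<in>carrier F0. h y + g y) \<in> left_hom R F0 N"
      using h(1) g(1) unfolding lh0 by (auto simp: N.P_dist2)
    ultimately show ?thesis unfolding B1_def by (intro image_eqI[where x = "\<lambda>y\<in>carrier F0. h y + g y"])
  qed
qed

end

text \<open>\<open>K\<close> is the kernel of \<open>f\<close> followed by the quotient map of
  \<open>H\<close>, and this composite is onto because \<open>f\<close> meets every coset of
  \<open>N\<close>. The first isomorphism theorem applies to it.\<close>

lemma quotient_iso:
  assumes G: "group G" and H: "comm_group H" and f: "f \<in> hom G H" and N: "subgroup N H"
    and ker: "\<And>x. x \<in> carrier G \<Longrightarrow> f x \<in> N \<longleftrightarrow> x \<in> K" and K: "K \<subseteq> carrier G"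
    and surj: "\<And>y. y \<in> carrier H \<Longrightarrow> \<exists>x\<in>carrier G. \<exists>n\<in>N. f x = n \<otimes>\<^bsub>H\<^esub> y"
  shows "G Mod K \<cong> H Mod N"
proof -
  interpret H: comm_group H by (rule H)
  interpret N: normal N H by (rule H.subgroup_imp_normal[OF N])
  have fc: "f x \<in> carrier H" if "x \<in> carrier G" for x using f that by (auto simp: hom_def)
  define p where "p x = N #>\<^bsub>H\<^esub> f x" for x
  have hom: "p \<in> hom G (H Mod N)"
    using hom_compose[OF f N.r_coset_hom_Mod] by (simp add: p_def[abs_def] o_def)
  interpret P: group_hom G "H Mod N" p
    by (intro group_hom.intro group_hom_axioms.intro G N.factorgroup_is_group hom)
  have "kernel G (H Mod N) p = K"
  proof -
    have "p x = N \<longleftrightarrow> f x \<in> N" if "x \<in> carrier G" for x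
      unfolding p_def using H.coset_join1[OF _ fc[OF that] N] H.coset_join2[OF fc[OF that] N] by blast
    then show ?thesis using ker K by (auto simp: kernel_def FactGroup_def)
  qed
  moreover have "p ` carrier G = carrier (H Mod N)"
  proof
    show "p ` carrier G \<subseteq> carrier (H Mod N)" using hom by (auto simp: hom_def)
    show "carrier (H Mod N) \<subseteq> p ` carrier G"
    proof
      fix C assume "C \<in> carrier (H Mod N)"
      then obtain y where y: "y \<in> carrier H" "C = N #>\<^bsub>H\<^esub> y" by (auto simp: FactGroup_def RCOSETS_def)
      obtain x n where x: "x \<in> carrier G" "n \<in> N" "f x = n \<otimes>\<^bsub>H\<^esub> y" using surj[OF y(1)] by blast
      have "f x \<in> N #>\<^bsub>H\<^esub> y" using x by (auto simp: r_coset_def)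
      from H.repr_independence[OF this y(1) N] have "C = p x" by (simp add: p_def y(2))
      then show "C \<in> p ` carrier G" using x(1) by blast
    qed
  qed
  ultimately show ?thesis using P.FactGroup_iso by simp
qed

section \<open>The comparison map for the double\<close>

context yd_two
begin

lemma lring_double: "lring (double A)"
proof (intro lring.intro; unfold double_def ring_record_simps monoid.simps partial_object.simps)
  show "0 \<in> DD" by (rule tens_zero)
  show "- r \<in> DD" if "r \<in> DD" for r using tens_diff[OF tens_zero that] by (simp only: diff_0)
qed (auto simp: dmult_assoc one_dmult dmult_one intro: tens_add dmult_DD
    klin_add[OF dmult_klin_left] klin_add[OF dmult_klin_right])

lemma double_simps: "carrier (double A) = DD" "mult (double A) = double_mult A" "one (double A) = TD \<epsilon> 1"
  by (simp_all add: double_def)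

lemma double_module_simps: "carrier (double_module A P) = UNIV" "zero (double_module A P) = 0" "add (double_module A P) = (+)"
  by (simp_all add: double_module_def)

lemma lmod_double_M: "lmod (double A) (double_module A M)"
proof (intro lmod.intro lring_double lmod_axioms.intro; unfold double_simps double_module_simps M.smult_double_module)
  fix r x y assume r: "r \<in> DD"
  show "M.da.dm r (x + y) = M.da.dm r x + M.da.dm r y" using M.dm_lin_right[OF r] unfolding lin_iff by blast
  show "M.da.dm (r + t) x = M.da.dm r x + M.da.dm t x" if "t \<in> DD" for t
    using klin_add[OF M.da.dm_klin_left, of x r t] r that by simp
qed (auto simp: M.dm_mult M.dm_one)

lemma lmod_double_N: "lmod (double A) (double_module A N)"
proof (intro lmod.intro lring_double lmod_axioms.intro; unfold double_simps double_module_simps N.smult_double_module)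
  fix r x y assume r: "r \<in> DD"
  show "N.da.dm r (x + y) = N.da.dm r x + N.da.dm r y" using N.dm_lin_right[OF r] unfolding lin_iff by blast
  show "N.da.dm (r + t) x = N.da.dm r x + N.da.dm t x" if "t \<in> DD" for t
    using klin_add[OF N.da.dm_klin_left, of x r t] r that by simp
qed (auto simp: N.dm_mult N.dm_one)

sublocale X: kalg_ext "double A" "double_module A M" "double_module A N" tscale "msc M" "msc N"
proof (intro kalg_ext.intro kalg_ext_axioms.intro lring_double lmod_double_M lmod_double_N vector_space_tscale
    M.vector_space_M N.vector_space_M; unfold double_simps double_module_simps M.smult_double_module N.smult_double_module)
  fix r t c assume r: "r \<in> DD"
  show "tscale c r \<in> DD" by (rule tens_scale[OF r])
  show "M.da.dm (tscale c r) m = msc M c (M.da.dm r m)" for m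
    using klin_scale[OF M.da.dm_klin_left, of m r c] r by simp
  show "N.da.dm (tscale c r) n = msc N c (N.da.dm r n)" for n
    using klin_scale[OF N.da.dm_klin_left, of n r c] r by simp
  show "M.da.dm r (msc M c m) = msc M c (M.da.dm r m)" for m
    using M.dm_lin_right[OF r] unfolding lin_iff by blast
  show "double_mult A (tscale c r) t = tscale c (double_mult A r t)" if "t \<in> DD"
    using klin_scale[OF dmult_klin_left[OF that], of r c] r by simp
  show "double_mult A r (tscale c t) = tscale c (double_mult A r t)" if "t \<in> DD"
    using klin_scale[OF dmult_klin_right[OF r], of t c] that by simp
qed auto

lemma kcoc_dcocycle: "X.kcoc \<phi> \<longleftrightarrow> dcocycle \<phi>"
  unfolding X.kcoc_def dcocycle_def double_simps M.smult_double_module N.smult_double_module tspace_def ..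

text \<open>A cochain determines \<open>la\<close> only on linear functionals, so the conditions and
  \<open>phi\<close> must not depend on its other values.\<close>

lemma ext_data_cong:
  assumes E: "ext_data A M N om la" "ext_data A M N om' la'"
    and om: "\<And>a m. om a m = om' a m" and la: "\<And>q m. q \<in> vec DA \<Longrightarrow> la q m = la' q m"
  shows "ext_data.act_coc M N om \<longleftrightarrow> ext_data.act_coc M N om'"
    "ext_data.dual_coc A M N la \<longleftrightarrow> ext_data.dual_coc A M N la'"
    "ext_data.mix_coc A M N om la \<longleftrightarrow> ext_data.mix_coc A M N om' la'"
    "d \<in> DD \<Longrightarrow> ext_data.phi A M N om la d m = ext_data.phi A M N om' la' d m"
proof -
  interpret E: ext_data A M N om la by (rule E(1))
  interpret E': ext_data A M N om' la' by (rule E(2))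
  show "E.act_coc \<longleftrightarrow> E'.act_coc" unfolding E.act_coc_def E'.act_coc_def om ..
  show "E.dual_coc \<longleftrightarrow> E'.dual_coc" unfolding E.dual_coc_def E'.dual_coc_def
    by (intro ball_cong refl) (simp add: la)
  show "E.mix_coc \<longleftrightarrow> E'.mix_coc" unfolding E.mix_coc_def E'.mix_coc_def om
    by (intro iff_allI ball_cong refl) (simp add: la E.E.mult_dual)
  show "E.phi d m = E'.phi d m" if "d \<in> DD"
    by (rule tens2_eqI[OF E.phi_klin_left E'.phi_klin_left _ that]) (simp add: E.phi_TD E'.phi_TD om la)
qed

abbreviation phiF where "phiF F \<equiv> ext_data.phi A M N (omF F) (laF F)"

lemma phiF_dcocycle: assumes "F \<in> tot_cocycles A M N 1" shows "dcocycle (phiF F)"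
proof -
  have F: "F \<in> tot A M N 1" using assms by (simp add: tot_cocycles_def)
  show ?thesis
    using ext_data.coc_dcocycle[OF cochain_data(1)[OF F]] cocycle_iff[OF F] assms by blast
qed

lemma phiF_diff: assumes F: "F \<in> tot A M N 1" and G: "G \<in> tot A M N 1" and d: "d \<in> DD"
  shows "phiF (F - G) d m = phiF F d m - phiF G d m"
proof -
  interpret F: ext_data A M N "omF F" "laF F" by (rule cochain_data(1)[OF F])
  interpret G: ext_data A M N "omF G" "laF G" by (rule cochain_data(1)[OF G])
  interpret D: ext_data A M N "omF (F - G)" "laF (F - G)" by (rule cochain_data(1)[OF tot_diff(1)[OF F G]])
  have Nd: "N.dM q (x - y) = N.dM q x - N.dM q y" if "q \<in> vec DA" for q x y
    using N.dM_lin[OF that] Vector_Spaces.linear.axioms(3)[THEN module_hom.diff] by blast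
  show ?thesis
    by (rule tens2_eqI[OF D.phi_klin_left klin_diff[OF N.vector_space_M F.phi_klin_left G.phi_klin_left] _ d])
      (simp add: D.phi_TD F.phi_TD G.phi_TD tot_diff(2,3)[OF F G] Nd)
qed

lemma Psi_cong: "(\<And>d m. d \<in> DD \<Longrightarrow> \<phi> d m = \<psi> d m) \<Longrightarrow> X.Psi \<phi> = X.Psi \<psi>"
  unfolding X.Psi_def fsum_def
  by (intro restrict_ext sum.cong refl) (simp add: X.F_val(1)[OF X.d1_rules(3), unfolded double_simps])

lemma Psi_phiF_diff: assumes F: "F \<in> tot A M N 1" and G: "G \<in> tot A M N 1" and u: "u \<in> carrier X.F1"
  shows "X.Psi (phiF (F - G)) u = X.Psi (phiF F) u - X.Psi (phiF G) u"
  using u X.F_val(1)[OF X.d1_rules(3)[OF u], unfolded double_simps]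
  by (simp add: X.Psi_def fsum_def phiF_diff[OF F G] sum_subtractf)

lemma zero_cocycle: "0 \<in> tot_cocycles A M N 1"
proof -
  note t = tot_zero_mem[of 1]
  interpret E: ext_data A M N "omF 0" "laF 0" by (rule cochain_data(1)[OF t])
  have e: "omF 0 a m = 0" "q \<in> vec DA \<Longrightarrow> laF 0 q m = 0" for a q m
    using tot_diff(2)[OF t t, of a m] tot_diff(3)[OF t t, of q m] by simp_all
  have "E.act_coc" "E.dual_coc" "E.mix_coc"
    unfolding E.act_coc_def E.dual_coc_def E.mix_coc_def by (simp_all add: e E.N_add E.E.mult_dual)
  then show ?thesis using cocycle_iff[OF t] by blast
qed

lemma cocycle_add: assumes F: "F \<in> tot_cocycles A M N 1" and G: "G \<in> tot_cocycles A M N 1"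
  shows "F + G \<in> tot_cocycles A M N 1"
proof -
  have "F - (0 - G) \<in> tot_cocycles A M N 1" by (intro cocycle_diff F G zero_cocycle)
  then show ?thesis by (simp only: diff_0 diff_minus_eq_add)
qed

lemma group_cocycles: "group \<lparr>carrier = tot_cocycles A M N 1, mult = (+), one = 0\<rparr>"
proof (rule groupI; unfold partial_object.simps monoid.simps)
  fix F assume F: "F \<in> tot_cocycles A M N 1"
  have "- F \<in> tot_cocycles A M N 1" using cocycle_diff[OF zero_cocycle F] by (simp only: diff_0)
  then show "\<exists>G\<in>tot_cocycles A M N 1. G + F = 0" by (intro bexI[of _ "- F"]) (simp only: left_minus)
  show "0 + F = F" by (simp only: add_0)
qed (auto intro: cocycle_add zero_cocycle simp only: add.assoc)

lemma coboundary_cocycle: assumes "F \<in> tot_coboundaries A M N 1" shows "F \<in> tot_cocycles A M N 1"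
proof -
  note t = coboundary_tot[OF assms]
  obtain f where f: "lin (msc M) (msc N) f" "\<And>a m. omF F a m = act N a (f m) - f (act M a m)"
    "\<And>q m. q \<in> vec DA \<Longrightarrow> laF F q m = N.dM q (f m) - f (M.dM q m)"
    using assms coboundary_iff[OF t] by blast
  note c = coboundary_coc[OF f(1)]
  show ?thesis
    using ext_data_cong(1-3)[OF cochain_data(1)[OF t] c(1) f(2,3)] c(2-4) cocycle_iff[OF t] by blast
qed

text \<open>The same \<open>f\<close> works on both sides: the coboundary equation over the double,
  restricted to \<open>TD \<epsilon> a\<close> and \<open>TD q 1\<close>, gives the equations for
  \<open>omF\<close> and \<open>laF\<close>, and \<open>coboundary_coc\<close> leads back.\<close>

lemma Psi_phiF_B1: assumes Z: "F \<in> tot_cocycles A M N 1"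
  shows "X.Psi (phiF F) \<in> X.B1 \<longleftrightarrow> F \<in> tot_coboundaries A M N 1"
proof -
  have t: "F \<in> tot A M N 1" using Z by (simp add: tot_cocycles_def)
  interpret E: ext_data A M N "omF F" "laF F" by (rule cochain_data(1)[OF t])
  have "X.Psi (phiF F) \<in> X.B1 \<longleftrightarrow> (\<exists>f. lin (msc M) (msc N) f \<and> (\<forall>d\<in>DD. \<forall>m. E.phi d m = N.da.dm d (f m) - f (M.da.dm d m)))"
    using X.Psi_B1_iff[of "phiF F", unfolded kcoc_dcocycle double_simps M.smult_double_module N.smult_double_module, OF phiF_dcocycle[OF Z]] .
  also have "\<dots> \<longleftrightarrow> F \<in> tot_coboundaries A M N 1"
    unfolding coboundary_iff[OF t]
  proof (intro iff_exI conj_cong refl iffI conjI allI ballI)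
    fix f a m assume "\<forall>d\<in>DD. \<forall>m. E.phi d m = N.da.dm d (f m) - f (M.da.dm d m)"
    then have h: "E.phi (TD q b) m = N.da.dm (TD q b) (f m) - f (M.da.dm (TD q b) m)" if "q \<in> vec DA" for q b m
      using TD_DD[OF that] by blast
    note c = E.coc_unit[OF cocycle_iff[OF t, THEN iffD1, OF Z, THEN conjunct1] cocycle_iff[OF t, THEN iffD1, OF Z, THEN conjunct2, THEN conjunct1]]
    show "omF F a m = act N a (f m) - f (act M a m)"
      using h[OF eps_dual, of a m] by (simp add: c M.da.dm_TD N.da.dm_TD M.dM_eps N.dM_eps)
    show "laF F q m = N.dM q (f m) - f (M.dM q m)" if "q \<in> vec DA" for q
      using h[OF that, of 1 m] that by (simp add: c M.da.dm_TD N.da.dm_TD M.act_one N.act_one)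
  next
    fix f d m assume f: "lin (msc M) (msc N) f" and d: "d \<in> DD"
      and h: "(\<forall>a m. omF F a m = act N a (f m) - f (act M a m)) \<and> (\<forall>q\<in>vec DA. \<forall>m. laF F q m = N.dM q (f m) - f (M.dM q m))"
    note c = coboundary_coc[OF f]
    show "E.phi d m = N.da.dm d (f m) - f (M.da.dm d m)"
      using ext_data_cong(4)[OF cochain_data(1)[OF t] c(1) _ _ d] c(5)[OF d] h by simp
  qed
  finally show ?thesis .
qed

lemma cohomology_iso_Ext1: "yd_cohomology A M N 1 \<cong> Ext1 (double A) (double_module A M) (double_module A N)"
  unfolding yd_cohomology_def X.Ext1_Zgroup
proof (rule quotient_iso[OF group_cocycles X.comm_group_Zgroup _ X.subgroup_B1, where f = "\<lambda>F. X.Psi (phiF F)"];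
    (unfold partial_object.simps X.Zgroup_simps(1))?)
  have PZ: "X.Psi (phiF F) \<in> X.Z1" if "F \<in> tot_cocycles A M N 1" for F
    using X.Psi_Z1 phiF_dcocycle[OF that] by (simp add: kcoc_dcocycle)
  show "(\<lambda>F. X.Psi (phiF F)) \<in> hom \<lparr>carrier = tot_cocycles A M N 1, mult = (+), one = 0\<rparr> X.Zgroup"
  proof (rule homI; unfold partial_object.simps monoid.simps X.Zgroup_simps)
    fix F G assume F: "F \<in> tot_cocycles A M N 1" and G: "G \<in> tot_cocycles A M N 1"
    note H = cocycle_add[OF F G]
    have t: "F + G \<in> tot A M N 1" "G \<in> tot A M N 1" using H G by (auto simp: tot_cocycles_def)
    \<comment> \<open>Compatibility with sums is obtained from that with differences, applied to
      \<open>F + G\<close> and \<open>G\<close>.\<close>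
    have e: "F + G - G = F" by (rule add_diff_cancel_right')
    show "X.Psi (phiF (F + G)) = (\<lambda>u\<in>carrier X.F1. X.Psi (phiF F) u + X.Psi (phiF G) u)"
    proof (rule X.Z1_ext[OF PZ[OF H] X.Z1_closed(1)[OF PZ[OF F] PZ[OF G]]])
      fix u assume u: "u \<in> carrier X.F1"
      show "X.Psi (phiF (F + G)) u = (\<lambda>u\<in>carrier X.F1. X.Psi (phiF F) u + X.Psi (phiF G) u) u"
        using Psi_phiF_diff[OF t u, unfolded e] u by simp
    qed
  qed (rule PZ)
  show "X.Psi (phiF F) \<in> X.B1 \<longleftrightarrow> F \<in> tot_coboundaries A M N 1" if "F \<in> tot_cocycles A M N 1" for F
    by (rule Psi_phiF_B1[OF that])
  show "tot_coboundaries A M N 1 \<subseteq> tot_cocycles A M N 1" using coboundary_cocycle by blast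
  show "\<exists>F\<in>tot_cocycles A M N 1. \<exists>b\<in>X.B1. X.Psi (phiF F) = b \<otimes>\<^bsub>X.Zgroup\<^esub> h" if h: "h \<in> X.Z1" for h
  proof -
    \<comment> \<open>Surjectivity modulo \<open>B1\<close>: \<open>h\<close> is represented by a
      cocycle of the double, whose restrictions to \<open>A\<close> and the dual are then realised
      by a total cocycle.\<close>
    obtain \<phi> b where p: "dcocycle \<phi>" and b: "b \<in> X.B1" "\<And>u. u \<in> carrier X.F1 \<Longrightarrow> X.Psi \<phi> u = h u + b u"
      using X.Z1_representative[OF h] unfolding kcoc_dcocycle by blast
    note D = dcocycle_data[OF p]
    obtain F where F: "F \<in> tot A M N 1" "\<And>a m. omF F a m = \<phi> (TD \<epsilon> a) m" "\<And>q m. q \<in> vec DA \<Longrightarrow> laF F q m = \<phi> (TD q 1) m"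
      using cochain_exists[OF D(1)] by blast
    note C = ext_data_cong[OF cochain_data(1)[OF F(1)] D(1) F(2,3)]
    have Z: "F \<in> tot_cocycles A M N 1" using C(1-3) D(2-4) cocycle_iff[OF F(1)] by blast
    have "X.Psi (phiF F) = X.Psi \<phi>" by (rule Psi_cong) (simp add: C(4) D(5))
    moreover have "b \<in> X.Z1" using b(1) subgroup.subset[OF X.subgroup_B1] by (auto simp: X.Zgroup_simps)
    ultimately have "X.Psi (phiF F) = b \<otimes>\<^bsub>X.Zgroup\<^esub> h"
      unfolding X.Zgroup_simps using PZ[OF Z] h X.Z1_closed(1)
      by (intro X.Z1_ext) (auto simp: b(2) add.commute)
    then show ?thesis using Z b(1) by blast
  qed
qed

end

theorem mainTheorem4:
  fixes A :: "('k::field, 'a::ring_1) hopf"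
    and M :: "('k, 'a, 'm::ab_group_add) yd"
    and N :: "('k, 'a, 'n::ab_group_add) yd"
  assumes "hopf_algebra A"
    and "finite_dim (sc A)"
    and "yetter_drinfeld A M"
    and "yetter_drinfeld A N"
  shows "yd_cohomology A M N 1 \<cong> Ext1 (double A) (double_module A M) (double_module A N)"
proof -
  have fd: "fd_hopf A" using assms(1,2) by (intro fd_hopf.intro fd_hopf_axioms.intro)
  interpret yd_two A M N
    by (intro yd_two.intro fd yd_hopf.intro assms)
  show ?thesis by (rule cohomology_iso_Ext1)
qed

end
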